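(* Let $\mathcal{F}$ be a family of finite graphs whose vertex degrees are uniformly bounded. Suppose that for every $\lambda>0$ there is a modulus of continuity $\omega$ such that $\mathcal{F}$ has asymptotically $\omega$-uniformly continuous IDSs (for potentials bounded by $\lambda$). Then $\mathcal{F}$ has asymptotically dense delocalization.
   Context: For a finite graph $\mathcal{G}$ with vertex set $\mathcal{V}(\mathcal{G})$ and a potential $V:\mathcal{V}(\mathcal{G})\to[-\lambda,\lambda]$, the Schr\"odinger operator $H_{\mathcal{G},V}$ on $\ell^2(\mathcal{V}(\mathcal{G}))$ is $(H_{\mathcal{G},V}\phi)(v)=\sum_{v'\sim v}[\phi(v')-\phi(v)]+V(v)\phi(v)$, where $v'\sim v$ means adjacency. $\sigma_{V,v}$ denotes the spectral measure of $H_{\mathcal{G},V}$ at $\delta_v$, i.e. $\langle\delta_v,g(H_{\mathcal{G},V})\delta_v\rangle=\int g\,d\sigma_{V,v}$ for continuous $g$. The integrated density of states (IDS) is $\mathcal{N}_{V,\mathcal{G}}(E)=\#\{i:E_i\le E\}/\#\mathcal{V}(\mathcal{G})$, where $E_1\le\dots\le E_{\#\mathcal{V}(\mathcal{G})}$ are the eigenvalues of $H_{\mathcal{G},V}$ with multiplicity. A modulus of continuity is a non-decreasing function $\omega:\mathbb{R}^+\to\mathbb{R}^+\cup\{+\infty\}$ with $\omega(t)\to0$ as $t\to0^+$; $g:\mathbb{R}\to\mathbb{R}$ is $\omega$-uniformly continuous if $|g(x)-g(y)|\le\omega(|x-y|)$ for all $x\ne y$. A family $\mathcal{M}$ of functions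 $\mathbb{R}\to\mathbb{R}$ is $\varepsilon$-quasi $\omega$-uniformly continuous if for every $f\in\mathcal{M}$ there is an $\omega$-uniformly continuous $g:\mathbb{R}\to\mathbb{R}$ with $\|f-g\|_\infty\le\varepsilon$. Given $\lambda>0$, $\mathcal{F}$ has asymptotically $\omega$-uniformly continuous IDSs if for every $\varepsilon>0$ there is $N_\varepsilon$ such that $\{\mathcal{N}_{V,\mathcal{G}}:\mathcal{G}\in\mathcal{F},\ \#\mathcal{V}(\mathcal{G})\ge N_\varepsilon,\ V:\mathcal{V}(\mathcal{G})\to[-\lambda,\lambda]\}$ is $\varepsilon$-quasi $\omega$-uniformly continuous. $\mathcal{F}$ has asymptotically dense delocalization if for all $\lambda,\varepsilon,\delta>0$ there is $N_{\mathcal{F}}(\lambda,\varepsilon,\delta)>0$ such that for every $\mathcal{G}\in\mathcal{F}$ with $\#\mathcal{V}(\mathcal{G})>N_{\mathcal{F}}(\lambda,\varepsilon,\delta)$ and every $V:\mathcal{V}(\mathcal{G})\to[-\lambda,\lambda]$ there is a potential $W:\mathcal{V}(\mathcal{G})\to[-\lambda,\lambda]$ with $\|V-W\|_\infty<\delta$ such that, for at least $(1-\delta)\#\mathcal{V}(\mathcal{G})$ vertices $v$, the spectral measure $\sigma_{W,v}$ has no atom of weight larger than $\varepsilon$. *)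

theory Defs
  imports
    "HOL-Analysis.Analysis"
    "HOL-Library.Function_Algebras"
    "HOL-Library.Multiset"
    "Graph_Theory.Digraph"
begin

text \<open>
  Finite simple graphs are symmetric digraphs without loops and multiple arcs (locale
  \<^locale>\<open>graph\<close>); \<open>u \<rightarrow>\<^bsub>G\<^esub> v\<close> is adjacency and \<^const>\<open>out_degree\<close> is the vertex degree.
  Elements of the $\ell^2$ space of the vertex set are the complex functions on the whole vertex
  type that vanish off \<^term>\<open>verts G\<close>.  Values of a potential off \<^term>\<open>verts G\<close> are never used.
\<close>

definition ell2 :: "('a, 'b) pre_digraph \<Rightarrow> ('a \<Rightarrow> complex) set" where
  "ell2 G = {\<phi>. \<forall>v. v \<notin> verts G \<longrightarrow> \<phi> v = 0}"

definition ell2_inner :: "('a, 'b) pre_digraph \<Rightarrow> ('a \<Rightarrow> complex) \<Rightarrow> ('a \<Rightarrow> complex) \<Rightarrow> complex" where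
  "ell2_inner G \<phi> \<psi> = (\<Sum>v\<in>verts G. cnj (\<phi> v) * \<psi> v)"

definition fscale :: "complex \<Rightarrow> ('a \<Rightarrow> complex) \<Rightarrow> 'a \<Rightarrow> complex" where
  "fscale c \<phi> = (\<lambda>v. c * \<phi> v)"

global_interpretation cfun: vector_space fscale
  by unfold_locales (auto simp: fscale_def fun_eq_iff algebra_simps)

definition delta :: "'a \<Rightarrow> 'a \<Rightarrow> complex" where
  "delta v = (\<lambda>u. if u = v then 1 else 0)"

definition schroedinger ::
  "('a, 'b) pre_digraph \<Rightarrow> ('a \<Rightarrow> real) \<Rightarrow> ('a \<Rightarrow> complex) \<Rightarrow> 'a \<Rightarrow> complex" where
  "schroedinger G V \<phi> = (\<lambda>v.
     if v \<in> verts G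
     then (\<Sum>v' | v' \<in> verts G \<and> v \<rightarrow>\<^bsub>G\<^esub> v'. \<phi> v' - \<phi> v) + complex_of_real (V v) * \<phi> v
     else 0)"

text \<open>The operator is self-adjoint, so only real eigenvalues have to be considered.\<close>

definition eigenspace :: "('a, 'b) pre_digraph \<Rightarrow> ('a \<Rightarrow> real) \<Rightarrow> real \<Rightarrow> ('a \<Rightarrow> complex) set" where
  "eigenspace G V E = {\<phi> \<in> ell2 G. schroedinger G V \<phi> = fscale (complex_of_real E) \<phi>}"

definition eigenvalues :: "('a, 'b) pre_digraph \<Rightarrow> ('a \<Rightarrow> real) \<Rightarrow> real set" where
  "eigenvalues G V = {E. \<exists>\<phi>\<in>eigenspace G V E. \<phi> \<noteq> 0}"

definition eigenvalue_mset :: "('a, 'b) pre_digraph \<Rightarrow> ('a \<Rightarrow> real) \<Rightarrow> real multiset" where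
  "eigenvalue_mset G V =
     (\<Sum>E\<in>eigenvalues G V. replicate_mset (cfun.dim (eigenspace G V E)) E)"

definition IDS :: "('a \<Rightarrow> real) \<Rightarrow> ('a, 'b) pre_digraph \<Rightarrow> real \<Rightarrow> real" where
  "IDS V G = (\<lambda>E. real (size {# e \<in># eigenvalue_mset G V. e \<le> E #}) / real (card (verts G)))"

text \<open>
  The orthogonal projection onto an eigenspace, and the functional calculus
  $g(H) = \sum_E g(E) P_E$.
\<close>

definition eigenproj ::
  "('a, 'b) pre_digraph \<Rightarrow> ('a \<Rightarrow> real) \<Rightarrow> real \<Rightarrow> ('a \<Rightarrow> complex) \<Rightarrow> 'a \<Rightarrow> complex" where
  "eigenproj G V E \<phi> =
     (THE \<psi>. \<psi> \<in> eigenspace G V E \<and> (\<forall>\<eta>\<in>eigenspace G V E. ell2_inner G \<eta> (\<phi> - \<psi>) = 0))"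

definition fun_calc ::
  "(real \<Rightarrow> complex) \<Rightarrow> ('a, 'b) pre_digraph \<Rightarrow> ('a \<Rightarrow> real) \<Rightarrow> ('a \<Rightarrow> complex) \<Rightarrow> 'a \<Rightarrow> complex" where
  "fun_calc g G V \<phi> = (\<Sum>E\<in>eigenvalues G V. fscale (g E) (eigenproj G V E \<phi>))"

text \<open>
  For a finite graph and one of its vertices, this measure exists and is unique; it is finite
  because constants are integrable.
\<close>

definition spectral_measure :: "('a, 'b) pre_digraph \<Rightarrow> ('a \<Rightarrow> real) \<Rightarrow> 'a \<Rightarrow> real measure" where
  "spectral_measure G V v = (THE \<sigma>. sets \<sigma> = sets borel \<and>
     (\<forall>g :: real \<Rightarrow> complex. continuous_on UNIV g \<longrightarrow>
        integrable \<sigma> g \<and>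
        ell2_inner G (delta v) (fun_calc g G V (delta v)) = integral\<^sup>L \<sigma> g))"

text \<open>
  A modulus of continuity lives on $(0,\infty)$; its values at other arguments are irrelevant.
  The value 0 is allowed.
\<close>

definition modulus_of_continuity :: "(real \<Rightarrow> ennreal) \<Rightarrow> bool" where
  "modulus_of_continuity \<omega> \<longleftrightarrow> mono_on {0<..} \<omega> \<and> (\<omega> \<longlongrightarrow> 0) (at_right 0)"

definition modulus_uniformly_continuous :: "(real \<Rightarrow> ennreal) \<Rightarrow> (real \<Rightarrow> real) \<Rightarrow> bool" where
  "modulus_uniformly_continuous \<omega> g \<longleftrightarrow>
     (\<forall>x y. x \<noteq> y \<longrightarrow> ennreal \<bar>g x - g y\<bar> \<le> \<omega> \<bar>x - y\<bar>)"

definition quasi_uniformly_continuous ::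
  "real \<Rightarrow> (real \<Rightarrow> ennreal) \<Rightarrow> (real \<Rightarrow> real) set \<Rightarrow> bool" where
  "quasi_uniformly_continuous \<epsilon> \<omega> M \<longleftrightarrow>
     (\<forall>f\<in>M. \<exists>g. modulus_uniformly_continuous \<omega> g \<and> (\<forall>x. \<bar>f x - g x\<bar> \<le> \<epsilon>))"

definition asymptotically_uniformly_continuous_IDSs ::
  "real \<Rightarrow> (real \<Rightarrow> ennreal) \<Rightarrow> ('a, 'b) pre_digraph set \<Rightarrow> bool" where
  "asymptotically_uniformly_continuous_IDSs lam \<omega> \<F> \<longleftrightarrow>
     (\<forall>\<epsilon>>0. \<exists>N::nat. quasi_uniformly_continuous \<epsilon> \<omega>
        {IDS V G | V G. G \<in> \<F> \<and> N \<le> card (verts G) \<and> V \<in> verts G \<rightarrow> {-lam..lam}})"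

text \<open>
  Since the vertex set is finite and non-empty here, \<open>\<parallel>V - W\<parallel> < \<delta>\<close> in the supremum norm
  is the strict inequality at every vertex.
\<close>

definition asymptotically_dense_delocalization :: "('a, 'b) pre_digraph set \<Rightarrow> bool" where
  "asymptotically_dense_delocalization \<F> \<longleftrightarrow>
     (\<forall>lam>0. \<forall>\<epsilon>>0. \<forall>\<delta>>0. \<exists>N::nat. N > 0 \<and>
        (\<forall>G\<in>\<F>. \<forall>V \<in> verts G \<rightarrow> {-lam..lam}. card (verts G) > N \<longrightarrow>
           (\<exists>W \<in> verts G \<rightarrow> {-lam..lam}.
              (\<forall>v\<in>verts G. \<bar>V v - W v\<bar> < \<delta>) \<and>
              real (card {v \<in> verts G. \<not> (\<exists>E. measure (spectral_measure G W v) {E} > \<epsilon>)})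
                \<ge> (1 - \<delta>) * real (card (verts G)))))"

end

theory Submission
  imports Defs
begin

text \<open>
  Measure the localization of the operator with potential \<open>W\<close> by the number \<open>\<Phi>(W)\<close> of pairs of
  eigenvalues at distance at most \<open>\<rho>\<close>, each eigenvalue weighted by the spectral measure at \<open>v\<close>,
  averaged over \<open>v\<close>; it lies in $[0,1]$.  If a positive proportion of the vertices carry an atom of
  weight more than \<open>\<epsilon>\<close>, then an arbitrarily small change of the potential lowers \<open>\<Phi>\<close> by a definite
  amount, with \<open>\<rho>\<close> replaced by a much smaller scale.  Boundedly many such changes remove almost all
  atoms.

  For one change, choose for each of these vertices a scale on which its atom is isolated in its
  spectral measure, keep the vertices with the most popular scale, and thin them out to a set \<open>J\<close>
  so that the eigenfunction \<open>\<psi>\<close> belonging to \<open>v \<in> J\<close> has little mass on \<open>J - {v}\<close>.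
  Vary the potential on \<open>J\<close> only: to first order the atom at \<open>v\<close> then moves with the value at \<open>v\<close>
  alone, so by the Poincare--Miranda theorem some such potential makes a grid energy \<open>\<gamma>\<close> split the
  atom of every \<open>v \<in> J\<close> into two equal parts.  By the continuity of the
  integrated density of states few eigenvalues lie close to the finitely many grid energies, so for
  most \<open>v \<in> J\<close> the two parts are separated by a gap.
\<close>

section \<open>Real symmetric matrices on a finite set\<close>

text \<open>The drop of \<Phi> gained by one change depends on \<epsilon> and \<delta> alone, never
  on \<rho>. Hence the number of changes is bounded before any scale or graph is chosen. The scales
  may shrink without control, but they are finitely many, so one threshold for the number of
  vertices serves all of them. The obstacle is that a new potential disturbs every spectral measure,
  not only those at the vertices being treated. Counting pairs up to a fixed distance survives this:
  a continuous kernel fits between the indicator functions at \<rho>/2 and \<rho>, and its form is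
  controlled by finitely many moments. The price is a halved scale and half of the gain.
  Poincare--Miranda supplies a potential of which only the size and the balance equations are known.
  So the splitting energies come from a grid fixed in advance, and the spectrum must be sparse near
  it for all admissible potentials at once; the uniformity over potentials in the hypothesis on the
  IDSs provides this. Bounded degrees make the moment bounds, the polynomial approximations and the
  grid independent of the graph.\<close>

definition ip :: "'a set \<Rightarrow> ('a \<Rightarrow> real) \<Rightarrow> ('a \<Rightarrow> real) \<Rightarrow> real" where
  "ip S x y = (\<Sum>v\<in>S. x v * y v)"

definition mat_app :: "'a set \<Rightarrow> ('a \<Rightarrow> 'a \<Rightarrow> real) \<Rightarrow> ('a \<Rightarrow> real) \<Rightarrow> 'a \<Rightarrow> real" where
  "mat_app S B x v = (\<Sum>u\<in>S. B v u * x u)"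

definition symmetric_on :: "'a set \<Rightarrow> ('a \<Rightarrow> 'a \<Rightarrow> real) \<Rightarrow> bool" where
  "symmetric_on S B \<longleftrightarrow> (\<forall>u\<in>S. \<forall>v\<in>S. B u v = B v u)"

text \<open>Only indices below \<open>card S\<close> and points of \<open>S\<close> matter. The last
  clause is orthonormality of the rows: for \<open>u = v\<close> it makes the squares
  \<open>(e i v)\<^sup>2\<close> a probability distribution over \<open>i\<close>, the weights of
  the spectral measure at \<open>v\<close>.\<close>

definition eigenbasis ::
  "'a set \<Rightarrow> ('a \<Rightarrow> 'a \<Rightarrow> real) \<Rightarrow> (nat \<Rightarrow> 'a \<Rightarrow> real) \<Rightarrow> (nat \<Rightarrow> real) \<Rightarrow> bool" where
  "eigenbasis S B e \<mu> \<longleftrightarrow>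
     (\<forall>i<card S. \<forall>j<card S. ip S (e i) (e j) = of_bool (i = j)) \<and>
     (\<forall>i<card S. \<forall>v\<in>S. mat_app S B (e i) v = \<mu> i * e i v) \<and>
     (\<forall>u\<in>S. \<forall>v\<in>S. (\<Sum>i<card S. e i u * e i v) = of_bool (u = v))"

lemma ip_commute: "ip S x y = ip S y x"
  by (simp add: ip_def mult.commute)

lemma ip_add_left: "ip S (\<lambda>v. x v + y v) z = ip S x z + ip S y z"
  by (simp add: ip_def distrib_right sum.distrib)

lemma ip_add_right: "ip S z (\<lambda>v. x v + y v) = ip S z x + ip S z y"
  by (simp add: ip_def distrib_left sum.distrib)

lemma ip_scale_left: "ip S (\<lambda>v. c * x v) z = c * ip S x z"
  by (simp add: ip_def sum_distrib_left mult.assoc)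

lemma ip_scale_right: "ip S z (\<lambda>v. c * x v) = c * ip S z x"
  by (simp add: ip_def sum_distrib_left mult.left_commute)

lemma ip_self_nonneg: "0 \<le> ip S x x"
  by (simp add: ip_def sum_nonneg)

lemma ip_self: "ip S x x = (L2_set x S)\<^sup>2"
  by (simp add: ip_def L2_set_def sum_nonneg power2_eq_square)

lemma ip_self_eq_0: "finite S \<Longrightarrow> ip S x x = 0 \<longleftrightarrow> (\<forall>v\<in>S. x v = 0)"
  by (simp add: ip_self L2_set_eq_0_iff)

lemma ip_cong: "(\<And>v. v \<in> S \<Longrightarrow> x v = x' v) \<Longrightarrow> (\<And>v. v \<in> S \<Longrightarrow> y v = y' v) \<Longrightarrow> ip S x y = ip S x' y'"
  by (simp add: ip_def)

lemma mat_app_cong: "(\<And>v. v \<in> S \<Longrightarrow> x v = x' v) \<Longrightarrow> mat_app S B x = mat_app S B x'"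
  by (auto simp: mat_app_def)

lemma mat_app_add: "mat_app S B (\<lambda>v. x v + y v) u = mat_app S B x u + mat_app S B y u"
  by (simp add: mat_app_def distrib_left sum.distrib)

lemma mat_app_scale: "mat_app S B (\<lambda>v. c * x v) u = c * mat_app S B x u"
  by (simp add: mat_app_def sum_distrib_left mult.left_commute)

lemma mat_app_sum: "mat_app S B (\<lambda>v. \<Sum>i\<in>I. x i v) u = (\<Sum>i\<in>I. mat_app S B (x i) u)"
  unfolding mat_app_def sum_distrib_left by (rule sum.swap)

lemma ip_sum_right: "ip S z (\<lambda>v. \<Sum>i\<in>I. x i v) = (\<Sum>i\<in>I. ip S z (x i))"
  unfolding ip_def sum_distrib_left by (rule sum.swap)

lemma ip_mat_app:
  assumes "symmetric_on S B"
  shows "ip S x (mat_app S B y) = ip S (mat_app S B x) y"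
proof -
  have "ip S x (mat_app S B y) = (\<Sum>v\<in>S. \<Sum>u\<in>S. x v * B v u * y u)"
    by (simp add: ip_def mat_app_def sum_distrib_left mult.assoc)
  also have "\<dots> = (\<Sum>u\<in>S. \<Sum>v\<in>S. x v * B v u * y u)"
    by (rule sum.swap)
  also have "\<dots> = (\<Sum>u\<in>S. \<Sum>v\<in>S. B u v * x v * y u)"
    using assms by (intro sum.cong) (auto simp: symmetric_on_def)
  finally show ?thesis
    by (simp add: ip_def mat_app_def sum_distrib_right)
qed

section \<open>Existence of an orthonormal eigenbasis\<close>

lemma compact_coordinatewise:
  fixes C :: "'a \<Rightarrow> real set"
  assumes "\<And>v. compact (C v)"
  shows "compact {x. \<forall>v. x v \<in> C v}"
proof -
  have "compactin (product_topology (\<lambda>i. euclidean) UNIV) (PiE UNIV C)"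
    using assms by (simp add: compactin_PiE)
  moreover have "PiE UNIV C = {x. \<forall>v. x v \<in> C v}"
    by (auto simp: PiE_def)
  ultimately show ?thesis
    by (simp only: euclidean_product_topology compactin_euclidean_iff)
qed

lemma continuous_on_ip [continuous_intros]:
  fixes f g :: "'b::topological_space \<Rightarrow> 'a \<Rightarrow> real"
  assumes "\<And>v. v \<in> S \<Longrightarrow> continuous_on T (\<lambda>s. f s v)" "\<And>v. v \<in> S \<Longrightarrow> continuous_on T (\<lambda>s. g s v)"
  shows "continuous_on T (\<lambda>s. ip S (f s) (g s))"
  unfolding ip_def using assms by (intro continuous_intros) auto

lemma continuous_on_mat_app [continuous_intros]:
  fixes B :: "'b::topological_space \<Rightarrow> 'a \<Rightarrow> 'a \<Rightarrow> real"
  assumes "\<And>u. u \<in> S \<Longrightarrow> continuous_on T (\<lambda>s. B s v u)" "\<And>u. u \<in> S \<Longrightarrow> continuous_on T (\<lambda>s. f s u)"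
  shows "continuous_on T (\<lambda>s. mat_app S (B s) (f s) v)"
  unfolding mat_app_def using assms by (intro continuous_intros) auto

lemma quadratic_nonneg_imp_linear_zero:
  fixes a b :: real
  assumes "\<And>t. 0 \<le> 2 * t * b + t\<^sup>2 * a"
  shows "b = 0"
proof (rule ccontr)
  assume "b \<noteq> 0"
  define c where "c = \<bar>a\<bar> + 1"
  have c: "c > 0" "a < c" by (auto simp: c_def)
  \<comment> \<open>At \<open>t = - b / c\<close> the linear term is
    \<open>- 2 * b\<^sup>2 / c\<close>, while the quadratic one is below
    \<open>b\<^sup>2 / c\<close> because \<open>a < c\<close>.\<close>
  have "0 \<le> 2 * (- b / c) * b + (- b / c)\<^sup>2 * a" by (rule assms)
  also have "\<dots> = b\<^sup>2 / c * (a / c - 2)"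
    using c by (simp add: field_simps power2_eq_square)
  also have "\<dots> < 0"
    using c \<open>b \<noteq> 0\<close> by (intro mult_pos_neg) (auto simp: field_simps)
  finally show False by simp
qed

text \<open>A maximiser of the Rayleigh quotient on an invariant subspace is an eigenvector.\<close>

lemma eigenvector_orthogonal_exists:
  fixes e :: "nat \<Rightarrow> 'a \<Rightarrow> real"
  assumes fin: "finite S" and sym: "symmetric_on S B"
    and eig: "\<And>i v. i < k \<Longrightarrow> v \<in> S \<Longrightarrow> mat_app S B (e i) v = \<mu> i * e i v"
    and ex: "ip S z z > 0" "\<And>i. i < k \<Longrightarrow> ip S (e i) z = 0"
  obtains x m where "ip S x x = 1" "\<And>i. i < k \<Longrightarrow> ip S (e i) x = 0"
    "\<And>v. v \<in> S \<Longrightarrow> mat_app S B x v = m * x v"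
proof -
  \<comment> \<open>Functions on the whole type are cut off outside \<open>S\<close>, and unit
    vectors have coordinates in \<open>{-1..1}\<close>; this puts the unit sphere inside a compact
    box of the product topology.\<close>
  define K where "K = {x. (\<forall>v. x v \<in> (if v \<in> S then {-1..1} else {0}))} \<inter>
    ({x. ip S x x = 1} \<inter> (\<Inter>i\<in>{..<k}. {x. ip S (e i) x = 0}))"
  have cont [continuous_intros]: "continuous_on UNIV (\<lambda>x::'a\<Rightarrow>real. x v)" for v
    by (rule continuous_on_product_coordinates)
  have "compact K"
    unfolding K_def
    by (intro compact_Int_closed compact_coordinatewise closed_Int closed_INT ballI
        closed_Collect_eq continuous_intros) auto
  have norm_mem: "(\<lambda>v. if v \<in> S then c * y v else 0) \<in> K"
    if y: "c\<^sup>2 * ip S y y = 1" "\<And>i. i < k \<Longrightarrow> ip S (e i) y = 0" for c y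
  proof -
    have 1: "ip S (\<lambda>v. if v \<in> S then c * y v else 0) (\<lambda>v. if v \<in> S then c * y v else 0)
        = ip S (\<lambda>v. c * y v) (\<lambda>v. c * y v)"
      by (rule ip_cong) auto
    have 2: "ip S (e i) (\<lambda>v. if v \<in> S then c * y v else 0) = ip S (e i) (\<lambda>v. c * y v)" for i
      by (rule ip_cong) auto
    have "\<bar>c * y v\<bar> \<le> 1" if "v \<in> S" for v
    proof -
      have "(c * y v)\<^sup>2 \<le> (\<Sum>v\<in>S. (c * y v)\<^sup>2)"
        using that fin by (intro member_le_sum) auto
      also have "\<dots> = c\<^sup>2 * ip S y y"
        by (simp add: ip_def sum_distrib_left power2_eq_square algebra_simps)
      finally show ?thesis using y by (simp add: abs_square_le_1)
    qed
    then show ?thesis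
      using y by (auto simp: K_def 1 2 ip_scale_left ip_scale_right power2_eq_square abs_le_iff)
  qed
  have "K \<noteq> {}"
    using norm_mem[of "1 / sqrt (ip S z z)" z] ex by (auto simp: power_divide)
  have "continuous_on K (\<lambda>x. ip S x (mat_app S B x))"
    by (rule continuous_on_subset[of UNIV]) (auto intro!: continuous_intros)
  from continuous_attains_sup[OF \<open>compact K\<close> \<open>K \<noteq> {}\<close> this]
  obtain x where x: "x \<in> K" "\<And>y. y \<in> K \<Longrightarrow> ip S y (mat_app S B y) \<le> ip S x (mat_app S B x)"
    by blast
  define m where "m = ip S x (mat_app S B x)"
  have xx: "ip S x x = 1" and xe: "\<And>i. i < k \<Longrightarrow> ip S (e i) x = 0"
    using x(1) by (auto simp: K_def)
  \<comment> \<open>Maximality on the unit sphere made homogeneous: this form is non-negative on the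
    complement of the \<open>e i\<close> and vanishes at \<open>x\<close>.\<close>
  have Q: "0 \<le> m * ip S y y - ip S y (mat_app S B y)" if y: "\<And>i. i < k \<Longrightarrow> ip S (e i) y = 0" for y
  proof (cases "ip S y y = 0")
    case True
    then have "\<forall>v\<in>S. y v = 0" using fin by (simp add: ip_self_eq_0)
    then have "ip S y (mat_app S B y) = 0" by (simp add: ip_def)
    then show ?thesis using True by simp
  next
    case False
    then have pos: "ip S y y > 0" using ip_self_nonneg[of S y] by linarith
    define c where "c = 1 / sqrt (ip S y y)"
    have c: "c\<^sup>2 * ip S y y = 1" using pos by (simp add: c_def power_divide)
    let ?y = "\<lambda>v. if v \<in> S then c * y v else 0"
    have "mat_app S B ?y = mat_app S B (\<lambda>v. c * y v)" by (rule mat_app_cong) auto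
    then have "ip S ?y (mat_app S B ?y) = ip S (\<lambda>v. c * y v) (\<lambda>v. c * mat_app S B y v)"
      by (intro ip_cong) (auto simp: mat_app_scale)
    also have "\<dots> = c\<^sup>2 * ip S y (mat_app S B y)"
      by (simp add: ip_scale_left ip_scale_right power2_eq_square)
    finally have "c\<^sup>2 * ip S y (mat_app S B y) \<le> m"
      using x(2)[OF norm_mem[OF c y]] by (simp add: m_def)
    also have "m = c\<^sup>2 * (m * ip S y y)" using c by (metis mult.left_commute mult.right_neutral)
    finally show ?thesis using pos by (simp add: c_def)
  qed
  \<comment> \<open>A non-negative form that vanishes at \<open>x\<close> has zero first variation
    there in every admissible direction.\<close>
  have orth: "ip S y (\<lambda>v. mat_app S B x v - m * x v) = 0"
    if y: "\<And>i. i < k \<Longrightarrow> ip S (e i) y = 0" for y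
  proof -
    define b where "b = m * ip S x y - ip S y (mat_app S B x)"
    define a where "a = m * ip S y y - ip S y (mat_app S B y)"
    have "0 \<le> 2 * t * b + t\<^sup>2 * a" for t
    proof -
      have eq: "mat_app S B (\<lambda>v. x v + t * y v) = (\<lambda>v. mat_app S B x v + t * mat_app S B y v)"
        by (auto simp: mat_app_add mat_app_scale)
      have s: "ip S x (mat_app S B y) = ip S y (mat_app S B x)"
        by (subst ip_mat_app[OF sym]) (rule ip_commute)
      have "0 \<le> m * ip S (\<lambda>v. x v + t * y v) (\<lambda>v. x v + t * y v)
          - ip S (\<lambda>v. x v + t * y v) (mat_app S B (\<lambda>v. x v + t * y v))"
        using y xe by (intro Q) (simp add: ip_add_right ip_scale_right)
      also have "\<dots> = 2 * t * b + t\<^sup>2 * a"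
        unfolding eq
        by (simp add: ip_add_right ip_scale_right ip_add_left ip_scale_left xx s a_def b_def
            ip_commute[of S y x] power2_eq_square algebra_simps flip: m_def)
      finally show ?thesis .
    qed
    then have "b = 0" by (rule quadratic_nonneg_imp_linear_zero)
    then show ?thesis
      using ip_add_right[of S y "mat_app S B x" "\<lambda>v. (- m) * x v"]
      by (simp only: ip_scale_right) (simp add: b_def ip_commute[of S y x])
  qed
  define r where "r = (\<lambda>v. mat_app S B x v - m * x v)"
  \<comment> \<open>The complement of the earlier eigenvectors is invariant, so the residual
    \<open>r\<close> is itself an admissible direction and hence orthogonal to itself.\<close>
  have "ip S (e i) r = 0" if i: "i < k" for i
  proof -
    have "ip S (e i) (mat_app S B x) = ip S (mat_app S B (e i)) x"
      by (rule ip_mat_app[OF sym])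
    also have "\<dots> = ip S (\<lambda>v. \<mu> i * e i v) x"
      using eig[OF i] by (intro ip_cong) auto
    finally have "ip S (e i) (mat_app S B x) = 0"
      using xe[OF i] by (simp add: ip_scale_left)
    then show ?thesis
      using ip_add_right[of S "e i" "mat_app S B x" "\<lambda>v. (- m) * x v"] xe[OF i]
      by (simp only: ip_scale_right) (simp add: r_def)
  qed
  then have "ip S r r = 0" using orth by (simp add: r_def)
  then have "\<forall>v\<in>S. r v = 0" using fin by (simp add: ip_self_eq_0)
  then show ?thesis using that[of x m] xx xe by (auto simp: r_def)
qed

lemma sum_delta_vec:
  assumes "finite S" "v \<in> S"
  shows "(\<Sum>u\<in>S. f u * of_bool (u = v)) = (f v :: real)"
  using assms by (simp add: of_bool_def if_distrib cong: if_cong)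

text \<open>\<open>z\<close> is the point mass at \<open>v\<close> minus its projection onto the
  first \<open>k\<close> vectors. A nonzero residual leaves room for another eigenvector; vanishing
  residuals express completeness.\<close>

lemma delta_residual:
  fixes e :: "nat \<Rightarrow> 'a \<Rightarrow> real"
  assumes fin: "finite S" and v: "v \<in> S"
    and on: "\<And>i j. i < k \<Longrightarrow> j < k \<Longrightarrow> ip S (e i) (e j) = of_bool (i = j)"
  defines "z \<equiv> \<lambda>u. of_bool (u = v) + (\<Sum>i<k. - (e i v * e i u))"
  shows "ip S z z = 1 - (\<Sum>i<k. (e i v)\<^sup>2)" and "\<And>i. i < k \<Longrightarrow> ip S (e i) z = 0"
proof -
  have ev: "ip S x (\<lambda>u. of_bool (u = v)) = x v" for x
    unfolding ip_def using fin v by (rule sum_delta_vec)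
  have z: "ip S x z = x v - (\<Sum>i<k. e i v * ip S x (e i))" for x
    unfolding z_def ip_add_right ip_sum_right ev
    using ip_scale_right[of S x "- e i v" "e i" for i] by (simp add: sum_negf)
  show 1: "ip S (e i) z = 0" if "i < k" for i
  proof -
    have "(\<Sum>j<k. e j v * ip S (e i) (e j)) = (\<Sum>j<k. e j v * of_bool (j = i))"
      using on that by (intro sum.cong) auto
    also have "\<dots> = e i v" using that by (intro sum_delta_vec) auto
    finally show ?thesis by (simp add: z)
  qed
  have "ip S z z = z v - (\<Sum>i<k. e i v * ip S (e i) z)"
    by (simp add: z ip_commute)
  also have "\<dots> = 1 - (\<Sum>i<k. (e i v)\<^sup>2)"
    using 1 by (simp add: z_def sum_negf power2_eq_square)
  finally show "ip S z z = 1 - (\<Sum>i<k. (e i v)\<^sup>2)" .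
qed

text \<open>For \<open>k\<close> orthonormal vectors the squared norms of the residuals of all point
  masses add up to \<open>card S - k\<close>. This is positive while \<open>k < card S\<close>,
  which admits the next eigenvector, and zero at the end, which is the completeness clause.\<close>

theorem eigenbasis_exists:
  assumes fin: "finite S" and sym: "symmetric_on S B"
  shows "\<exists>e \<mu>. eigenbasis S B e \<mu>"
proof -
  have tr: "(\<Sum>v\<in>S. \<Sum>i<k. (e i v)\<^sup>2) = real k"
    if "\<forall>i<k. \<forall>j<k. ip S (e i) (e j) = of_bool (i = j)" for k and e :: "nat \<Rightarrow> 'a \<Rightarrow> real"
  proof -
    have "(\<Sum>v\<in>S. \<Sum>i<k. (e i v)\<^sup>2) = (\<Sum>i<k. ip S (e i) (e i))"
      unfolding ip_def power2_eq_square by (rule sum.swap)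
    then show ?thesis using that by simp
  qed
  have "\<exists>e \<mu>. (\<forall>i<k. \<forall>j<k. ip S (e i) (e j) = of_bool (i = j)) \<and>
     (\<forall>i<k. \<forall>v\<in>S. mat_app S B (e i) v = \<mu> i * e i v)" if "k \<le> card S" for k
    using that
  proof (induction k)
    case (Suc k)
    then obtain e \<mu> where on: "\<forall>i<k. \<forall>j<k. ip S (e i) (e j) = of_bool (i = j)"
      and eig: "\<forall>i<k. \<forall>v\<in>S. mat_app S B (e i) v = \<mu> i * e i v"
      by auto
    define z where "z = (\<lambda>v u. of_bool (u = v) + (\<Sum>i<k. - (e i v * e i u)))"
    have z: "ip S (z v) (z v) = 1 - (\<Sum>i<k. (e i v)\<^sup>2)" "\<And>i. i < k \<Longrightarrow> ip S (e i) (z v) = 0"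
      if "v \<in> S" for v
      unfolding z_def using delta_residual[OF fin that, of k e] on by auto
    have "(\<Sum>v\<in>S. ip S (z v) (z v)) = (\<Sum>v\<in>S. 1 - (\<Sum>i<k. (e i v)\<^sup>2))"
      using z by simp
    also have "\<dots> = card S - k"
      using tr[OF on] Suc.prems by (simp add: sum_subtractf)
    finally have "(\<Sum>v\<in>S. ip S (z v) (z v)) > 0"
      using Suc.prems by simp
    then obtain v where v: "v \<in> S" "ip S (z v) (z v) > 0"
      by (meson not_le sum_nonpos)
    obtain x m where x: "ip S x x = 1" "\<And>i. i < k \<Longrightarrow> ip S (e i) x = 0"
      "\<And>v. v \<in> S \<Longrightarrow> mat_app S B x v = m * x v"
      by (rule eigenvector_orthogonal_exists[OF fin sym _ v(2) z(2)[OF v(1)], where \<mu> = \<mu>])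
        (use eig in auto)
    have "ip S x (e i) = 0" if "i < k" for i
      using x(2)[OF that] by (simp add: ip_commute)
    then show ?case
      using on eig x
      by (intro exI[of _ "e(k := x)"] exI[of _ "\<mu>(k := m)"])
        (auto simp: less_Suc_eq)
  qed auto
  from this[of "card S"] obtain e \<mu> where
    on: "\<forall>i<card S. \<forall>j<card S. ip S (e i) (e j) = of_bool (i = j)"
    and eig: "\<forall>i<card S. \<forall>v\<in>S. mat_app S B (e i) v = \<mu> i * e i v"
    by auto
  define z where "z = (\<lambda>v u. of_bool (u = v) + (\<Sum>i<card S. - (e i v * e i u)))"
  have z: "ip S (z v) (z v) = 1 - (\<Sum>i<card S. (e i v)\<^sup>2)" if "v \<in> S" for v
    unfolding z_def using delta_residual[OF fin that, of "card S" e] on by auto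
  have "(\<Sum>v\<in>S. ip S (z v) (z v)) = (\<Sum>v\<in>S. 1 - (\<Sum>i<card S. (e i v)\<^sup>2))"
    using z by simp
  also have "\<dots> = 0"
    using tr[OF on] by (simp add: sum_subtractf)
  finally have "\<forall>v\<in>S. \<forall>u\<in>S. z v u = 0"
    using fin by (simp add: sum_nonneg_eq_0_iff ip_self_nonneg ip_self_eq_0)
  then have "\<forall>u\<in>S. \<forall>v\<in>S. (\<Sum>i<card S. e i u * e i v) = of_bool (u = v)"
    by (auto simp: z_def sum_negf mult.commute)
  then show ?thesis
    using on eig unfolding eigenbasis_def by blast
qed

section \<open>Stability of the localization functional under perturbations of the potential\<close>

lemma eigenbasisD:
  assumes "eigenbasis S B e \<mu>"
  shows eigenbasis_orthonormal: "\<And>i j. i < card S \<Longrightarrow> j < card S \<Longrightarrow> ip S (e i) (e j) = of_bool (i = j)"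
    and eigenbasis_eigen: "\<And>i v. i < card S \<Longrightarrow> v \<in> S \<Longrightarrow> mat_app S B (e i) v = \<mu> i * e i v"
    and eigenbasis_complete: "\<And>u v. u \<in> S \<Longrightarrow> v \<in> S \<Longrightarrow> (\<Sum>i<card S. e i u * e i v) = of_bool (u = v)"
  using assms unfolding eigenbasis_def by blast+

lemma ip_delta:
  assumes "finite S" "v \<in> S"
  shows "ip S x (\<lambda>u. of_bool (u = v)) = x v"
  unfolding ip_def using assms by (rule sum_delta_vec)

lemma eigenbasis_expand:
  assumes "finite S" "eigenbasis S B e \<mu>" "v \<in> S"
  shows "x v = (\<Sum>i<card S. ip S (e i) x * e i v)"
proof -
  have "(\<Sum>i<card S. ip S (e i) x * e i v) = (\<Sum>i<card S. \<Sum>u\<in>S. x u * (e i u * e i v))"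
    by (simp add: ip_def sum_distrib_left sum_distrib_right mult_ac)
  also have "\<dots> = (\<Sum>u\<in>S. x u * (\<Sum>i<card S. e i u * e i v))"
    by (subst sum.swap) (simp add: sum_distrib_left)
  also have "\<dots> = (\<Sum>u\<in>S. x u * of_bool (u = v))"
    using eigenbasis_complete[OF assms(2) _ assms(3)] by (intro sum.cong) auto
  also have "\<dots> = x v"
    using assms by (intro sum_delta_vec) auto
  finally show ?thesis ..
qed

lemma parseval:
  assumes "finite S" "eigenbasis S B e \<mu>"
  shows "ip S x y = (\<Sum>i<card S. ip S (e i) x * ip S (e i) y)"
proof -
  have "ip S x y = (\<Sum>v\<in>S. x v * (\<Sum>i<card S. ip S (e i) y * e i v))"
    unfolding ip_def[of S x y]
    by (intro sum.cong refl) (simp flip: eigenbasis_expand[OF assms])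
  also have "\<dots> = (\<Sum>i<card S. \<Sum>v\<in>S. x v * (ip S (e i) y * e i v))"
    unfolding sum_distrib_left by (rule sum.swap)
  also have "\<dots> = (\<Sum>i<card S. ip S (e i) x * ip S (e i) y)"
    by (intro sum.cong refl) (simp add: ip_def[of S _ x] sum_distrib_left sum_distrib_right mult_ac)
  finally show ?thesis .
qed

lemma coef_mat_app:
  assumes "symmetric_on S B" "eigenbasis S B e \<mu>" "i < card S"
  shows "ip S (e i) (mat_app S B x) = \<mu> i * ip S (e i) x"
proof -
  have "ip S (e i) (mat_app S B x) = ip S (\<lambda>v. \<mu> i * e i v) x"
    unfolding ip_mat_app[OF assms(1)]
    using eigenbasis_eigen[OF assms(2,3)] by (intro ip_cong) auto
  then show ?thesis by (simp add: ip_scale_left)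
qed

lemma coef_mat_app_power:
  assumes "symmetric_on S B" "eigenbasis S B e \<mu>" "i < card S"
  shows "ip S (e i) ((mat_app S B ^^ k) x) = \<mu> i ^ k * ip S (e i) x"
  by (induction k) (simp_all add: coef_mat_app[OF assms])

lemma ip_mat_app_power:
  assumes "finite S" "symmetric_on S B" "eigenbasis S B e \<mu>"
  shows "ip S x ((mat_app S B ^^ k) y) = (\<Sum>i<card S. \<mu> i ^ k * (ip S (e i) x * ip S (e i) y))"
  unfolding parseval[OF assms(1,3), of x]
  by (intro sum.cong refl) (simp add: coef_mat_app_power[OF assms(2,3)])

text \<open>The residual has the coefficients of \<open>x\<close> multiplied by
  \<open>\<mu> i - a\<close>, so this is Chebyshev's inequality for the spectral measure of
  \<open>x\<close>. It turns approximate eigenvectors into spectral concentration.\<close>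

lemma chebyshev_spectral:
  assumes fin: "finite S" and sym: "symmetric_on S B" and eb: "eigenbasis S B e \<mu>"
    and t: "0 < t" and err: "L2_set (\<lambda>v. mat_app S B x v - a * x v) S \<le> \<eta>"
  shows "(\<Sum>i | i < card S \<and> t \<le> \<bar>\<mu> i - a\<bar>. (ip S (e i) x)\<^sup>2) \<le> (\<eta> / t)\<^sup>2"
proof -
  define r where "r = (\<lambda>v. mat_app S B x v - a * x v)"
  have co: "ip S (e i) r = (\<mu> i - a) * ip S (e i) x" if "i < card S" for i
    using ip_add_right[of S "e i" "mat_app S B x" "\<lambda>v. (- a) * x v"] coef_mat_app[OF sym eb that, of x]
    by (simp only: ip_scale_right) (simp add: r_def algebra_simps)
  have "t\<^sup>2 * (\<Sum>i | i < card S \<and> t \<le> \<bar>\<mu> i - a\<bar>. (ip S (e i) x)\<^sup>2)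
      = (\<Sum>i | i < card S \<and> t \<le> \<bar>\<mu> i - a\<bar>. (t * ip S (e i) x)\<^sup>2)"
    by (simp add: sum_distrib_left power_mult_distrib)
  also have "\<dots> \<le> (\<Sum>i | i < card S \<and> t \<le> \<bar>\<mu> i - a\<bar>. (ip S (e i) r)\<^sup>2)"
  proof (rule sum_mono)
    fix i assume "i \<in> {i. i < card S \<and> t \<le> \<bar>\<mu> i - a\<bar>}"
    then have "i < card S" "t\<^sup>2 \<le> (\<mu> i - a)\<^sup>2"
      using t by (auto simp: abs_le_square_iff[symmetric])
    then show "(t * ip S (e i) x)\<^sup>2 \<le> (ip S (e i) r)\<^sup>2"
      by (simp add: co power_mult_distrib mult_right_mono)
  qed
  also have "\<dots> \<le> (\<Sum>i<card S. (ip S (e i) r)\<^sup>2)"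
    by (rule sum_mono2) auto
  also have "\<dots> = (L2_set r S)\<^sup>2"
    using parseval[OF fin eb, of r r] by (simp add: ip_self power2_eq_square)
  also have "\<dots> \<le> \<eta>\<^sup>2"
    using err by (intro power_mono) (auto simp: r_def)
  finally show ?thesis
    using t by (simp add: power_divide field_simps)
qed

lemma ip_le_L2_set: "\<bar>ip S x y\<bar> \<le> L2_set x S * L2_set y S"
proof -
  have "\<bar>ip S x y\<bar> \<le> (\<Sum>v\<in>S. \<bar>x v\<bar> * \<bar>y v\<bar>)"
    unfolding ip_def by (rule order_trans[OF sum_abs]) (simp add: abs_mult)
  also have "\<dots> \<le> L2_set x S * L2_set y S"
    by (rule L2_set_mult_ineq)
  finally show ?thesis .
qed

lemma L2_set_mult_abs: "L2_set (\<lambda>v. c * x v) S = \<bar>c\<bar> * L2_set x S"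
  by (simp add: L2_set_def power_mult_distrib real_sqrt_mult flip: sum_distrib_left)

lemma L2_set_mult_le:
  assumes "\<And>v. v \<in> S \<Longrightarrow> \<bar>c v\<bar> \<le> h" "0 \<le> h"
  shows "L2_set (\<lambda>v. c v * x v) S \<le> h * L2_set x S"
proof -
  have "L2_set (\<lambda>v. c v * x v) S \<le> L2_set (\<lambda>v. h * x v) S"
    unfolding L2_set_def
  proof (intro real_sqrt_le_mono sum_mono)
    fix v assume "v \<in> S"
    then have "\<bar>c v * x v\<bar> \<le> \<bar>h * x v\<bar>"
      using assms(1)[of v] assms(2) by (simp add: abs_mult mult_right_mono)
    then show "(c v * x v)\<^sup>2 \<le> (h * x v)\<^sup>2"
      by (simp add: abs_le_square_iff)
  qed
  then show ?thesis using assms by (simp add: L2_set_mult_abs)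
qed

text \<open>The eigenvalue equation is read at a coordinate where the eigenvector is
  largest.\<close>

lemma eigenvalue_bound:
  assumes fin: "finite S" and eb: "eigenbasis S B e \<mu>" and i: "i < card S"
    and row: "\<And>v. v \<in> S \<Longrightarrow> (\<Sum>u\<in>S. \<bar>B v u\<bar>) \<le> M"
  shows "\<bar>\<mu> i\<bar> \<le> M"
proof -
  have ne: "S \<noteq> {}" using i by auto
  obtain v where v: "v \<in> S" "\<And>u. u \<in> S \<Longrightarrow> \<bar>e i u\<bar> \<le> \<bar>e i v\<bar>"
    using arg_min_if_finite(1)[OF fin ne, of "\<lambda>u. - \<bar>e i u\<bar>"]
      arg_min_least[OF fin ne, of _ "\<lambda>u. - \<bar>e i u\<bar>"] by (metis neg_le_iff_le)
  have "e i v \<noteq> 0"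
  proof
    assume "e i v = 0"
    then have "ip S (e i) (e i) = 0" using v(2) by (auto simp: ip_def)
    then show False using eigenbasis_orthonormal[OF eb i i] by simp
  qed
  have "\<bar>\<mu> i\<bar> * \<bar>e i v\<bar> = \<bar>mat_app S B (e i) v\<bar>"
    using eigenbasis_eigen[OF eb i v(1)] by (simp add: abs_mult)
  also have "\<dots> \<le> (\<Sum>u\<in>S. \<bar>B v u\<bar> * \<bar>e i v\<bar>)"
    unfolding mat_app_def
    by (rule order_trans[OF sum_abs]) (auto intro!: sum_mono mult_left_mono v(2) simp: abs_mult)
  also have "\<dots> \<le> M * \<bar>e i v\<bar>"
    using row[OF v(1)] by (simp add: mult_right_mono flip: sum_distrib_right)
  finally show ?thesis using \<open>e i v \<noteq> 0\<close> by simp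
qed

lemma L2_set_mat_app_le:
  assumes fin: "finite S" and sym: "symmetric_on S B"
    and row: "\<And>v. v \<in> S \<Longrightarrow> (\<Sum>u\<in>S. \<bar>B v u\<bar>) \<le> M"
  shows "L2_set (mat_app S B x) S \<le> M * L2_set x S"
proof (cases "S = {}")
  case False
  then obtain v where "v \<in> S" by auto
  then have M: "0 \<le> M" using row[of v] by (meson abs_ge_zero order_trans sum_nonneg)
  obtain e \<mu> where eb: "eigenbasis S B e \<mu>"
    using eigenbasis_exists[OF fin sym] by blast
  have "(L2_set (mat_app S B x) S)\<^sup>2 = (\<Sum>i<card S. (\<mu> i * ip S (e i) x)\<^sup>2)"
    unfolding ip_self[symmetric] parseval[OF fin eb, of "mat_app S B x"]
    by (intro sum.cong refl) (simp add: coef_mat_app[OF sym eb] power2_eq_square)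
  also have "\<dots> \<le> (\<Sum>i<card S. (M * ip S (e i) x)\<^sup>2)"
  proof (rule sum_mono)
    fix i assume "i \<in> {..<card S}"
    then have "\<bar>\<mu> i * ip S (e i) x\<bar> \<le> \<bar>M * ip S (e i) x\<bar>"
      using eigenvalue_bound[OF fin eb _ row, of i] M by (simp add: abs_mult mult_right_mono)
    then show "(\<mu> i * ip S (e i) x)\<^sup>2 \<le> (M * ip S (e i) x)\<^sup>2"
      by (simp add: abs_le_square_iff)
  qed
  also have "\<dots> = (M * L2_set x S)\<^sup>2"
    using parseval[OF fin eb, of x x]
    by (simp add: power_mult_distrib sum_distrib_left ip_self) (simp add: power2_eq_square)
  finally show ?thesis
    by (rule power2_le_imp_le) (use M in auto)
qed auto

text \<open>The expectation of \<open>f\<close> at the difference of two independent samples of the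
  spectral measure at \<open>v\<close>.\<close>

definition pair_form :: "'a set \<Rightarrow> (nat \<Rightarrow> 'a \<Rightarrow> real) \<Rightarrow> (nat \<Rightarrow> real) \<Rightarrow> (real \<Rightarrow> real) \<Rightarrow> 'a \<Rightarrow> real" where
  "pair_form S e \<mu> f v = (\<Sum>i<card S. \<Sum>j<card S. f (\<mu> i - \<mu> j) * ((e i v)\<^sup>2 * (e j v)\<^sup>2))"

lemma eigenbasis_row_norm:
  assumes "eigenbasis S B e \<mu>" "v \<in> S"
  shows "(\<Sum>i<card S. (e i v)\<^sup>2) = 1"
  using eigenbasis_complete[OF assms(1) assms(2) assms(2)] by (simp add: power2_eq_square)

lemma pair_form_le:
  assumes eb: "eigenbasis S B e \<mu>" and v: "v \<in> S"
    and le: "\<And>i j. i < card S \<Longrightarrow> j < card S \<Longrightarrow> f (\<mu> i - \<mu> j) \<le> g (\<mu> i - \<mu> j) + c"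
  shows "pair_form S e \<mu> f v \<le> pair_form S e \<mu> g v + c"
proof -
  have "pair_form S e \<mu> f v \<le>
      (\<Sum>i<card S. \<Sum>j<card S. (g (\<mu> i - \<mu> j) + c) * ((e i v)\<^sup>2 * (e j v)\<^sup>2))"
    unfolding pair_form_def using le by (intro sum_mono mult_right_mono) auto
  also have "\<dots> = pair_form S e \<mu> g v + c * ((\<Sum>i<card S. (e i v)\<^sup>2) * (\<Sum>j<card S. (e j v)\<^sup>2))"
    unfolding pair_form_def distrib_right sum.distrib sum_product
    by (simp add: sum_distrib_left)
  finally show ?thesis by (simp add: eigenbasis_row_norm[OF eb v])
qed

definition moment :: "'a set \<Rightarrow> (nat \<Rightarrow> 'a \<Rightarrow> real) \<Rightarrow> (nat \<Rightarrow> real) \<Rightarrow> nat \<Rightarrow> 'a \<Rightarrow> real" where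
  "moment S e \<mu> k v = (\<Sum>i<card S. \<mu> i ^ k * (e i v)\<^sup>2)"

text \<open>The binomial theorem separates the two eigenvalues, and the double sum factors into
  moments. These are diagonal entries of matrix powers, so no eigenvector has to be followed under
  perturbation.\<close>

lemma pair_form_polynomial:
  "pair_form S e \<mu> (\<lambda>x. \<Sum>d\<le>N. a d * x ^ d) v =
     (\<Sum>d\<le>N. a d * (\<Sum>q\<le>d. real (d choose q) * (-1) ^ (d - q) * (moment S e \<mu> q v * moment S e \<mu> (d - q) v)))"
proof -
  have *: "(\<Sum>i<card S. \<Sum>j<card S. (\<mu> i - \<mu> j) ^ d * ((e i v)\<^sup>2 * (e j v)\<^sup>2)) =
      (\<Sum>q\<le>d. real (d choose q) * (-1) ^ (d - q) * (moment S e \<mu> q v * moment S e \<mu> (d - q) v))" for d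
  proof -
    have "(\<mu> i - \<mu> j) ^ d * ((e i v)\<^sup>2 * (e j v)\<^sup>2) =
        (\<Sum>q\<le>d. real (d choose q) * (-1) ^ (d - q) *
           ((\<mu> i ^ q * (e i v)\<^sup>2) * (\<mu> j ^ (d - q) * (e j v)\<^sup>2)))" for i j
    proof -
      have "(\<mu> i + (- \<mu> j)) ^ d = (\<Sum>q\<le>d. real (d choose q) * \<mu> i ^ q * (- \<mu> j) ^ (d - q))"
        by (rule binomial_ring)
      then show ?thesis
        by (simp add: sum_distrib_right sum_distrib_left power_minus[of "\<mu> j"] mult_ac)
    qed
    then have "(\<Sum>i<card S. \<Sum>j<card S. (\<mu> i - \<mu> j) ^ d * ((e i v)\<^sup>2 * (e j v)\<^sup>2)) =
      (\<Sum>i<card S. \<Sum>j<card S. \<Sum>q\<le>d. real (d choose q) * (-1) ^ (d - q) *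
           ((\<mu> i ^ q * (e i v)\<^sup>2) * (\<mu> j ^ (d - q) * (e j v)\<^sup>2)))"
      by simp
    also have "\<dots> = (\<Sum>q\<le>d. \<Sum>i<card S. \<Sum>j<card S. real (d choose q) * (-1) ^ (d - q) *
           ((\<mu> i ^ q * (e i v)\<^sup>2) * (\<mu> j ^ (d - q) * (e j v)\<^sup>2)))"
      by (subst sum.swap, subst (2) sum.swap) (rule refl)
    also have "\<dots> = (\<Sum>q\<le>d. real (d choose q) * (-1) ^ (d - q) *
        (moment S e \<mu> q v * moment S e \<mu> (d - q) v))"
      unfolding moment_def sum_product by (simp add: sum_distrib_left)
    finally show ?thesis .
  qed
  have "pair_form S e \<mu> (\<lambda>x. \<Sum>d\<le>N. a d * x ^ d) v =
      (\<Sum>i<card S. \<Sum>j<card S. \<Sum>d\<le>N. a d * ((\<mu> i - \<mu> j) ^ d * ((e i v)\<^sup>2 * (e j v)\<^sup>2)))"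
    by (simp add: pair_form_def sum_distrib_left sum_distrib_right mult_ac)
  also have "\<dots> = (\<Sum>d\<le>N. \<Sum>i<card S. \<Sum>j<card S. a d * ((\<mu> i - \<mu> j) ^ d * ((e i v)\<^sup>2 * (e j v)\<^sup>2)))"
    by (subst sum.swap, subst (2) sum.swap) (rule refl)
  also have "\<dots> = (\<Sum>d\<le>N. a d * (\<Sum>q\<le>d. real (d choose q) * (-1) ^ (d - q) *
      (moment S e \<mu> q v * moment S e \<mu> (d - q) v)))"
    by (simp flip: * add: sum_distrib_left)
  finally show ?thesis .
qed

lemma moment_eq:
  assumes "finite S" "symmetric_on S B" "eigenbasis S B e \<mu>" "v \<in> S"
  shows "moment S e \<mu> k v = ip S (\<lambda>u. of_bool (u = v)) ((mat_app S B ^^ k) (\<lambda>u. of_bool (u = v)))"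
  unfolding ip_mat_app_power[OF assms(1-3)] moment_def
  using assms(1,4) by (simp add: ip_delta power2_eq_square)

lemma moment_abs_le:
  assumes "finite S" "eigenbasis S B e \<mu>" "v \<in> S" "1 \<le> M"
    and row: "\<And>v. v \<in> S \<Longrightarrow> (\<Sum>u\<in>S. \<bar>B v u\<bar>) \<le> M" and k: "k \<le> N"
  shows "\<bar>moment S e \<mu> k v\<bar> \<le> M ^ N"
proof -
  have "\<bar>moment S e \<mu> k v\<bar> \<le> (\<Sum>i<card S. \<bar>\<mu> i\<bar> ^ k * (e i v)\<^sup>2)"
    unfolding moment_def by (rule order_trans[OF sum_abs]) (simp add: abs_mult power_abs)
  also have "\<dots> \<le> (\<Sum>i<card S. M ^ N * (e i v)\<^sup>2)"
  proof (intro sum_mono mult_right_mono)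
    fix i assume "i \<in> {..<card S}"
    then have "\<bar>\<mu> i\<bar> ^ k \<le> M ^ k"
      using eigenvalue_bound[OF assms(1,2) _ row, of i] by (intro power_mono) auto
    also have "\<dots> \<le> M ^ N"
      using k assms(4) by (rule power_increasing)
    finally show "\<bar>\<mu> i\<bar> ^ k \<le> M ^ N" .
  qed auto
  also have "\<dots> = M ^ N"
    by (simp add: eigenbasis_row_norm[OF assms(2,3)] flip: sum_distrib_left)
  finally show ?thesis .
qed

definition add_potential :: "('a \<Rightarrow> 'a \<Rightarrow> real) \<Rightarrow> ('a \<Rightarrow> real) \<Rightarrow> 'a \<Rightarrow> 'a \<Rightarrow> real" where
  "add_potential B X v u = B v u + of_bool (u = v) * X v"

lemma mat_app_add_potential:
  assumes "finite S" "v \<in> S"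
  shows "mat_app S (add_potential B X) x v = mat_app S B x v + X v * x v"
proof -
  have "(\<Sum>u\<in>S. X u * x u * of_bool (u = v)) = X v * x v"
    using assms by (rule sum_delta_vec)
  moreover have "(\<Sum>u\<in>S. X u * x u * of_bool (u = v)) = (\<Sum>u\<in>S. of_bool (u = v) * X v * x u)"
    by (intro sum.cong) auto
  ultimately show ?thesis
    by (simp add: mat_app_def add_potential_def distrib_right sum.distrib)
qed

lemma symmetric_add_potential: "symmetric_on S B \<Longrightarrow> symmetric_on S (add_potential B X)"
  by (auto simp: symmetric_on_def add_potential_def)

text \<open>One more power splits the error into \<open>B\<close> applied to the previous error and
  \<open>X\<close> applied to the perturbed power. The exponent \<open>k\<close>, one more than
  telescoping gives, is affordable as \<open>1 \<le> M\<close>.\<close>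

lemma mat_app_power_diff:
  assumes fin: "finite S" and sym: "symmetric_on S B" and M: "1 \<le> M"
    and row: "\<And>v. v \<in> S \<Longrightarrow> (\<Sum>u\<in>S. \<bar>B v u\<bar>) \<le> M"
    and row': "\<And>v. v \<in> S \<Longrightarrow> (\<Sum>u\<in>S. \<bar>add_potential B X v u\<bar>) \<le> M"
    and X: "\<And>v. v \<in> S \<Longrightarrow> \<bar>X v\<bar> \<le> h" and h: "0 \<le> h"
  shows "L2_set (\<lambda>v. (mat_app S (add_potential B X) ^^ k) x v - (mat_app S B ^^ k) x v) S
    \<le> real k * M ^ k * h * L2_set x S"
proof (induction k)
  case (Suc k)
  let ?B' = "add_potential B X"
  define y where "y = (mat_app S B ^^ k) x"
  define y' where "y' = (mat_app S ?B' ^^ k) x"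
  have pow: "L2_set ((mat_app S ?B' ^^ k) x) S \<le> M ^ k * L2_set x S" for k
  proof (induction k)
    case (Suc k)
    have "L2_set ((mat_app S ?B' ^^ Suc k) x) S \<le> M * L2_set ((mat_app S ?B' ^^ k) x) S"
      using L2_set_mat_app_le[OF fin symmetric_add_potential[OF sym] row'] by simp
    also have "\<dots> \<le> M * (M ^ k * L2_set x S)"
      using Suc M by (intro mult_left_mono) auto
    finally show ?case by simp
  qed simp
  have "mat_app S ?B' y' v - mat_app S B y v = mat_app S B (\<lambda>u. y' u - y u) v + X v * y' v" if "v \<in> S" for v
    using mat_app_add[of S B y' "\<lambda>u. (-1) * y u" v] mat_app_add_potential[OF fin that, of B X y']
    by (simp only: mat_app_scale) simp
  then have "L2_set (\<lambda>v. mat_app S ?B' y' v - mat_app S B y v) S =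
      L2_set (\<lambda>v. mat_app S B (\<lambda>u. y' u - y u) v + X v * y' v) S"
    by (intro L2_set_cong) auto
  also have "\<dots> \<le> L2_set (mat_app S B (\<lambda>u. y' u - y u)) S + L2_set (\<lambda>v. X v * y' v) S"
    by (rule L2_set_triangle_ineq)
  also have "\<dots> \<le> M * L2_set (\<lambda>u. y' u - y u) S + h * L2_set y' S"
    using L2_set_mat_app_le[OF fin sym row] L2_set_mult_le[OF X h] by (intro add_mono) auto
  also have "\<dots> \<le> M * (real k * M ^ k * h * L2_set x S) + h * (M ^ k * L2_set x S)"
    using Suc pow[of k] M h by (intro add_mono mult_left_mono) (auto simp: y_def y'_def)
  also have "\<dots> \<le> M * (real k * M ^ k * h * L2_set x S) + h * (M ^ Suc k * L2_set x S)"
  proof -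
    have "1 * M ^ k \<le> M * M ^ k" using M by (intro mult_right_mono) auto
    then show ?thesis using h by (intro add_left_mono mult_left_mono mult_right_mono) auto
  qed
  also have "\<dots> = real (Suc k) * M ^ Suc k * h * L2_set x S"
    by (simp add: algebra_simps)
  finally show ?case by (simp add: y_def y'_def)
qed (simp add: L2_set_0')

lemma L2_set_delta:
  assumes "finite S" "v \<in> S"
  shows "L2_set (\<lambda>u. of_bool (u = v)) S = 1"
  using ip_self[of S "\<lambda>u. of_bool (u = v)"] ip_delta[OF assms, of "\<lambda>u. of_bool (u = v)"]
  by (simp add: power2_eq_1_iff) (smt (verit) L2_set_nonneg)

lemma moment_diff:
  assumes fin: "finite S" and sym: "symmetric_on S B" and M: "1 \<le> M"
    and row: "\<And>v. v \<in> S \<Longrightarrow> (\<Sum>u\<in>S. \<bar>B v u\<bar>) \<le> M"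
    and row': "\<And>v. v \<in> S \<Longrightarrow> (\<Sum>u\<in>S. \<bar>add_potential B X v u\<bar>) \<le> M"
    and X: "\<And>v. v \<in> S \<Longrightarrow> \<bar>X v\<bar> \<le> h" and h: "0 \<le> h"
    and eb: "eigenbasis S B e \<mu>" and eb': "eigenbasis S (add_potential B X) e' \<mu>'"
    and v: "v \<in> S" and k: "k \<le> N"
  shows "\<bar>moment S e' \<mu>' k v - moment S e \<mu> k v\<bar> \<le> real N * M ^ N * h"
proof -
  let ?d = "\<lambda>u. of_bool (u = v) :: real"
  have "moment S e' \<mu>' k v - moment S e \<mu> k v =
      ip S ?d (\<lambda>u. (mat_app S (add_potential B X) ^^ k) ?d u - (mat_app S B ^^ k) ?d u)"
    unfolding moment_eq[OF fin sym eb v] moment_eq[OF fin symmetric_add_potential[OF sym] eb' v]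
    by (simp add: ip_def right_diff_distrib sum_subtractf)
  then have "\<bar>moment S e' \<mu>' k v - moment S e \<mu> k v\<bar> \<le>
      L2_set ?d S * L2_set (\<lambda>u. (mat_app S (add_potential B X) ^^ k) ?d u - (mat_app S B ^^ k) ?d u) S"
    using ip_le_L2_set by metis
  also have "\<dots> \<le> real k * M ^ k * h"
    using mat_app_power_diff[OF fin sym M row row' X h, of k ?d] L2_set_delta[OF fin v] by simp
  also have "\<dots> \<le> real N * M ^ N * h"
    using k M h by (intro mult_right_mono mult_mono power_increasing) auto
  finally show ?thesis .
qed

text \<open>The kernel is replaced by a polynomial in \<open>\<mu> i - \<mu> j\<close>, so that the form becomes a
  polynomial in the moments, which are Lipschitz in the potential.\<close>

lemma pair_form_stable:
  assumes M: "1 \<le> M" and rho: "0 < \<rho>" and c: "0 < c"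
  obtains h0 where "0 < h0"
    "\<And>(S::'a set) B X e \<mu> e' \<mu>' v. \<lbrakk>finite S; symmetric_on S B;
      \<And>v. v \<in> S \<Longrightarrow> (\<Sum>u\<in>S. \<bar>B v u\<bar>) \<le> M;
      \<And>v. v \<in> S \<Longrightarrow> (\<Sum>u\<in>S. \<bar>add_potential B X v u\<bar>) \<le> M;
      \<And>v. v \<in> S \<Longrightarrow> \<bar>X v\<bar> \<le> h0;
      eigenbasis S B e \<mu>; eigenbasis S (add_potential B X) e' \<mu>'; v \<in> S\<rbrakk> \<Longrightarrow>
      pair_form S e' \<mu>' (\<lambda>x. of_bool (\<bar>x\<bar> \<le> \<rho> / 2)) v
        \<le> pair_form S e \<mu> (\<lambda>x. of_bool (\<bar>x\<bar> \<le> \<rho>)) v + c"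
proof -
  \<comment> \<open>A trapezoid: 1 up to \<open>\<rho> / 2\<close> and 0 from \<open>\<rho>\<close>
    on. It separates the two indicator functions in the claim, which is why the scale is
    halved.\<close>
  define f where "f = (\<lambda>x::real. max 0 (min 1 (2 - \<bar>x\<bar> * (2 / \<rho>))))"
  have "continuous_on {-2*M..2*M} f"
    unfolding f_def by (intro continuous_intros)
  then obtain p where p: "real_polynomial_function p" "\<And>x. x \<in> {-2*M..2*M} \<Longrightarrow> \<bar>f x - p x\<bar> < c / 4"
    using Stone_Weierstrass_real_polynomial_function[of "{-2*M..2*M}" f "c/4"] c by auto
  then obtain a N where pa: "p = (\<lambda>x. \<Sum>d\<le>N. a d * x ^ d)"
    unfolding real_polynomial_function_iff_sum by blast
  \<comment> \<open>\<open>C\<close> bounds the change of the polynomial form per unit of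
    \<open>h0\<close>. It involves only \<open>M\<close> and the polynomial, so \<open>h0\<close>
    does not depend on \<open>S\<close> or the matrix. Of the error \<open>c\<close>, half is spent
    on the moments and a quarter on each of the two passages between kernel and polynomial.\<close>
  define C where "C = (\<Sum>d\<le>N. \<bar>a d\<bar> * (\<Sum>q\<le>d. real (d choose q) * (2 * real N * M ^ N * M ^ N)))"
  have C: "0 \<le> C" unfolding C_def using M by (intro sum_nonneg mult_nonneg_nonneg) auto
  define h0 where "h0 = c / (2 * (C + 1))"
  have h0: "0 < h0" using c C by (simp add: h0_def)
  have Ch: "C * h0 \<le> c / 2" using c C by (simp add: h0_def field_simps)
  show ?thesis
  proof (rule that[OF h0])
    fix S :: "'a set" and B X e \<mu> e' \<mu>' v
    assume fin: "finite S" and sym: "symmetric_on S B"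
      and row: "\<And>v. v \<in> S \<Longrightarrow> (\<Sum>u\<in>S. \<bar>B v u\<bar>) \<le> M"
      and row': "\<And>v. v \<in> S \<Longrightarrow> (\<Sum>u\<in>S. \<bar>add_potential B X v u\<bar>) \<le> M"
      and X: "\<And>v. v \<in> S \<Longrightarrow> \<bar>X v\<bar> \<le> h0"
      and eb: "eigenbasis S B e \<mu>" and eb': "eigenbasis S (add_potential B X) e' \<mu>'" and v: "v \<in> S"
    define m where "m = (\<lambda>k. moment S e \<mu> k v)"
    define m' where "m' = (\<lambda>k. moment S e' \<mu>' k v)"
    have dm: "\<bar>m' q * m' r - m q * m r\<bar> \<le> 2 * real N * M ^ N * M ^ N * h0" if "q \<le> N" "r \<le> N" for q r
    proof -
      have d: "\<bar>m' k - m k\<bar> \<le> real N * M ^ N * h0" if "k \<le> N" for k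
        unfolding m_def m'_def using moment_diff[OF fin sym M row row' X _ eb eb' v that] h0 by auto
      have b: "\<bar>m k\<bar> \<le> M ^ N" "\<bar>m' k\<bar> \<le> M ^ N" if "k \<le> N" for k
        unfolding m_def m'_def
        using moment_abs_le[OF fin eb v M row that] moment_abs_le[OF fin eb' v M row' that] by auto
      have "m' q * m' r - m q * m r = m' q * (m' r - m r) + (m' q - m q) * m r"
        by (simp add: algebra_simps)
      also have "\<bar>\<dots>\<bar> \<le> \<bar>m' q\<bar> * \<bar>m' r - m r\<bar> + \<bar>m' q - m q\<bar> * \<bar>m r\<bar>"
        by (rule order_trans[OF abs_triangle_ineq]) (simp add: abs_mult)
      also have "\<dots> \<le> M ^ N * (real N * M ^ N * h0) + (real N * M ^ N * h0) * M ^ N"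
        using d b that M h0 by (intro add_mono mult_mono) auto
      finally show ?thesis by (simp add: algebra_simps)
    qed
    have "pair_form S e' \<mu>' p v - pair_form S e \<mu> p v =
       (\<Sum>d\<le>N. a d * (\<Sum>q\<le>d. real (d choose q) * (-1) ^ (d - q) * (m' q * m' (d - q) - m q * m (d - q))))"
      unfolding pa pair_form_polynomial m_def m'_def
      by (simp add: right_diff_distrib sum_subtractf)
    also have "\<dots> \<le> (\<Sum>d\<le>N. \<bar>a d\<bar> * (\<Sum>q\<le>d. real (d choose q) * (2 * real N * M ^ N * M ^ N * h0)))"
    proof (rule sum_mono)
      fix d assume d: "d \<in> {..N}"
      have "\<bar>\<Sum>q\<le>d. real (d choose q) * (-1) ^ (d - q) * (m' q * m' (d - q) - m q * m (d - q))\<bar>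
        \<le> (\<Sum>q\<le>d. real (d choose q) * \<bar>m' q * m' (d - q) - m q * m (d - q)\<bar>)"
        by (rule order_trans[OF sum_abs]) (simp add: abs_mult power_abs)
      also have "\<dots> \<le> (\<Sum>q\<le>d. real (d choose q) * (2 * real N * M ^ N * M ^ N * h0))"
        using d by (intro sum_mono mult_left_mono dm) auto
      finally have "\<bar>a d * (\<Sum>q\<le>d. real (d choose q) * (-1) ^ (d - q) * (m' q * m' (d - q) - m q * m (d - q)))\<bar>
        \<le> \<bar>a d\<bar> * (\<Sum>q\<le>d. real (d choose q) * (2 * real N * M ^ N * M ^ N * h0))"
        by (simp only: abs_mult) (rule mult_left_mono, auto)
      then show "a d * (\<Sum>q\<le>d. real (d choose q) * (-1) ^ (d - q) * (m' q * m' (d - q) - m q * m (d - q)))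
        \<le> \<bar>a d\<bar> * (\<Sum>q\<le>d. real (d choose q) * (2 * real N * M ^ N * M ^ N * h0))"
        by linarith
    qed
    also have "\<dots> = C * h0"
      by (simp add: C_def sum_distrib_left sum_distrib_right mult_ac)
    finally have pp: "pair_form S e' \<mu>' p v \<le> pair_form S e \<mu> p v + c / 2"
      using Ch by linarith
    have bd: "\<mu> i - \<mu> j \<in> {-2*M..2*M}" "\<mu>' i - \<mu>' j \<in> {-2*M..2*M}" if "i < card S" "j < card S" for i j
      using eigenvalue_bound[OF fin eb that(1) row] eigenvalue_bound[OF fin eb that(2) row]
        eigenvalue_bound[OF fin eb' that(1) row'] eigenvalue_bound[OF fin eb' that(2) row']
      by (auto simp: abs_le_iff)
    have f1: "of_bool (\<bar>x\<bar> \<le> \<rho> / 2) \<le> f x" and f2: "f x \<le> of_bool (\<bar>x\<bar> \<le> \<rho>)" for x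
      using rho by (auto simp: f_def of_bool_def field_simps)
    have "pair_form S e' \<mu>' (\<lambda>x. of_bool (\<bar>x\<bar> \<le> \<rho> / 2)) v \<le> pair_form S e' \<mu>' p v + c / 4"
    proof (rule pair_form_le[OF eb' v])
      fix i j assume "i < card S" "j < card S"
      then show "of_bool (\<bar>\<mu>' i - \<mu>' j\<bar> \<le> \<rho> / 2) \<le> p (\<mu>' i - \<mu>' j) + c / 4"
        using p(2)[of "\<mu>' i - \<mu>' j"] f1[of "\<mu>' i - \<mu>' j"] bd(2)[of i j] by linarith
    qed
    moreover have "pair_form S e \<mu> p v \<le> pair_form S e \<mu> (\<lambda>x. of_bool (\<bar>x\<bar> \<le> \<rho>)) v + c / 4"
    proof (rule pair_form_le[OF eb v])
      fix i j assume "i < card S" "j < card S"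
      then show "p (\<mu> i - \<mu> j) \<le> of_bool (\<bar>\<mu> i - \<mu> j\<bar> \<le> \<rho>) + c / 4"
        using p(2)[of "\<mu> i - \<mu> j"] f2[of "\<mu> i - \<mu> j"] bd(1)[of i j] by linarith
    qed
    ultimately show "pair_form S e' \<mu>' (\<lambda>x. of_bool (\<bar>x\<bar> \<le> \<rho> / 2)) v
        \<le> pair_form S e \<mu> (\<lambda>x. of_bool (\<bar>x\<bar> \<le> \<rho>)) v + c"
      using pp by linarith
  qed
qed

section \<open>Weakly interacting vertices and the Poincare--Miranda theorem\<close>

text \<open>Greedy form of a uniformly random colouring: each new point takes a colour whose
  interaction with the earlier points is at most the average over the \<open>k\<close>
  colours.\<close>

lemma balanced_colouring_exists:
  fixes a :: "'a \<Rightarrow> 'a \<Rightarrow> real"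
  assumes "finite B" and k: "0 < k"
  shows "\<exists>f. (\<forall>v\<in>B. f v < k) \<and>
    real k * (\<Sum>v\<in>B. \<Sum>j\<in>B. of_bool (j \<noteq> v \<and> f j = f v) * a v j)
      \<le> (\<Sum>v\<in>B. \<Sum>j\<in>B. of_bool (j \<noteq> v) * a v j)"
  using assms(1)
proof induction
  case (insert x F)
  then obtain f where f: "\<forall>v\<in>F. f v < k"
    "real k * (\<Sum>v\<in>F. \<Sum>j\<in>F. of_bool (j \<noteq> v \<and> f j = f v) * a v j)
      \<le> (\<Sum>v\<in>F. \<Sum>j\<in>F. of_bool (j \<noteq> v) * a v j)"
    by auto
  define b where "b = (\<lambda>j. a x j + a j x)"
  have "(\<Sum>c<k. \<Sum>j\<in>F. of_bool (f j = c) * b j) = (\<Sum>j\<in>F. \<Sum>c<k. b j * of_bool (c = f j))"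
    by (subst sum.swap) (auto intro!: sum.cong)
  also have "\<dots> = (\<Sum>j\<in>F. b j)"
    using f(1) by (intro sum.cong sum_delta_vec) auto
  finally have tot: "(\<Sum>c<k. \<Sum>j\<in>F. of_bool (f j = c) * b j) = (\<Sum>j\<in>F. b j)" .
  have "\<exists>c<k. real k * (\<Sum>j\<in>F. of_bool (f j = c) * b j) \<le> (\<Sum>j\<in>F. b j)"
  proof (rule ccontr)
    assume "\<not> ?thesis"
    then have "(\<Sum>c<k. (\<Sum>j\<in>F. b j)) < (\<Sum>c<k. real k * (\<Sum>j\<in>F. of_bool (f j = c) * b j))"
      using k by (intro sum_strict_mono) (auto simp: not_le)
    then show False using k tot by (simp flip: sum_distrib_left)
  qed
  then obtain c where c: "c < k" "real k * (\<Sum>j\<in>F. of_bool (f j = c) * b j) \<le> (\<Sum>j\<in>F. b j)"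
    by blast
  define g where "g = f(x := c)"
  have gx: "g x = c" and gF: "g j = f j" "j \<noteq> x" "x \<noteq> j" if "j \<in> F" for j
    using insert.hyps that by (auto simp: g_def)
  have split: "(\<Sum>v\<in>insert x F. \<Sum>j\<in>insert x F. P v j * a v j) =
      (\<Sum>v\<in>F. \<Sum>j\<in>F. P v j * a v j) + (\<Sum>j\<in>F. P x j * a x j + P j x * a j x)"
    if "P x x = 0" for P :: "'a \<Rightarrow> 'a \<Rightarrow> real"
    using insert.hyps that by (simp add: sum.distrib)
  have "(\<Sum>v\<in>insert x F. \<Sum>j\<in>insert x F. of_bool (j \<noteq> v \<and> g j = g v) * a v j) =
      (\<Sum>v\<in>F. \<Sum>j\<in>F. of_bool (j \<noteq> v \<and> g j = g v) * a v j) +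
      (\<Sum>j\<in>F. of_bool (j \<noteq> x \<and> g j = g x) * a x j + of_bool (x \<noteq> j \<and> g x = g j) * a j x)"
    by (rule split) simp
  also have "(\<Sum>v\<in>F. \<Sum>j\<in>F. of_bool (j \<noteq> v \<and> g j = g v) * a v j) =
      (\<Sum>v\<in>F. \<Sum>j\<in>F. of_bool (j \<noteq> v \<and> f j = f v) * a v j)"
    by (intro sum.cong refl) (simp add: gF)
  also have "(\<Sum>j\<in>F. of_bool (j \<noteq> x \<and> g j = g x) * a x j + of_bool (x \<noteq> j \<and> g x = g j) * a j x)
      = (\<Sum>j\<in>F. of_bool (f j = c) * b j)"
    by (intro sum.cong refl) (simp add: gF gx b_def distrib_left eq_commute[of c])
  finally have "real k * (\<Sum>v\<in>insert x F. \<Sum>j\<in>insert x F. of_bool (j \<noteq> v \<and> g j = g v) * a v j)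
      \<le> (\<Sum>v\<in>F. \<Sum>j\<in>F. of_bool (j \<noteq> v) * a v j) + (\<Sum>j\<in>F. b j)"
    using f(2) c(2) by (simp add: distrib_left)
  also have "(\<Sum>j\<in>F. b j) = (\<Sum>j\<in>F. of_bool (j \<noteq> x) * a x j + of_bool (x \<noteq> j) * a j x)"
    by (intro sum.cong refl) (simp add: gF b_def)
  also have "(\<Sum>v\<in>F. \<Sum>j\<in>F. of_bool (j \<noteq> v) * a v j) + \<dots> =
      (\<Sum>v\<in>insert x F. \<Sum>j\<in>insert x F. of_bool (j \<noteq> v) * a v j)"
    by (rule split[symmetric]) simp
  finally show ?case
    using f(1) c(1) by (intro exI[of _ g]) (auto simp: g_def)
qed auto

lemma large_fibre_exists:
  assumes "finite B" "0 < k" "\<And>v. v \<in> B \<Longrightarrow> f v < k"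
  shows "\<exists>c<k. card B \<le> k * card {v\<in>B. f v = (c::nat)}"
proof (rule ccontr)
  assume neg: "\<not> ?thesis"
  have "B = (\<Union>c\<in>{..<k}. {v\<in>B. f v = c})" using assms(3) by auto
  then have "card B = card (\<Union>c\<in>{..<k}. {v\<in>B. f v = c})" by simp
  also have "\<dots> = (\<Sum>c<k. card {v\<in>B. f v = c})"
    using assms(1) by (intro card_UN_disjoint) auto
  finally have "card B = (\<Sum>c<k. card {v\<in>B. f v = c})" .
  moreover have "(\<Sum>c<k. k * card {v\<in>B. f v = c}) < (\<Sum>c<k. card B)"
    using neg assms(2) by (intro sum_strict_mono) (auto simp: not_le)
  ultimately show False by (simp flip: sum_distrib_left)
qed

text \<open>The colouring makes the average same-colour interaction at most \<open>1 / k\<close>. By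
  Markov's inequality at most half of the points exceed \<open>2 / k\<close>; a largest colour class
  of the others is kept. In the application \<open>a v j\<close> is the squared value at
  \<open>j\<close> of the cluster vector of \<open>v\<close>.\<close>

lemma weakly_interacting_subset:
  fixes a :: "'a \<Rightarrow> 'a \<Rightarrow> real"
  assumes fin: "finite B" and k: "0 < k"
    and nonneg: "\<And>v j. 0 \<le> a v j" and row: "\<And>v. v \<in> B \<Longrightarrow> (\<Sum>j\<in>B. a v j) \<le> 1"
  obtains J where "J \<subseteq> B" "card B \<le> 2 * k * card J" "\<And>v. v \<in> J \<Longrightarrow> (\<Sum>j\<in>J - {v}. a v j) \<le> 2 / real k"
proof -
  obtain f where f: "\<forall>v\<in>B. f v < k"
    "real k * (\<Sum>v\<in>B. \<Sum>j\<in>B. of_bool (j \<noteq> v \<and> f j = f v) * a v j)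
      \<le> (\<Sum>v\<in>B. \<Sum>j\<in>B. of_bool (j \<noteq> v) * a v j)"
    using balanced_colouring_exists[OF fin k] by blast
  define w where "w = (\<lambda>v. \<Sum>j\<in>B. of_bool (j \<noteq> v \<and> f j = f v) * a v j)"
  have w0: "0 \<le> w v" for v
    unfolding w_def using nonneg by (intro sum_nonneg) auto
  have "(\<Sum>v\<in>B. \<Sum>j\<in>B. of_bool (j \<noteq> v) * a v j) \<le> (\<Sum>v\<in>B. \<Sum>j\<in>B. a v j)"
    using nonneg by (intro sum_mono) auto
  also have "\<dots> \<le> (\<Sum>v\<in>B. 1)"
    using row by (intro sum_mono)
  finally have tot: "real k * (\<Sum>v\<in>B. w v) \<le> real (card B)"
    using f(2) by (simp add: w_def)
  define B' where "B' = {v\<in>B. w v \<le> 2 / real k}"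
  have "real (card (B - B')) * 2 = real k * (\<Sum>v\<in>B-B'. 2 / real k)"
    using k by simp
  also have "\<dots> \<le> real k * (\<Sum>v\<in>B-B'. w v)"
    by (intro mult_left_mono sum_mono) (auto simp: B'_def)
  also have "\<dots> \<le> real k * (\<Sum>v\<in>B. w v)"
    using fin w0 by (intro mult_left_mono sum_mono2) auto
  finally have "2 * card (B - B') \<le> card B"
    using tot by linarith
  moreover have "card (B - B') = card B - card B'"
    using fin by (intro card_Diff_subset) (auto simp: B'_def)
  ultimately have half: "card B \<le> 2 * card B'" by linarith
  obtain c where c: "card B' \<le> k * card {v\<in>B'. f v = c}"
    using large_fibre_exists[of B' k f] fin k f(1) by (auto simp: B'_def)
  define J where "J = {v\<in>B'. f v = c}"
  show ?thesis
  proof (rule that[of J])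
    show "J \<subseteq> B" by (auto simp: J_def B'_def)
    show "card B \<le> 2 * k * card J" using half c by (simp add: J_def)
    fix v assume v: "v \<in> J"
    have "(\<Sum>j\<in>J - {v}. a v j) = (\<Sum>j\<in>J - {v}. of_bool (j \<noteq> v \<and> f j = f v) * a v j)"
      using v by (intro sum.cong) (auto simp: J_def)
    also have "\<dots> \<le> w v"
      unfolding w_def using fin nonneg \<open>J \<subseteq> B\<close> by (intro sum_mono2) auto
    also have "\<dots> \<le> 2 / real k" using v by (auto simp: J_def B'_def)
    finally show "(\<Sum>j\<in>J - {v}. a v j) \<le> 2 / real k" .
  qed
qed

section \<open>The Poincare--Miranda theorem\<close>

lemma tendsto_coordinatewise:
  fixes f :: "'b \<Rightarrow> 'a \<Rightarrow> 'c::topological_space"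
  assumes "\<And>i. ((\<lambda>x. f x i) \<longlongrightarrow> l i) F"
  shows "(f \<longlongrightarrow> l) F"
proof -
  have "limitin (product_topology (\<lambda>i. euclidean) UNIV) f l F"
    using assms by (simp add: limitin_componentwise)
  then show ?thesis by (simp only: euclidean_product_topology limitin_canonical_iff)
qed

text \<open>Kuhn's combinatorial lemma on finer and finer grids gives small cells with corners of
  either weak sign for every \<open>c i\<close>. Such cells accumulate at a point, where continuity
  forces all \<open>c i\<close> to vanish.\<close>

lemma poincare_miranda_nat:
  fixes c :: "nat \<Rightarrow> (nat \<Rightarrow> real) \<Rightarrow> real"
  assumes cont: "\<And>i. i < n \<Longrightarrow> continuous_on UNIV (c i)"
    and lo: "\<And>i y. i < n \<Longrightarrow> (\<And>j. 0 \<le> y j \<and> y j \<le> 1) \<Longrightarrow> y i = 0 \<Longrightarrow> c i y \<le> 0"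
    and hi: "\<And>i y. i < n \<Longrightarrow> (\<And>j. 0 \<le> y j \<and> y j \<le> 1) \<Longrightarrow> y i = 1 \<Longrightarrow> 0 \<le> c i y"
  obtains y where "\<And>j. 0 \<le> y j \<and> y j \<le> 1" "\<And>i. i < n \<Longrightarrow> c i y = 0"
proof -
  define pt where "pt = (\<lambda>(p::nat) x i. if i < n then real (x i) / real (Suc p) else 0)"
  \<comment> \<open>Inside the cube the label is the sign of \<open>c i\<close>; on the faces it is
    prescribed as Kuhn's lemma demands. There \<open>lo\<close> and \<open>hi\<close> supply the
    weak sign that the label stands for.\<close>
  define label where "label = (\<lambda>p (x::nat\<Rightarrow>nat) i. if x i = 0 then 0 else if x i = Suc p then 1
      else if c i (pt p x) < 0 then 0 else (1::nat))"
  define cell where "cell = (\<lambda>(q::nat\<Rightarrow>nat) r. \<forall>j<n. q j \<le> r j \<and> r j \<le> q j + 1)"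
  have ptb: "0 \<le> pt p x j \<and> pt p x j \<le> 1" if "\<And>i. i < n \<Longrightarrow> x i \<le> Suc p" for p x j
    using that[of j] by (simp add: pt_def del: of_nat_Suc)
  define good where "good = (\<lambda>p q. (\<forall>i<n. q i < Suc p) \<and>
    (\<forall>i<n. \<exists>r s. cell q r \<and> cell q s \<and> label p r i \<noteq> label p s i))"
  have "\<exists>q. good p q" for p
  proof (rule kuhn_lemma[of "Suc p" n "label p"])
    fix q assume "\<forall>i<n. q i < Suc p" "\<forall>i<n. \<exists>r s. (\<forall>j<n. q j \<le> r j \<and> r j \<le> q j + 1) \<and>
      (\<forall>j<n. q j \<le> s j \<and> s j \<le> q j + 1) \<and> label p r i \<noteq> label p s i"
    then show ?thesis unfolding good_def cell_def by (intro exI[of _ q] conjI)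
  qed (simp_all add: label_def)
  then obtain q where good: "\<And>p. good p (q p)" by metis
  have q: "\<And>p i. i < n \<Longrightarrow> q p i < Suc p"
    "\<And>p i. i < n \<Longrightarrow> \<exists>r s. cell (q p) r \<and> cell (q p) s \<and> label p r i \<noteq> label p s i"
    using good unfolding good_def by blast+
  have "\<exists>r s. cell (q p) r \<and> cell (q p) s \<and> c i (pt p r) \<le> 0 \<and> 0 \<le> c i (pt p s)" if i: "i < n" for p i
  proof -
    obtain r s where rs: "cell (q p) r" "cell (q p) s" "label p r i = 0" "label p s i = 1"
    proof -
      have lab: "label p x i = 0 \<or> label p x i = 1" for x by (simp add: label_def)
      obtain r s where "cell (q p) r" "cell (q p) s" "label p r i \<noteq> label p s i"
        using q(2)[OF i, of p] by blast
      then show ?thesis using lab[of r] lab[of s] that[of r s] that[of s r] by auto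
    qed
    have rb: "r j \<le> Suc p" "s j \<le> Suc p" if "j < n" for j
      using rs(1,2) q(1)[OF that, of p] that unfolding cell_def by (metis Suc_eq_plus1 Suc_leI le_trans)+
    have "c i (pt p r) \<le> 0"
      using rs(3) i lo[OF i, of "pt p r"] ptb[of r p] rb by (auto simp: label_def pt_def split: if_splits)
    moreover have "0 \<le> c i (pt p s)"
      using rs(4) i hi[OF i, of "pt p s"] ptb[of s p] rb by (auto simp: label_def pt_def split: if_splits)
    ultimately show ?thesis using rs by blast
  qed
  note corners = this
  define K where "K = {y::nat\<Rightarrow>real. \<forall>i. y i \<in> {0..1}}"
  have "seq_compact K"
    unfolding K_def by (intro compact_imp_seq_compact compact_coordinatewise) auto
  moreover have "pt p (q p) \<in> K" for p
    using ptb[of "q p" p] q(1) by (auto simp: K_def less_imp_le)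
  ultimately obtain y \<phi> where y: "y \<in> K" and phi: "strict_mono \<phi>" and
    lim: "((\<lambda>p. pt p (q p)) \<circ> \<phi>) \<longlonglongrightarrow> y"
    using seq_compactE[of K "\<lambda>p. pt p (q p)"] by blast
  have lim_i: "(\<lambda>p. pt (\<phi> p) (q (\<phi> p)) i) \<longlonglongrightarrow> y i" for i
  proof -
    have "isCont (\<lambda>y. y i) y"
      using continuous_on_product_coordinates continuous_on_eq_continuous_at open_UNIV UNIV_I by metis
    from isCont_tendsto_compose[OF this lim] show ?thesis by (simp add: o_def)
  qed
  \<comment> \<open>Every choice of corners has the same limit: cells have side
    \<open>1 / Suc (\<phi> p)\<close> in the first \<open>n\<close> coordinates, and
    \<open>pt\<close> is zero in the others.\<close>
  have lim_cell: "(\<lambda>p. pt (\<phi> p) (t p)) \<longlonglongrightarrow> y" if t: "\<And>p. cell (q (\<phi> p)) (t p)" for t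
  proof (rule tendsto_coordinatewise)
    fix i
    have "(\<lambda>p. 1 / real (Suc (\<phi> p))) \<longlonglongrightarrow> 0"
      using LIMSEQ_subseq_LIMSEQ[OF lim_1_over_n phi] LIMSEQ_subseq_LIMSEQ[OF LIMSEQ_inverse_real_of_nat phi]
      by (simp add: o_def inverse_eq_divide)
    then have "(\<lambda>p. pt (\<phi> p) (t p) i - pt (\<phi> p) (q (\<phi> p)) i) \<longlonglongrightarrow> 0"
    proof (rule tendsto_0_le[where K = 1], intro always_eventually allI)
      fix p
      show "norm (pt (\<phi> p) (t p) i - pt (\<phi> p) (q (\<phi> p)) i) \<le> norm (1 / real (Suc (\<phi> p))) * 1"
      proof (cases "i < n")
        case True
        then have "q (\<phi> p) i \<le> t p i" "t p i \<le> q (\<phi> p) i + 1"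
          using t[of p] by (auto simp: cell_def)
        then have "\<bar>real (t p i) - real (q (\<phi> p) i)\<bar> \<le> 1"
          by linarith
        then show ?thesis using True
          by (simp add: pt_def divide_right_mono flip: diff_divide_distrib)
      qed (simp add: pt_def)
    qed
    from tendsto_add[OF this lim_i[of i]] show "(\<lambda>p. pt (\<phi> p) (t p) i) \<longlonglongrightarrow> y i" by simp
  qed
  show ?thesis
  proof (rule that[of y])
    show "0 \<le> y j \<and> y j \<le> 1" for j using y by (auto simp: K_def)
    fix i assume i: "i < n"
    have "\<exists>r. \<forall>p. cell (q p) (r p) \<and> c i (pt p (r p)) \<le> 0"
      by (rule choice) (use corners[OF i] in blast)
    then obtain r where r: "\<And>p. cell (q p) (r p)" "\<And>p. c i (pt p (r p)) \<le> 0" by blast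
    have "\<exists>s. \<forall>p. cell (q p) (s p) \<and> 0 \<le> c i (pt p (s p))"
      by (rule choice) (use corners[OF i] in blast)
    then obtain s where s: "\<And>p. cell (q p) (s p)" "\<And>p. 0 \<le> c i (pt p (s p))" by blast
    have ci: "isCont (c i) y" using cont[OF i] by (simp add: continuous_on_eq_continuous_at)
    have "(\<lambda>p. c i (pt (\<phi> p) (r (\<phi> p)))) \<longlonglongrightarrow> c i y"
      using isCont_tendsto_compose[OF ci lim_cell, of "\<lambda>p. r (\<phi> p)"] r(1) by simp
    then have "c i y \<le> 0" by (rule LIMSEQ_le_const2) (use r(2) in auto)
    moreover have "(\<lambda>p. c i (pt (\<phi> p) (s (\<phi> p)))) \<longlonglongrightarrow> c i y"
      using isCont_tendsto_compose[OF ci lim_cell, of "\<lambda>p. s (\<phi> p)"] s(1) by simp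
    then have "0 \<le> c i y" by (rule LIMSEQ_le_const) (use s(2) in auto)
    ultimately show "c i y = 0" by simp
  qed
qed

lemma poincare_miranda:
  fixes c :: "'a \<Rightarrow> ('a \<Rightarrow> real) \<Rightarrow> real"
  assumes J: "finite J" and h: "0 < h"
    and cont: "\<And>j. j \<in> J \<Longrightarrow> continuous_on UNIV (c j)"
    and lo: "\<And>j s. j \<in> J \<Longrightarrow> (\<And>i. \<bar>s i\<bar> \<le> h) \<Longrightarrow> (\<And>i. i \<notin> J \<Longrightarrow> s i = 0) \<Longrightarrow> s j = - h \<Longrightarrow> c j s \<le> 0"
    and hi: "\<And>j s. j \<in> J \<Longrightarrow> (\<And>i. \<bar>s i\<bar> \<le> h) \<Longrightarrow> (\<And>i. i \<notin> J \<Longrightarrow> s i = 0) \<Longrightarrow> s j = h \<Longrightarrow> 0 \<le> c j s"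
  obtains s where "\<And>i. \<bar>s i\<bar> \<le> h" "\<And>i. i \<notin> J \<Longrightarrow> s i = 0" "\<And>j. j \<in> J \<Longrightarrow> c j s = 0"
proof -
  define n where "n = card J"
  obtain g where "bij_betw g {0..<card J} J"
    using ex_bij_betw_nat_finite[OF J] by blast
  then have g: "bij_betw g {..<n} J" by (simp add: n_def atLeast0LessThan)
  define g' where "g' = inv_into {..<n} g"
  have gJ: "g i \<in> J" "g' (g i) = i" if "i < n" for i
    using g that by (auto simp: g'_def bij_betw_def)
  have g'J: "g' j < n" "g (g' j) = j" if "j \<in> J" for j
    using g that by (auto simp: g'_def bij_betw_def inv_into_into f_inv_into_f)
  \<comment> \<open>Parametrises the functions supported in \<open>J\<close> with values between
    \<open>- h\<close> and \<open>h\<close> by the unit cube.\<close>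
  define \<Phi> where "\<Phi> = (\<lambda>(y::nat\<Rightarrow>real) j. if j \<in> J then h * (2 * y (g' j) - 1) else 0)"
  have contPhi: "continuous_on UNIV \<Phi>"
    unfolding \<Phi>_def
  proof (intro continuous_on_coordinatewise_then_product)
    show "continuous_on UNIV (\<lambda>y. if j \<in> J then h * (2 * y (g' j) - 1) else 0)" for j
      by (cases "j \<in> J") (auto intro!: continuous_intros continuous_on_product_coordinates)
  qed
  have bd: "\<bar>\<Phi> y j\<bar> \<le> h" if "\<And>i. 0 \<le> y i \<and> y i \<le> 1" for y j
  proof -
    have "\<bar>2 * y (g' j) - 1\<bar> \<le> 1" using that[of "g' j"] by (auto simp: abs_le_iff)
    then have "h * \<bar>2 * y (g' j) - 1\<bar> \<le> h * 1" using h by (intro mult_left_mono) auto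
    then show ?thesis using h by (simp add: \<Phi>_def abs_mult)
  qed
  obtain y where y: "\<And>j. 0 \<le> y j \<and> y j \<le> 1" "\<And>i. i < n \<Longrightarrow> c (g i) (\<Phi> y) = 0"
  proof (rule poincare_miranda_nat[of n "\<lambda>i y. c (g i) (\<Phi> y)"])
    show "continuous_on UNIV (\<lambda>y. c (g i) (\<Phi> y))" if "i < n" for i
      by (rule continuous_on_compose2[OF cont[OF gJ(1)[OF that]] contPhi]) auto
    show "c (g i) (\<Phi> y) \<le> 0" if "i < n" "\<And>j. 0 \<le> y j \<and> y j \<le> 1" "y i = 0" for i y
      using that gJ by (intro lo bd) (auto simp: \<Phi>_def)
    show "0 \<le> c (g i) (\<Phi> y)" if "i < n" "\<And>j. 0 \<le> y j \<and> y j \<le> 1" "y i = 1" for i y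
      using that gJ by (intro hi bd) (auto simp: \<Phi>_def)
    fix y assume "\<And>j. 0 \<le> y j \<and> y j \<le> 1" "\<And>i. i < n \<Longrightarrow> c (g i) (\<Phi> y) = 0"
    then show thesis by (rule that)
  qed
  show ?thesis
  proof (rule that[of "\<Phi> y"])
    show "c j (\<Phi> y) = 0" if "j \<in> J" for j using y(2)[OF g'J(1)[OF that]] g'J(2)[OF that] by simp
    show "\<bar>\<Phi> y i\<bar> \<le> h" for i using y(1) by (rule bd)
    show "\<Phi> y i = 0" if "i \<notin> J" for i using that by (simp add: \<Phi>_def)
  qed
qed

section \<open>Perturbation of a spectral cluster\<close>

lemma sum_le_of_cover:
  fixes a :: "'i \<Rightarrow> real"
  assumes "finite I" "I \<subseteq> P \<union> Q" "finite P" "finite Q" "\<And>i. 0 \<le> a i"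
  shows "sum a I \<le> sum a P + sum a Q"
proof -
  have "sum a I \<le> sum a (P \<union> Q)" using assms by (intro sum_mono2) auto
  also have "\<dots> \<le> sum a P + sum a Q"
    using assms sum_nonneg[of "P \<inter> Q" a] by (simp add: sum_Un)
  finally show ?thesis .
qed

lemma coef_L2_le:
  assumes "finite S" "eigenbasis S B e \<mu>" "I \<subseteq> {..<card S}"
  shows "L2_set (\<lambda>i. ip S (e i) x) I \<le> L2_set x S"
proof -
  have "(L2_set (\<lambda>i. ip S (e i) x) I)\<^sup>2 \<le> (\<Sum>i<card S. (ip S (e i) x)\<^sup>2)"
    unfolding ip_self[symmetric] unfolding ip_def[of I]
    using assms(3) by (simp flip: power2_eq_square) (intro sum_mono2, auto)
  also have "\<dots> = (L2_set x S)\<^sup>2"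
    using parseval[OF assms(1,2), of x x] by (simp add: ip_self power2_eq_square)
  finally show ?thesis by (rule power2_le_imp_le) simp
qed

lemma weighted_sum_le:
  assumes "\<And>i. i \<in> I \<Longrightarrow> \<bar>f i\<bar> \<le> C" "0 \<le> C" "L2_set a I \<le> A" "L2_set c I \<le> D"
  shows "(\<Sum>i\<in>I. \<bar>f i * (a i * c i)\<bar>) \<le> C * (A * D)"
proof -
  have "(\<Sum>i\<in>I. \<bar>f i * (a i * c i)\<bar>) \<le> (\<Sum>i\<in>I. C * (\<bar>a i\<bar> * \<bar>c i\<bar>))"
    using assms(1) by (intro sum_mono) (auto simp: abs_mult intro!: mult_right_mono)
  also have "\<dots> \<le> C * (L2_set a I * L2_set c I)"
    unfolding sum_distrib_left[symmetric] using assms(2) by (intro mult_left_mono L2_set_mult_ineq)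
  also have "\<dots> \<le> C * (A * D)"
    using assms by (intro mult_left_mono mult_mono) (auto intro: order_trans[OF L2_set_nonneg])
  finally show ?thesis .
qed

definition synth :: "'a set \<Rightarrow> (nat \<Rightarrow> 'a \<Rightarrow> real) \<Rightarrow> (nat \<Rightarrow> real) \<Rightarrow> 'a \<Rightarrow> real" where
  "synth S e c u = (\<Sum>i<card S. c i * e i u)"

lemma coef_synth:
  assumes "eigenbasis S B e \<mu>" "i < card S"
  shows "ip S (e i) (synth S e c) = c i"
proof -
  have "ip S (e i) (synth S e c) = (\<Sum>j<card S. c j * ip S (e i) (e j))"
    unfolding synth_def ip_sum_right by (simp add: ip_scale_right)
  also have "\<dots> = (\<Sum>j<card S. c j * of_bool (j = i))"
    using eigenbasis_orthonormal[OF assms(1) assms(2)] by (intro sum.cong) auto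
  finally show ?thesis using assms(2) by (simp add: sum_delta_vec)
qed

lemma L2_set_synth:
  assumes "finite S" "eigenbasis S B e \<mu>"
  shows "(L2_set (synth S e c) S)\<^sup>2 = (\<Sum>i<card S. (c i)\<^sup>2)"
  unfolding ip_self[symmetric] parseval[OF assms, of "synth S e c"]
  by (simp add: coef_synth[OF assms(2)] power2_eq_square)

lemma mat_app_synth:
  assumes "eigenbasis S B e \<mu>" "u \<in> S"
  shows "mat_app S B (synth S e c) u = synth S e (\<lambda>i. \<mu> i * c i) u"
  unfolding synth_def mat_app_sum mat_app_scale
  using eigenbasis_eigen[OF assms(1) _ assms(2)] by (intro sum.cong) auto

lemma sum_of_bool_filter:
  fixes a :: "nat \<Rightarrow> real"
  shows "(\<Sum>i<n. of_bool (P i) * a i) = (\<Sum>i | i < n \<and> P i. a i)"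
proof -
  have "(\<Sum>i<n. of_bool (P i) * a i) = (\<Sum>i<n. if P i then a i else 0)"
    by (intro sum.cong) auto
  also have "\<dots> = sum a ({..<n} \<inter> {i. P i})"
    by (subst sum.inter_restrict) auto
  also have "{..<n} \<inter> {i. P i} = {i. i < n \<and> P i}" by auto
  finally show ?thesis .
qed

text \<open>Within \<alpha>^2 r of E the spectral measure at v has mass at least \<epsilon>, and
  between \<alpha>^2 r and r almost none. A potential of the intermediate size \<alpha> r is large
  compared with the width of the cluster and small compared with its distance to the rest of the
  spectrum; both ratios are \<alpha>.\<close>

locale spectral_cluster =
  fixes S :: "'a set" and B e \<mu> v E r \<alpha> \<epsilon>
  assumes fin: "finite S" and sym: "symmetric_on S B" and eb: "eigenbasis S B e \<mu>" and v: "v \<in> S"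
    and r: "0 < r" and eps: "0 < \<epsilon>" "\<epsilon> \<le> 1" and alpha: "0 < \<alpha>" "\<alpha> \<le> \<epsilon>\<^sup>2 / 100"
    and annulus: "(\<Sum>i | i < card S \<and> \<alpha>\<^sup>2 * r < \<bar>\<mu> i - E\<bar> \<and> \<bar>\<mu> i - E\<bar> \<le> r. (e i v)\<^sup>2) \<le> \<alpha>\<^sup>2"
    and weight: "\<epsilon> \<le> (\<Sum>i | i < card S \<and> \<bar>\<mu> i - E\<bar> \<le> \<alpha>\<^sup>2 * r. (e i v)\<^sup>2)"
begin

definition "w = (\<Sum>i | i < card S \<and> \<bar>\<mu> i - E\<bar> \<le> \<alpha>\<^sup>2 * r. (e i v)\<^sup>2)"
text \<open>The point mass at \<open>v\<close> is split by the distance of the energy from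
  \<open>E\<close> into the cluster \<open>\<psi>\<close>, the annulus \<open>near\<close> and the
  rest \<open>far\<close>; \<open>g\<close> is the resolvent at \<open>E\<close> applied to
  \<open>far\<close>.\<close>

definition "\<psi> = synth S e (\<lambda>i. of_bool (\<bar>\<mu> i - E\<bar> \<le> \<alpha>\<^sup>2 * r) * e i v)"
definition "near = synth S e (\<lambda>i. of_bool (\<alpha>\<^sup>2 * r < \<bar>\<mu> i - E\<bar> \<and> \<bar>\<mu> i - E\<bar> \<le> r) * e i v)"
definition "far = synth S e (\<lambda>i. of_bool (r < \<bar>\<mu> i - E\<bar>) * e i v)"
definition "g = synth S e (\<lambda>i. of_bool (r < \<bar>\<mu> i - E\<bar>) * (e i v / (\<mu> i - E)))"
definition "h = \<alpha> * r"

text \<open>With an eigenbasis of the perturbed matrix this is the matrix element of the function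
  \<open>F\<close> of that matrix between the point mass at \<open>v\<close> and the old vector
  \<open>\<psi>\<close>. For polynomial \<open>F\<close> it is therefore a polynomial in the
  potential.\<close>

definition "corr e' \<mu>' F = (\<Sum>i<card S. F (\<mu>' i) * (e' i v * ip S (e' i) \<psi>))"

lemma alpha_le: "\<alpha> \<le> \<epsilon> / 100" "\<alpha> \<le> 1 / 100" "\<alpha>\<^sup>2 \<le> \<alpha>"
proof -
  have "\<epsilon>\<^sup>2 \<le> \<epsilon>" using eps by (simp add: power2_eq_square mult_left_le)
  then show "\<alpha> \<le> \<epsilon> / 100" using alpha by linarith
  then show "\<alpha> \<le> 1 / 100" using eps by linarith
  then show "\<alpha>\<^sup>2 \<le> \<alpha>" using alpha by (simp add: power2_eq_square mult_left_le)
qed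

lemma h_pos: "0 < h" using alpha r by (simp add: h_def)

lemma row_norm: "(\<Sum>i<card S. (e i v)\<^sup>2) = 1"
  using eb v by (rule eigenbasis_row_norm)

lemma w_bounds: "\<epsilon> \<le> w" "w \<le> 1" "0 < w"
proof -
  show "\<epsilon> \<le> w" using weight by (simp add: w_def)
  then show "0 < w" using eps by linarith
  have "w \<le> (\<Sum>i<card S. (e i v)\<^sup>2)"
    unfolding w_def by (intro sum_mono2) auto
  then show "w \<le> 1" using row_norm by simp
qed

lemma psi_norm: "(L2_set \<psi> S)\<^sup>2 = w"
  unfolding \<psi>_def L2_set_synth[OF fin eb] w_def sum_of_bool_filter[symmetric]
  by (intro sum.cong) auto

lemma psi_le_1: "L2_set \<psi> S \<le> 1"
  using psi_norm w_bounds by (metis L2_set_nonneg abs_square_le_1 abs_of_nonneg)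

lemma psi_v: "\<psi> v = w"
  unfolding \<psi>_def synth_def w_def sum_of_bool_filter[symmetric]
  by (intro sum.cong) (auto simp: power2_eq_square)

lemma near_norm: "L2_set near S \<le> \<alpha>"
proof -
  have "(L2_set near S)\<^sup>2 =
      (\<Sum>i<card S. of_bool (\<alpha>\<^sup>2 * r < \<bar>\<mu> i - E\<bar> \<and> \<bar>\<mu> i - E\<bar> \<le> r) * (e i v)\<^sup>2)"
    unfolding near_def L2_set_synth[OF fin eb] by (intro sum.cong) auto
  then have "(L2_set near S)\<^sup>2 \<le> \<alpha>\<^sup>2"
    using annulus unfolding sum_of_bool_filter by simp
  then show ?thesis by (rule power2_le_imp_le) (use alpha in auto)
qed

lemma g_norm: "L2_set g S \<le> 1 / r"
proof -
  have "(L2_set g S)\<^sup>2 = (\<Sum>i<card S. (of_bool (r < \<bar>\<mu> i - E\<bar>) * (e i v / (\<mu> i - E)))\<^sup>2)"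
    unfolding g_def L2_set_synth[OF fin eb] ..
  also have "\<dots> \<le> (\<Sum>i<card S. (1 / r)\<^sup>2 * (e i v)\<^sup>2)"
  proof (rule sum_mono)
    fix i
    show "(of_bool (r < \<bar>\<mu> i - E\<bar>) * (e i v / (\<mu> i - E)))\<^sup>2 \<le> (1 / r)\<^sup>2 * (e i v)\<^sup>2"
    proof (cases "r < \<bar>\<mu> i - E\<bar>")
      case True
      then have "\<bar>e i v / (\<mu> i - E)\<bar> \<le> \<bar>1 / r * e i v\<bar>"
        using r by (simp add: abs_mult frac_le)
      then have "(e i v / (\<mu> i - E))\<^sup>2 \<le> (1 / r * e i v)\<^sup>2" by (simp only: abs_le_square_iff)
      then show ?thesis using True by (simp add: power_mult_distrib power_divide)
    qed simp
  qed
  also have "\<dots> = (1 / r)\<^sup>2"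
    using row_norm by (simp flip: sum_distrib_left)
  finally show ?thesis by (rule power2_le_imp_le) (use r in auto)
qed

lemma decomposition:
  assumes "u \<in> S"
  shows "of_bool (u = v) = \<psi> u + near u + far u"
proof -
  have "\<psi> u + near u + far u = (\<Sum>i<card S. e i v * e i u)"
    unfolding \<psi>_def near_def far_def synth_def sum.distrib[symmetric]
  proof (intro sum.cong refl)
    fix i
    have "\<alpha>\<^sup>2 * r \<le> 1 * r" using r alpha alpha_le by (intro mult_right_mono) auto
    then have "of_bool (\<bar>\<mu> i - E\<bar> \<le> \<alpha>\<^sup>2 * r) + of_bool (\<alpha>\<^sup>2 * r < \<bar>\<mu> i - E\<bar> \<and> \<bar>\<mu> i - E\<bar> \<le> r)
        + of_bool (r < \<bar>\<mu> i - E\<bar>) = (1::real)"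
      by (auto simp: of_bool_def)
    then show "of_bool (\<bar>\<mu> i - E\<bar> \<le> \<alpha>\<^sup>2 * r) * e i v * e i u +
        of_bool (\<alpha>\<^sup>2 * r < \<bar>\<mu> i - E\<bar> \<and> \<bar>\<mu> i - E\<bar> \<le> r) * e i v * e i u +
        of_bool (r < \<bar>\<mu> i - E\<bar>) * e i v * e i u = e i v * e i u"
      by (simp flip: distrib_right)
  qed
  then show ?thesis using eigenbasis_complete[OF eb v assms] by auto
qed

lemma psi_residual: "L2_set (\<lambda>u. mat_app S B \<psi> u - E * \<psi> u) S \<le> \<alpha>\<^sup>2 * r"
proof -
  have "L2_set (\<lambda>u. mat_app S B \<psi> u - E * \<psi> u) S =
      L2_set (synth S e (\<lambda>i. (\<mu> i - E) * (of_bool (\<bar>\<mu> i - E\<bar> \<le> \<alpha>\<^sup>2 * r) * e i v))) S"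
  proof (intro L2_set_cong refl)
    fix u assume u: "u \<in> S"
    show "mat_app S B \<psi> u - E * \<psi> u =
        synth S e (\<lambda>i. (\<mu> i - E) * (of_bool (\<bar>\<mu> i - E\<bar> \<le> \<alpha>\<^sup>2 * r) * e i v)) u"
      unfolding \<psi>_def mat_app_synth[OF eb u]
      unfolding synth_def sum_distrib_left sum_subtractf[symmetric]
      by (intro sum.cong refl) (simp add: left_diff_distrib mult.assoc)
  qed
  moreover have "(\<dots>)\<^sup>2 \<le> (\<Sum>i<card S. (\<alpha>\<^sup>2 * r)\<^sup>2 * (e i v)\<^sup>2)"
    unfolding L2_set_synth[OF fin eb]
  proof (rule sum_mono)
    fix i
    show "((\<mu> i - E) * (of_bool (\<bar>\<mu> i - E\<bar> \<le> \<alpha>\<^sup>2 * r) * e i v))\<^sup>2 \<le> (\<alpha>\<^sup>2 * r)\<^sup>2 * (e i v)\<^sup>2"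
    proof (cases "\<bar>\<mu> i - E\<bar> \<le> \<alpha>\<^sup>2 * r")
      case True
      then have "(\<mu> i - E)\<^sup>2 \<le> (\<alpha>\<^sup>2 * r)\<^sup>2"
        using r by (intro abs_le_square_iff[THEN iffD1]) simp
      then show ?thesis using True by (simp add: power_mult_distrib mult_right_mono)
    qed simp
  qed
  moreover have "(\<Sum>i<card S. (\<alpha>\<^sup>2 * r)\<^sup>2 * (e i v)\<^sup>2) = (\<alpha>\<^sup>2 * r)\<^sup>2"
    using row_norm by (simp flip: sum_distrib_left)
  ultimately have "(L2_set (\<lambda>u. mat_app S B \<psi> u - E * \<psi> u) S)\<^sup>2 \<le> (\<alpha>\<^sup>2 * r)\<^sup>2"
    by simp
  then show ?thesis by (rule power2_le_imp_le) (use r in auto)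
qed

lemma g_residual:
  assumes "u \<in> S"
  shows "mat_app S B g u - E * g u = far u"
  unfolding g_def mat_app_synth[OF eb assms] far_def
  unfolding synth_def sum_distrib_left sum_subtractf[symmetric]
proof (intro sum.cong refl)
  fix i
  show "\<mu> i * (of_bool (r < \<bar>\<mu> i - E\<bar>) * (e i v / (\<mu> i - E))) * e i u -
      E * (of_bool (r < \<bar>\<mu> i - E\<bar>) * (e i v / (\<mu> i - E)) * e i u)
      = of_bool (r < \<bar>\<mu> i - E\<bar>) * e i v * e i u"
  proof (cases "r < \<bar>\<mu> i - E\<bar>")
    case True
    have "\<mu> i * (e i v / (\<mu> i - E)) * e i u - E * (e i v / (\<mu> i - E) * e i u)
        = (\<mu> i - E) * (e i v / (\<mu> i - E)) * e i u"
      by (simp only: left_diff_distrib mult.assoc)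
    also have "\<dots> = e i v * e i u"
      using True r by simp
    finally show ?thesis using True by simp
  qed simp
qed

section \<open>First-order perturbation of one cluster\<close>

context
  fixes X :: "'a \<Rightarrow> real" and J :: "'a set"
  assumes X: "\<And>u. \<bar>X u\<bar> \<le> h" and XJ: "\<And>u. u \<notin> J \<Longrightarrow> X u = 0" and J: "J \<subseteq> S"
    and weak: "(\<Sum>j\<in>J - {v}. (\<psi> j)\<^sup>2) \<le> \<alpha>\<^sup>2"
begin

definition "\<phi> = (\<lambda>u. \<psi> u - X v * w * g u)"

lemma phi_near_psi: "L2_set (\<lambda>u. X v * w * g u) S \<le> \<alpha>"
proof -
  have "\<bar>X v * w\<bar> \<le> h * 1"
    unfolding abs_mult using X[of v] w_bounds h_pos by (intro mult_mono) auto
  then have "L2_set (\<lambda>u. X v * w * g u) S \<le> h * (1 / r)"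
    unfolding L2_set_mult_abs using g_norm h_pos by (intro mult_mono) auto
  then show ?thesis using r by (simp add: h_def)
qed

text \<open>First-order perturbation theory: \<open>\<phi>\<close> is an approximate eigenvector of the perturbed operator
  whose energy has moved by \<open>X v * w\<close>; subtracting the multiple of \<open>g\<close> cancels the coupling of
  \<open>\<psi>\<close> to the part of the spectrum far from \<open>E\<close>.\<close>

lemma phi_residual:
  "L2_set (\<lambda>u. mat_app S (add_potential B X) \<phi> u - (E + X v * w) * \<phi> u) S \<le> 5 * \<alpha> * h"
proof -
  \<comment> \<open>The perturbation away from \<open>v\<close>; by \<open>weak\<close> it meets
    only mass \<open>\<alpha>\<^sup>2\<close> of \<open>\<psi>\<close>.\<close>
  define Y where "Y = (\<lambda>u. if u = v then 0 else X u)"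
  have sw: "\<bar>X v * w\<bar> \<le> h"
    using mult_mono[of "\<bar>X v\<bar>" h w 1] X[of v] w_bounds h_pos by (auto simp: abs_mult)
  have "mat_app S (add_potential B X) \<phi> u - (E + X v * w) * \<phi> u =
      ((mat_app S B \<psi> u - E * \<psi> u) + X v * w * near u) +
      (Y u * \<psi> u + (- (X u - X v * w)) * (X v * w * g u))" if u: "u \<in> S" for u
  proof -
    have "mat_app S B \<phi> u = mat_app S B \<psi> u - X v * w * mat_app S B g u"
      using mat_app_add[of S B \<psi> "\<lambda>u. (- (X v * w)) * g u" u]
      unfolding mat_app_scale by (simp add: \<phi>_def)
    \<comment> \<open>At \<open>v\<close> the potential creates \<open>X v * w\<close> times the
      point mass, because \<open>\<psi> v = w\<close>. Of the three parts of the point mass,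
      \<open>\<psi>\<close> gives the energy shift, \<open>near\<close> is small and
      \<open>far\<close> is cancelled by \<open>g\<close>.\<close>
    moreover have "X u * \<psi> u = Y u * \<psi> u + X v * w * (\<psi> u + near u + far u)"
      using decomposition[OF u] by (cases "u = v") (auto simp: Y_def psi_v)
    ultimately show ?thesis
      unfolding mat_app_add_potential[OF fin u] g_residual[OF u, symmetric]
      by (simp add: \<phi>_def algebra_simps)
  qed
  then have "L2_set (\<lambda>u. mat_app S (add_potential B X) \<phi> u - (E + X v * w) * \<phi> u) S =
      L2_set (\<lambda>u. ((mat_app S B \<psi> u - E * \<psi> u) + X v * w * near u) +
        (Y u * \<psi> u + (- (X u - X v * w)) * (X v * w * g u))) S"
    by (intro L2_set_cong) auto
  also have "\<dots> \<le> (L2_set (\<lambda>u. mat_app S B \<psi> u - E * \<psi> u) S + L2_set (\<lambda>u. X v * w * near u) S) +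
      (L2_set (\<lambda>u. Y u * \<psi> u) S + L2_set (\<lambda>u. (- (X u - X v * w)) * (X v * w * g u)) S)"
    by (intro order_trans[OF L2_set_triangle_ineq] add_mono L2_set_triangle_ineq)
  \<comment> \<open>The four errors are the width of the cluster, which is \<alpha>^2 r = \<alpha>
    h, the annulus, the other points of J, and the potential and the shift acting on the correction
    term.\<close>
  also have "\<dots> \<le> (\<alpha>\<^sup>2 * r + h * \<alpha>) + (h * \<alpha> + (2 * h) * \<alpha>)"
  proof (intro add_mono)
    show "L2_set (\<lambda>u. X v * w * near u) S \<le> h * \<alpha>"
      unfolding L2_set_mult_abs using sw near_norm h_pos by (intro mult_mono) auto
    have "L2_set (\<lambda>u. (- (X u - X v * w)) * (X v * w * g u)) S
        \<le> (2 * h) * L2_set (\<lambda>u. X v * w * g u) S"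
    proof (rule L2_set_mult_le)
      show "\<bar>- (X u - X v * w)\<bar> \<le> 2 * h" for u using X[of u] sw by linarith
    qed (use h_pos in auto)
    also have "\<dots> \<le> (2 * h) * \<alpha>" using phi_near_psi h_pos by (intro mult_left_mono) auto
    finally show "L2_set (\<lambda>u. (- (X u - X v * w)) * (X v * w * g u)) S \<le> (2 * h) * \<alpha>" .
    have "(L2_set (\<lambda>u. Y u * \<psi> u) S)\<^sup>2 = (\<Sum>u\<in>S. (Y u * \<psi> u)\<^sup>2)"
      by (simp add: L2_set_def sum_nonneg)
    also have "\<dots> = (\<Sum>u\<in>J - {v}. (Y u * \<psi> u)\<^sup>2)"
      using fin J XJ by (intro sum.mono_neutral_right) (auto simp: Y_def)
    also have "\<dots> \<le> (\<Sum>u\<in>J - {v}. h\<^sup>2 * (\<psi> u)\<^sup>2)"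
    proof (rule sum_mono)
      fix u
      have "(Y u)\<^sup>2 \<le> h\<^sup>2" using X[of u] h_pos by (intro abs_le_square_iff[THEN iffD1]) (auto simp: Y_def)
      then show "(Y u * \<psi> u)\<^sup>2 \<le> h\<^sup>2 * (\<psi> u)\<^sup>2" by (simp add: power_mult_distrib mult_right_mono)
    qed
    also have "\<dots> \<le> h\<^sup>2 * \<alpha>\<^sup>2"
      using weak by (simp add: mult_left_mono flip: sum_distrib_left)
    finally have "(L2_set (\<lambda>u. Y u * \<psi> u) S)\<^sup>2 \<le> (h * \<alpha>)\<^sup>2" by (simp add: power_mult_distrib)
    then show "L2_set (\<lambda>u. Y u * \<psi> u) S \<le> h * \<alpha>"
      by (rule power2_le_imp_le) (use h_pos alpha in auto)
  qed (rule psi_residual)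
  also have "\<dots> = 5 * \<alpha> * h" by (simp add: h_def power2_eq_square)
  finally show ?thesis .
qed

context
  fixes e' \<mu>'
  assumes eb': "eigenbasis S (add_potential B X) e' \<mu>'"
begin

text \<open>Chebyshev's inequality for \<open>\<phi>\<close>; the extra \<open>\<alpha>\<close> pays
  for the return to \<open>\<psi>\<close>. The centre shows that the cluster follows the value of
  the potential at \<open>v\<close> alone.\<close>

lemma psi_concentrated:
  assumes t: "0 < t" and I: "I \<subseteq> {i. i < card S \<and> t \<le> \<bar>\<mu>' i - (E + X v * w)\<bar>}"
  shows "L2_set (\<lambda>i. ip S (e' i) \<psi>) I \<le> 5 * \<alpha> * h / t + \<alpha>"
proof -
  have "(L2_set (\<lambda>i. ip S (e' i) \<phi>) I)\<^sup>2 \<le>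
      (\<Sum>i | i < card S \<and> t \<le> \<bar>\<mu>' i - (E + X v * w)\<bar>. (ip S (e' i) \<phi>)\<^sup>2)"
    using I by (simp add: L2_set_def sum_nonneg) (intro sum_mono2, auto)
  also have "\<dots> \<le> (5 * \<alpha> * h / t)\<^sup>2"
    using fin symmetric_add_potential[OF sym] eb' t phi_residual by (rule chebyshev_spectral)
  finally have 1: "L2_set (\<lambda>i. ip S (e' i) \<phi>) I \<le> 5 * \<alpha> * h / t"
    by (rule power2_le_imp_le) (use h_pos alpha t in auto)
  have "L2_set (\<lambda>i. ip S (e' i) \<psi>) I =
      L2_set (\<lambda>i. ip S (e' i) \<phi> + ip S (e' i) (\<lambda>u. X v * w * g u)) I"
    by (intro L2_set_cong refl) (simp add: \<phi>_def flip: ip_add_right)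
  also have "\<dots> \<le> L2_set (\<lambda>i. ip S (e' i) \<phi>) I + L2_set (\<lambda>i. ip S (e' i) (\<lambda>u. X v * w * g u)) I"
    by (rule L2_set_triangle_ineq)
  also have "\<dots> \<le> 5 * \<alpha> * h / t + \<alpha>"
    using I by (intro add_mono 1 order_trans[OF coef_L2_le[OF fin eb'] phi_near_psi]) auto
  finally show ?thesis .
qed

text \<open>A cruder bound without reference to the shifted energy: \<open>\<psi>\<close> itself is
  an approximate eigenvector at \<open>E\<close> with error \<open>2 * \<alpha> * r\<close>, so it
  stays mostly within \<open>r\<close> of \<open>E\<close> wherever the cluster has moved.\<close>

lemma psi_local:
  assumes I: "I \<subseteq> {i. i < card S \<and> r < \<bar>\<mu>' i - E\<bar>}"
  shows "L2_set (\<lambda>i. ip S (e' i) \<psi>) I \<le> 2 * \<alpha>"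
proof -
  have "L2_set (\<lambda>u. mat_app S (add_potential B X) \<psi> u - E * \<psi> u) S =
      L2_set (\<lambda>u. (mat_app S B \<psi> u - E * \<psi> u) + X u * \<psi> u) S"
    using fin by (intro L2_set_cong) (auto simp: mat_app_add_potential)
  also have "\<dots> \<le> L2_set (\<lambda>u. mat_app S B \<psi> u - E * \<psi> u) S + L2_set (\<lambda>u. X u * \<psi> u) S"
    by (rule L2_set_triangle_ineq)
  also have "\<dots> \<le> \<alpha>\<^sup>2 * r + h * 1"
    using X h_pos psi_le_1
    by (intro add_mono psi_residual order_trans[OF L2_set_mult_le[of S X h]] mult_left_mono) auto
  also have "\<dots> \<le> 2 * \<alpha> * r"
    using mult_right_mono[OF alpha_le(3), of r] r by (simp add: h_def)
  finally have err: "L2_set (\<lambda>u. mat_app S (add_potential B X) \<psi> u - E * \<psi> u) S \<le> 2 * \<alpha> * r" .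
  have "(L2_set (\<lambda>i. ip S (e' i) \<psi>) I)\<^sup>2 \<le>
      (\<Sum>i | i < card S \<and> r \<le> \<bar>\<mu>' i - E\<bar>. (ip S (e' i) \<psi>)\<^sup>2)"
    using I by (simp add: L2_set_def sum_nonneg) (intro sum_mono2, auto)
  also have "\<dots> \<le> (2 * \<alpha> * r / r)\<^sup>2"
    using fin symmetric_add_potential[OF sym] eb' r err by (rule chebyshev_spectral)
  finally have "(L2_set (\<lambda>i. ip S (e' i) \<psi>) I)\<^sup>2 \<le> (2 * \<alpha>)\<^sup>2" using r by simp
  then show ?thesis by (rule power2_le_imp_le) (use alpha in auto)
qed

text \<open>The correlation with the constant function 1 is \<open>\<psi> v = w\<close> by
  completeness, so the two sides of a split share exactly \<open>w\<close>.\<close>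

lemma corr_one: "corr e' \<mu>' (\<lambda>x. 1 - F x) = w - corr e' \<mu>' F"
proof -
  have "(\<Sum>i<card S. e' i v * ip S (e' i) \<psi>) = w"
    using eigenbasis_expand[OF fin eb' v, of \<psi>] by (simp add: psi_v mult.commute)
  then show ?thesis by (simp add: corr_def left_diff_distrib sum_subtractf)
qed

lemma delta_coef_le_1: "I \<subseteq> {..<card S} \<Longrightarrow> L2_set (\<lambda>i. e' i v) I \<le> 1"
  using coef_L2_le[OF fin eb', of I "\<lambda>u. of_bool (u = v)"] L2_set_delta[OF fin v]
  by (simp add: ip_delta[OF fin v])

lemma psi_coef_le_1: "I \<subseteq> {..<card S} \<Longrightarrow> L2_set (\<lambda>i. ip S (e' i) \<psi>) I \<le> 1"
  using coef_L2_le[OF fin eb', of I \<psi>] psi_le_1 by linarith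

lemma sum_le_split:
  fixes a :: "nat \<Rightarrow> real"
  assumes "\<And>i. 0 \<le> a i"
  shows "(\<Sum>i<n. a i) \<le> (\<Sum>i | i < n \<and> P i. a i) + (\<Sum>i | i < n \<and> \<not> P i. a i)"
  using assms by (intro sum_le_of_cover) auto

text \<open>Applied to a potential that is extreme at \<open>v\<close>, so that the cluster lies on one side of a given
  energy, and to \<open>F\<close> close to the indicator function of the other side.\<close>

lemma corr_small:
  assumes Fb: "\<And>i. i < card S \<Longrightarrow> \<bar>F (\<mu>' i)\<bar> \<le> 2"
    and Fs: "\<And>i. i < card S \<Longrightarrow> \<bar>\<mu>' i - (E + X v * w)\<bar> < h * w / 2 \<Longrightarrow> \<bar>F (\<mu>' i)\<bar> \<le> \<alpha>"
  shows "\<bar>corr e' \<mu>' F\<bar> \<le> w / 2"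
proof -
  define I where "I = {i. i < card S \<and> \<not> \<bar>\<mu>' i - (E + X v * w)\<bar> < h * w / 2}"
  define I' where "I' = {i. i < card S \<and> \<bar>\<mu>' i - (E + X v * w)\<bar> < h * w / 2}"
  have hw: "0 < h * w / 2" using h_pos w_bounds by simp
  have "\<bar>corr e' \<mu>' F\<bar> \<le> (\<Sum>i<card S. \<bar>F (\<mu>' i) * (e' i v * ip S (e' i) \<psi>)\<bar>)"
    unfolding corr_def by (rule sum_abs)
  also have "\<dots> \<le> (\<Sum>i\<in>I'. \<bar>F (\<mu>' i) * (e' i v * ip S (e' i) \<psi>)\<bar>)
      + (\<Sum>i\<in>I. \<bar>F (\<mu>' i) * (e' i v * ip S (e' i) \<psi>)\<bar>)"
    unfolding I_def I'_def by (rule sum_le_split) auto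
  \<comment> \<open>Near the shifted energy \<open>F\<close> is small; elsewhere
    \<open>psi_concentrated\<close> applies with \<open>t = h * w / 2\<close>.\<close>
  also have "\<dots> \<le> \<alpha> * (1 * 1) + 2 * (1 * (5 * \<alpha> * h / (h * w / 2) + \<alpha>))"
    using Fb Fs alpha hw
    by (intro add_mono weighted_sum_le psi_concentrated delta_coef_le_1 psi_coef_le_1)
      (auto simp: I_def I'_def)
  also have "\<dots> = 3 * \<alpha> + 20 * \<alpha> / w"
    using h_pos w_bounds by (simp add: field_simps)
  \<comment> \<open>Weighing \<open>20 * \<alpha> / w\<close> against \<open>w / 2\<close> is what
    forces \<alpha> to be of the order of \<epsilon>^2.\<close>
  also have "\<dots> \<le> w / 2"
  proof -
    have "23 * \<alpha> \<le> \<epsilon>\<^sup>2 / 2" using alpha by (simp add: field_simps)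
    also have "\<dots> \<le> w\<^sup>2 / 2" using w_bounds eps by (simp add: power_mono)
    finally have "23 * \<alpha> \<le> w * (w / 2)" by (simp add: power2_eq_square)
    moreover have "3 * \<alpha> * w \<le> 3 * \<alpha>" using w_bounds alpha by (simp add: mult_left_le)
    ultimately show ?thesis using w_bounds by (simp add: field_simps)
  qed
  finally show ?thesis .
qed

text \<open>Applied to a potential for which an energy splits the cluster evenly, and to \<open>F\<close> close to the
  indicator function of one side.\<close>

lemma corr_large:
  assumes Fb: "\<And>i. i < card S \<Longrightarrow> \<bar>F (\<mu>' i)\<bar> \<le> 2"
    and Fs: "\<And>i. i < card S \<Longrightarrow> Q (\<mu>' i) \<Longrightarrow> \<bar>F (\<mu>' i)\<bar> \<le> \<alpha>"
    and mid: "(\<Sum>i | i < card S \<and> Mid (\<mu>' i). (e' i v)\<^sup>2) \<le> \<alpha>\<^sup>2"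
    and large: "w / 2 \<le> corr e' \<mu>' F"
  shows "\<epsilon>\<^sup>2 / 64 \<le> (\<Sum>i | i < card S \<and> \<not> Q (\<mu>' i) \<and> \<not> Mid (\<mu>' i) \<and> \<bar>\<mu>' i - E\<bar> \<le> r. (e' i v)\<^sup>2)"
proof -
  define a where "a = (\<lambda>i. \<bar>F (\<mu>' i) * (e' i v * ip S (e' i) \<psi>)\<bar>)"
  \<comment> \<open>Outside \<open>I4\<close> one factor is always small: \<open>\<psi>\<close> on
    \<open>I1\<close>, the point mass on \<open>I2\<close>, \<open>F\<close> on \<open>I3\<close>.
    This costs \<open>7 * \<alpha>\<close> altogether, so \<open>I4\<close> must supply the
    remainder of \<open>w / 2\<close>.\<close>
  define I1 where "I1 = {i. i < card S \<and> r < \<bar>\<mu>' i - E\<bar>}"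
  define I2 where "I2 = {i. i < card S \<and> Mid (\<mu>' i)}"
  define I3 where "I3 = {i. i < card S \<and> Q (\<mu>' i)}"
  define I4 where "I4 = {i. i < card S \<and> \<not> Q (\<mu>' i) \<and> \<not> Mid (\<mu>' i) \<and> \<bar>\<mu>' i - E\<bar> \<le> r}"
  define A where "A = L2_set (\<lambda>i. e' i v) I4"
  have fI: "finite I1" "finite I2" "finite I3" "finite I4" by (auto simp: I1_def I2_def I3_def I4_def)
  have a0: "0 \<le> a i" for i by (simp add: a_def)
  have "(L2_set (\<lambda>i. e' i v) I2)\<^sup>2 \<le> \<alpha>\<^sup>2"
    using mid by (simp add: I2_def L2_set_def sum_nonneg)
  then have midb: "L2_set (\<lambda>i. e' i v) I2 \<le> \<alpha>"
    by (rule power2_le_imp_le) (use alpha in simp)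
  have "w / 2 \<le> \<bar>corr e' \<mu>' F\<bar>" using large by linarith
  also have "\<dots> \<le> sum a {..<card S}"
    unfolding corr_def a_def by (rule sum_abs)
  also have "\<dots> \<le> sum a I1 + sum a (I2 \<union> (I3 \<union> I4))"
    using fI a0 by (intro sum_le_of_cover) (auto simp: I1_def I2_def I3_def I4_def)
  also have "sum a (I2 \<union> (I3 \<union> I4)) \<le> sum a I2 + sum a (I3 \<union> I4)"
    using fI a0 by (intro sum_le_of_cover) auto
  also have "sum a (I3 \<union> I4) \<le> sum a I3 + sum a I4"
    using fI a0 by (intro sum_le_of_cover) auto
  finally have "w / 2 \<le> sum a I1 + (sum a I2 + (sum a I3 + sum a I4))"
    by simp
  also have "\<dots> \<le> 2 * (1 * (2 * \<alpha>)) + (2 * (\<alpha> * 1) + (\<alpha> * (1 * 1) + 2 * (A * 1)))"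
  proof (intro add_mono)
    have sub: "I1 \<subseteq> {..<card S}" "I2 \<subseteq> {..<card S}" "I3 \<subseteq> {..<card S}" "I4 \<subseteq> {..<card S}"
      by (auto simp: I1_def I2_def I3_def I4_def)
    have Fb': "\<bar>F (\<mu>' i)\<bar> \<le> 2" if "i \<in> I" "I \<subseteq> {..<card S}" for i I
      using that by (intro Fb) auto
    show "sum a I1 \<le> 2 * (1 * (2 * \<alpha>))"
      unfolding a_def using sub(1)
      by (intro weighted_sum_le Fb' delta_coef_le_1 psi_local) (auto simp: I1_def)
    show "sum a I2 \<le> 2 * (\<alpha> * 1)"
      unfolding a_def by (intro weighted_sum_le Fb'[OF _ sub(2)] midb psi_coef_le_1 sub) auto
    show "sum a I3 \<le> \<alpha> * (1 * 1)"
      unfolding a_def using alpha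
      by (intro weighted_sum_le Fs delta_coef_le_1 psi_coef_le_1 sub) (auto simp: I3_def)
    show "sum a I4 \<le> 2 * (A * 1)"
      unfolding a_def A_def by (intro weighted_sum_le Fb'[OF _ sub(4)] order_refl psi_coef_le_1 sub) auto
  qed
  finally have "w / 2 \<le> 7 * \<alpha> + 2 * A" by simp
  then have "\<epsilon> / 8 \<le> A" using alpha_le w_bounds by linarith
  then have "(\<epsilon> / 8)\<^sup>2 \<le> A\<^sup>2" using eps by (intro power_mono) auto
  also have "A\<^sup>2 = (\<Sum>i\<in>I4. (e' i v)\<^sup>2)" by (simp add: A_def L2_set_def sum_nonneg)
  finally show ?thesis by (simp add: I4_def power_divide)
qed

end

end

end

text \<open>A polynomial replaces the ramp because a polynomial in a matrix is visibly continuous in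
  the entries; continuity of eigenvalues and eigenvectors is never invoked.\<close>

lemma step_polynomial_exists:
  fixes \<gamma> \<eta> \<tau> M :: real
  assumes eta: "0 < \<eta>" and tau: "0 < \<tau>" "\<tau> \<le> 1"
  obtains a N where
    "\<And>x. \<bar>x\<bar> \<le> M \<Longrightarrow> \<bar>\<Sum>d\<le>N. a d * x ^ d\<bar> \<le> 2"
    "\<And>x. \<bar>x\<bar> \<le> M \<Longrightarrow> \<bar>1 - (\<Sum>d\<le>N. a d * x ^ d)\<bar> \<le> 2"
    "\<And>x. \<bar>x\<bar> \<le> M \<Longrightarrow> x \<le> \<gamma> - \<eta> \<Longrightarrow> \<bar>\<Sum>d\<le>N. a d * x ^ d\<bar> \<le> \<tau>"
    "\<And>x. \<bar>x\<bar> \<le> M \<Longrightarrow> \<gamma> + \<eta> \<le> x \<Longrightarrow> \<bar>1 - (\<Sum>d\<le>N. a d * x ^ d)\<bar> \<le> \<tau>"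
proof -
  define f where "f = (\<lambda>x::real. max 0 (min 1 ((x - \<gamma> + \<eta>) / (2 * \<eta>))))"
  have "continuous_on {-M..M} f"
    unfolding f_def using eta by (intro continuous_intros) auto
  then obtain p where p: "real_polynomial_function p" "\<And>x. x \<in> {-M..M} \<Longrightarrow> \<bar>f x - p x\<bar> < \<tau>"
    using Stone_Weierstrass_real_polynomial_function[of "{-M..M}" f \<tau>] tau by auto
  then obtain a N where pa: "p = (\<lambda>x. \<Sum>d\<le>N. a d * x ^ d)"
    unfolding real_polynomial_function_iff_sum by blast
  have close: "\<bar>f x - (\<Sum>d\<le>N. a d * x ^ d)\<bar> < \<tau>" if "\<bar>x\<bar> \<le> M" for x
    using p(2)[of x] that by (auto simp: pa abs_le_iff)
  have f01: "0 \<le> f x" "f x \<le> 1" for x by (auto simp: f_def)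
  have f0: "f x = 0" if "x \<le> \<gamma> - \<eta>" for x
    using that eta by (auto simp: f_def field_simps max_def min_def)
  have f1: "f x = 1" if "\<gamma> + \<eta> \<le> x" for x
    using that eta by (auto simp: f_def field_simps max_def min_def)
  show ?thesis
  proof (rule that)
    fix x assume x: "\<bar>x\<bar> \<le> M"
    show "\<bar>\<Sum>d\<le>N. a d * x ^ d\<bar> \<le> 2" "\<bar>1 - (\<Sum>d\<le>N. a d * x ^ d)\<bar> \<le> 2"
      using close[OF x] f01[of x] tau by linarith+
    show "\<bar>\<Sum>d\<le>N. a d * x ^ d\<bar> \<le> \<tau>" if "x \<le> \<gamma> - \<eta>"
      using close[OF x] f0[OF that] by linarith
    show "\<bar>1 - (\<Sum>d\<le>N. a d * x ^ d)\<bar> \<le> \<tau>" if "\<gamma> + \<eta> \<le> x"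
      using close[OF x] f1[OF that] by linarith
  qed
qed

lemma continuous_on_mat_app_power:
  fixes x :: "'a \<Rightarrow> real"
  assumes "v \<in> S"
  shows "continuous_on UNIV (\<lambda>s. (mat_app S (add_potential B s) ^^ d) x v)"
  using assms
proof (induction d arbitrary: v)
  case (Suc d)
  have "continuous_on UNIV (\<lambda>s. mat_app S (add_potential B s) ((mat_app S (add_potential B s) ^^ d) x) v)"
    unfolding add_potential_def[of _ _ v]
    by (intro continuous_on_mat_app Suc.IH)
      (auto simp: add_potential_def intro!: continuous_intros continuous_on_product_coordinates)
  then show ?case by simp
qed simp

text \<open>The right side no longer mentions the eigenbasis. Thus the correlation is a function of
  the potential alone, and a continuous one.\<close>

lemma polynomial_calculus:
  assumes fin: "finite S" and sym: "symmetric_on S B" and eb: "eigenbasis S B e \<mu>" and v: "v \<in> S"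
  shows "(\<Sum>i<card S. (\<Sum>d\<le>N. a d * \<mu> i ^ d) * (e i v * ip S (e i) x)) =
    (\<Sum>d\<le>N. a d * (mat_app S B ^^ d) x v)"
proof -
  have "(mat_app S B ^^ d) x v = (\<Sum>i<card S. \<mu> i ^ d * (e i v * ip S (e i) x))" for d
    using ip_mat_app_power[OF fin sym eb, of "\<lambda>u. of_bool (u = v)" d x]
    by (simp add: ip_delta[OF fin v] ip_commute[of S "\<lambda>u. of_bool (u = v)"])
  then have "(\<Sum>d\<le>N. a d * (mat_app S B ^^ d) x v) =
      (\<Sum>d\<le>N. \<Sum>i<card S. a d * \<mu> i ^ d * (e i v * ip S (e i) x))"
    by (simp add: sum_distrib_left mult.assoc)
  also have "\<dots> = (\<Sum>i<card S. (\<Sum>d\<le>N. a d * \<mu> i ^ d) * (e i v * ip S (e i) x))"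
    by (subst sum.swap) (simp add: sum_distrib_right)
  finally show ?thesis ..
qed

text \<open>Poincare--Miranda lets all the clusters be split at the prescribed energies simultaneously.\<close>

lemma simultaneous_splitting:
  fixes S :: "'a set"
  assumes fin: "finite S" and sym: "symmetric_on S B" and J: "J \<subseteq> S" and alpha: "0 < \<alpha>" "\<alpha> \<le> 1"
    and cl: "\<And>v. v \<in> J \<Longrightarrow> spectral_cluster S B e \<mu> v (E v) r \<alpha> \<epsilon>"
    and weak: "\<And>v. v \<in> J \<Longrightarrow> (\<Sum>j\<in>J - {v}. (spectral_cluster.\<psi> S e \<mu> v (E v) r \<alpha> j)\<^sup>2) \<le> \<alpha>\<^sup>2"
    and eta: "0 < \<eta>" and r: "0 < r" and gam: "\<And>v. v \<in> J \<Longrightarrow> \<bar>\<gamma> v - E v\<bar> + \<eta> \<le> \<alpha> * r * \<epsilon> / 2"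
    and M: "\<forall>X e' \<mu>' i. (\<forall>v. \<bar>X v\<bar> \<le> \<alpha> * r) \<longrightarrow> eigenbasis S (add_potential B X) e' \<mu>' \<longrightarrow>
       i < card S \<longrightarrow> \<bar>\<mu>' i\<bar> \<le> M"
  shows "\<exists>X. (\<forall>v. \<bar>X v\<bar> \<le> \<alpha> * r) \<and> (\<forall>e' \<mu>' v. eigenbasis S (add_potential B X) e' \<mu>' \<longrightarrow> v \<in> J \<longrightarrow>
       (\<Sum>i | i < card S \<and> \<bar>\<mu>' i - \<gamma> v\<bar> < \<eta>. (e' i v)\<^sup>2) \<le> \<alpha>\<^sup>2 \<longrightarrow>
       \<epsilon>\<^sup>2 / 64 \<le> (\<Sum>i | i < card S \<and> \<gamma> v + \<eta> \<le> \<mu>' i \<and> \<bar>\<mu>' i - E v\<bar> \<le> r. (e' i v)\<^sup>2) \<and>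
       \<epsilon>\<^sup>2 / 64 \<le> (\<Sum>i | i < card S \<and> \<mu>' i \<le> \<gamma> v - \<eta> \<and> \<bar>\<mu>' i - E v\<bar> \<le> r. (e' i v)\<^sup>2))"
    (is "\<exists>X. _ \<and> (\<forall>e' \<mu>' v. _ \<longrightarrow> _ \<longrightarrow> _ \<longrightarrow> ?split X e' \<mu>' v)")
proof -
  define step where "step = (\<lambda>v a N. (\<forall>x. \<bar>x\<bar> \<le> M \<longrightarrow> \<bar>\<Sum>d\<le>N. a d * x ^ d\<bar> \<le> 2) \<and>
    (\<forall>x. \<bar>x\<bar> \<le> M \<longrightarrow> \<bar>1 - (\<Sum>d\<le>N. a d * x ^ d)\<bar> \<le> 2) \<and>
    (\<forall>x. \<bar>x\<bar> \<le> M \<longrightarrow> x \<le> \<gamma> v - \<eta> \<longrightarrow> \<bar>\<Sum>d\<le>N. a d * x ^ d\<bar> \<le> \<alpha>) \<and>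
    (\<forall>x. \<bar>x\<bar> \<le> M \<longrightarrow> \<gamma> v + \<eta> \<le> x \<longrightarrow> \<bar>1 - (\<Sum>d\<le>N. a d * x ^ d)\<bar> \<le> \<alpha>))"
  have "\<exists>a N. step v a N" for v
    unfolding step_def by (rule step_polynomial_exists[OF eta alpha, of M "\<gamma> v"]) blast
  then obtain a N where step: "\<And>v. step v (a v) (N v)" by metis
  define f where "f = (\<lambda>v x. \<Sum>d\<le>N v. a v d * x ^ d)"
  have fM: "\<bar>f v x\<bar> \<le> 2" "\<bar>1 - f v x\<bar> \<le> 2" "x \<le> \<gamma> v - \<eta> \<Longrightarrow> \<bar>f v x\<bar> \<le> \<alpha>"
    "\<gamma> v + \<eta> \<le> x \<Longrightarrow> \<bar>1 - f v x\<bar> \<le> \<alpha>" if "\<bar>x\<bar> \<le> M" for v x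
    using step[of v] that unfolding step_def f_def by auto
  define \<psi> where "\<psi> = (\<lambda>v. spectral_cluster.\<psi> S e \<mu> v (E v) r \<alpha>)"
  define wt where "wt = (\<lambda>v. spectral_cluster.w S e \<mu> v (E v) r \<alpha>)"
  \<comment> \<open>A zero of \<open>c v\<close> means that the smoothed step at
    \<open>\<gamma> v\<close> assigns exactly half of the cluster weight of \<open>v\<close> to its
    upper side.\<close>
  define c where "c = (\<lambda>v s. (\<Sum>d\<le>N v. a v d * (mat_app S (add_potential B s) ^^ d) (\<psi> v) v) - wt v / 2)"
  have h: "0 < \<alpha> * r" using alpha r by simp
  have corr: "c v s = spectral_cluster.corr S e \<mu> v (E v) r \<alpha> e' \<mu>' (f v) - wt v / 2"
    if "v \<in> J" and "eigenbasis S (add_potential B s) e' \<mu>'" for v s e' \<mu>'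
    using that J polynomial_calculus[OF fin symmetric_add_potential[OF sym] that(2), of v "a v" "N v" "\<psi> v"]
    by (auto simp: c_def spectral_cluster.corr_def[OF cl[OF that(1)]] f_def \<psi>_def)
  have weps: "\<epsilon> \<le> wt v" if "v \<in> J" for v
    unfolding wt_def by (rule spectral_cluster.w_bounds[OF cl[OF that]])
  have hw: "\<alpha> * r * \<epsilon> / 2 \<le> \<alpha> * r * wt v / 2" if "v \<in> J" for v
    using mult_left_mono[OF weps[OF that], of "\<alpha> * r"] h by simp
  obtain X where X: "\<And>i. \<bar>X i\<bar> \<le> \<alpha> * r" "\<And>i. i \<notin> J \<Longrightarrow> X i = 0" "\<And>v. v \<in> J \<Longrightarrow> c v X = 0"
  proof (rule poincare_miranda[of J "\<alpha> * r" c])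
    show "finite J" using J fin by (rule finite_subset)
    show "0 < \<alpha> * r" by (rule h)
    show "continuous_on UNIV (c v)" if "v \<in> J" for v
      unfolding c_def using that J by (intro continuous_intros continuous_on_mat_app_power) auto
    fix v s assume vJ: "v \<in> J" and s: "\<And>i. \<bar>s i\<bar> \<le> \<alpha> * r" "\<And>i. i \<notin> J \<Longrightarrow> s i = 0"
    interpret spectral_cluster S B e \<mu> v "E v" r \<alpha> \<epsilon> by (rule cl[OF vJ])
    obtain e' \<mu>' where eb': "eigenbasis S (add_potential B s) e' \<mu>'"
      using eigenbasis_exists[OF fin symmetric_add_potential[OF sym]] by blast
    have s': "\<And>i. \<bar>s i\<bar> \<le> local.h" using s(1) by (simp add: h_def)
    have bd: "\<bar>\<mu>' i\<bar> \<le> M" if "i < card S" for i using M s(1) eb' that by blast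
    have ww: "wt v = local.w" by (simp add: wt_def)
    note g = gam[OF vJ] hw[OF vJ, unfolded ww]
    \<comment> \<open>At the lowest value the cluster sits near E - h w. By \<open>gam\<close> the
      window of radius h w / 2 about that energy lies below \<open>\<gamma> v - \<eta>\<close>,
      whatever the potential does at the other points of \<open>J\<close>. The opposite face is
      symmetric, with \<open>1 - f v\<close>.\<close>
    show "c v s \<le> 0" if sv: "s v = - (\<alpha> * r)"
    proof -
      have "\<bar>local.corr e' \<mu>' (f v)\<bar> \<le> local.w / 2"
      proof (rule corr_small[OF s' s(2) J weak[OF vJ] eb'])
        fix i assume i: "i < card S"
        show "\<bar>f v (\<mu>' i)\<bar> \<le> 2" by (rule fM[OF bd[OF i]])
        assume "\<bar>\<mu>' i - (E v + s v * local.w)\<bar> < local.h * local.w / 2"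
        then have "\<mu>' i \<le> \<gamma> v - \<eta>"
          using g unfolding sv h_def by (simp add: abs_le_iff) argo
        then show "\<bar>f v (\<mu>' i)\<bar> \<le> \<alpha>" by (rule fM[OF bd[OF i]])
      qed
      then show ?thesis unfolding corr[OF vJ eb'] ww by linarith
    qed
    show "0 \<le> c v s" if sv: "s v = \<alpha> * r"
    proof -
      have "\<bar>local.corr e' \<mu>' (\<lambda>x. 1 - f v x)\<bar> \<le> local.w / 2"
      proof (rule corr_small[OF s' s(2) J weak[OF vJ] eb'])
        fix i assume i: "i < card S"
        show "\<bar>1 - f v (\<mu>' i)\<bar> \<le> 2" by (rule fM[OF bd[OF i]])
        assume "\<bar>\<mu>' i - (E v + s v * local.w)\<bar> < local.h * local.w / 2"
        then have "\<gamma> v + \<eta> \<le> \<mu>' i"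
          using g unfolding sv h_def by (simp add: abs_le_iff) argo
        then show "\<bar>1 - f v (\<mu>' i)\<bar> \<le> \<alpha>" by (rule fM[OF bd[OF i]])
      qed
      then show ?thesis
        using corr_one[OF s' s(2) J weak[OF vJ] eb', of "f v"] unfolding corr[OF vJ eb'] ww by linarith
    qed
  next
    fix X assume "\<And>i. \<bar>X i\<bar> \<le> \<alpha> * r" "\<And>i. i \<notin> J \<Longrightarrow> X i = 0" "\<And>v. v \<in> J \<Longrightarrow> c v X = 0"
    then show thesis by (rule that)
  qed
  show ?thesis
  proof (intro exI[of _ X] conjI[OF allI[OF X(1)]] allI impI)
    fix e' \<mu>' v
    assume eb': "eigenbasis S (add_potential B X) e' \<mu>'" and vJ: "v \<in> J"
      and mid: "(\<Sum>i | i < card S \<and> \<bar>\<mu>' i - \<gamma> v\<bar> < \<eta>. (e' i v)\<^sup>2) \<le> \<alpha>\<^sup>2"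
    interpret spectral_cluster S B e \<mu> v "E v" r \<alpha> \<epsilon> by (rule cl[OF vJ])
    have X': "\<And>i. \<bar>X i\<bar> \<le> local.h" using X(1) by (simp add: h_def)
    have bd: "\<bar>\<mu>' i\<bar> \<le> M" if "i < card S" for i using M X(1) eb' that by blast
    have ww: "wt v = local.w" by (simp add: wt_def)
    have half: "local.corr e' \<mu>' (f v) = local.w / 2"
      using X(3)[OF vJ] unfolding corr[OF vJ eb'] ww by simp
    then have half': "local.corr e' \<mu>' (\<lambda>x. 1 - f v x) = local.w / 2"
      using corr_one[OF X' X(2) J weak[OF vJ] eb', of "f v"] by linarith
    have "\<epsilon>\<^sup>2 / 64 \<le> (\<Sum>i | i < card S \<and> \<not> \<mu>' i \<le> \<gamma> v - \<eta> \<and> \<not> \<bar>\<mu>' i - \<gamma> v\<bar> < \<eta> \<and> \<bar>\<mu>' i - E v\<bar> \<le> r. (e' i v)\<^sup>2)"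
      using half mid bd
      by (intro corr_large[OF X' X(2) J weak[OF vJ] eb', of "f v" "\<lambda>x. x \<le> \<gamma> v - \<eta>" "\<lambda>x. \<bar>x - \<gamma> v\<bar> < \<eta>"] fM) auto
    moreover have "{i. i < card S \<and> \<not> \<mu>' i \<le> \<gamma> v - \<eta> \<and> \<not> \<bar>\<mu>' i - \<gamma> v\<bar> < \<eta> \<and> \<bar>\<mu>' i - E v\<bar> \<le> r} =
        {i. i < card S \<and> \<gamma> v + \<eta> \<le> \<mu>' i \<and> \<bar>\<mu>' i - E v\<bar> \<le> r}"
      using eta by auto
    moreover have "\<epsilon>\<^sup>2 / 64 \<le> (\<Sum>i | i < card S \<and> \<not> \<gamma> v + \<eta> \<le> \<mu>' i \<and> \<not> \<bar>\<mu>' i - \<gamma> v\<bar> < \<eta> \<and> \<bar>\<mu>' i - E v\<bar> \<le> r. (e' i v)\<^sup>2)"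
      using half' mid bd
      by (intro corr_large[OF X' X(2) J weak[OF vJ] eb', of "\<lambda>x. 1 - f v x" "\<lambda>x. \<gamma> v + \<eta> \<le> x" "\<lambda>x. \<bar>x - \<gamma> v\<bar> < \<eta>"] fM) auto
    moreover have "{i. i < card S \<and> \<not> \<gamma> v + \<eta> \<le> \<mu>' i \<and> \<not> \<bar>\<mu>' i - \<gamma> v\<bar> < \<eta> \<and> \<bar>\<mu>' i - E v\<bar> \<le> r} =
        {i. i < card S \<and> \<mu>' i \<le> \<gamma> v - \<eta> \<and> \<bar>\<mu>' i - E v\<bar> \<le> r}"
      using eta by auto
    ultimately show "?split X e' \<mu>' v" by simp
  qed
qed

text \<open>Pairs with one eigenvalue above and one below the gap are at distance at least
  \<open>2 * \<eta>\<close> and at most \<open>2 * r \<le> \<rho> / 2\<close>. They count at scale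
  \<open>\<rho> / 2\<close> but no longer at \<open>\<eta>\<close>, and weigh at least
  \<open>c\<^sup>2\<close>.\<close>

lemma pair_form_split:
  assumes eta: "0 < \<eta>" and rho: "4 * r \<le> \<rho>" and eta_rho: "2 * \<eta> \<le> \<rho>"
    and up: "c \<le> (\<Sum>i | i < card S \<and> \<gamma> + \<eta> \<le> \<mu> i \<and> \<bar>\<mu> i - E\<bar> \<le> r. (e i v)\<^sup>2)"
    and down: "c \<le> (\<Sum>i | i < card S \<and> \<mu> i \<le> \<gamma> - \<eta> \<and> \<bar>\<mu> i - E\<bar> \<le> r. (e i v)\<^sup>2)"
    and c: "0 \<le> c"
  shows "pair_form S e \<mu> (\<lambda>x. of_bool (\<bar>x\<bar> \<le> \<eta>)) v + c\<^sup>2 \<le> pair_form S e \<mu> (\<lambda>x. of_bool (\<bar>x\<bar> \<le> \<rho> / 2)) v"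
proof -
  define U where "U = (\<lambda>i. \<gamma> + \<eta> \<le> \<mu> i \<and> \<bar>\<mu> i - E\<bar> \<le> r)"
  define D where "D = (\<lambda>i. \<mu> i \<le> \<gamma> - \<eta> \<and> \<bar>\<mu> i - E\<bar> \<le> r)"
  have "c\<^sup>2 \<le> (\<Sum>i<card S. of_bool (U i) * (e i v)\<^sup>2) * (\<Sum>j<card S. of_bool (D j) * (e j v)\<^sup>2)"
    unfolding sum_of_bool_filter power2_eq_square[of c]
    using up down c by (intro mult_mono) (auto simp: U_def D_def sum_nonneg)
  also have "\<dots> = (\<Sum>i<card S. \<Sum>j<card S. of_bool (U i \<and> D j) * ((e i v)\<^sup>2 * (e j v)\<^sup>2))"
    unfolding sum_product by (intro sum.cong refl) (simp add: of_bool_conj mult_ac)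
  finally have "pair_form S e \<mu> (\<lambda>x. of_bool (\<bar>x\<bar> \<le> \<eta>)) v + c\<^sup>2 \<le>
      (\<Sum>i<card S. \<Sum>j<card S. (of_bool (\<bar>\<mu> i - \<mu> j\<bar> \<le> \<eta>) + of_bool (U i \<and> D j)) * ((e i v)\<^sup>2 * (e j v)\<^sup>2))"
    by (simp add: pair_form_def distrib_right sum.distrib)
  also have "\<dots> \<le> pair_form S e \<mu> (\<lambda>x. of_bool (\<bar>x\<bar> \<le> \<rho> / 2)) v"
    unfolding pair_form_def
  proof (intro sum_mono mult_right_mono)
    fix i j assume "i \<in> {..<card S}"
    have "\<not> \<bar>\<mu> i - \<mu> j\<bar> \<le> \<eta> \<and> \<bar>\<mu> i - \<mu> j\<bar> \<le> \<rho> / 2" if "U i" "D j"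
      using that eta rho unfolding U_def D_def by (auto simp: abs_le_iff)
    moreover have "\<bar>\<mu> i - \<mu> j\<bar> \<le> \<rho> / 2" if "\<bar>\<mu> i - \<mu> j\<bar> \<le> \<eta>"
      using that eta_rho by linarith
    ultimately show "of_bool (\<bar>\<mu> i - \<mu> j\<bar> \<le> \<eta>) + of_bool (U i \<and> D j) \<le> (of_bool (\<bar>\<mu> i - \<mu> j\<bar> \<le> \<rho> / 2) :: real)"
      by (auto simp: of_bool_def)
  qed auto
  finally show ?thesis .
qed

section \<open>Dispersal of localized vertices\<close>

text \<open>The \<open>m\<close> annuli are disjoint and share a total mass of at most 1, so one of
  them has at most the average.\<close>

lemma quiet_annulus_exists:
  assumes eb: "eigenbasis S B e \<mu>" and v: "v \<in> S" and R: "antimono R" and m: "0 < m"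
  obtains i where "i < m"
    "(\<Sum>j | j < card S \<and> R (Suc i) < \<bar>\<mu> j - E\<bar> \<and> \<bar>\<mu> j - E\<bar> \<le> R i. (e j v)\<^sup>2) \<le> 1 / real m"
proof -
  define P where "P = (\<lambda>i j. R (Suc i) < \<bar>\<mu> j - E\<bar> \<and> \<bar>\<mu> j - E\<bar> \<le> R i)"
  define A where "A = (\<lambda>i. \<Sum>j<card S. of_bool (P i j) * (e j v)\<^sup>2)"
  have one: "(\<Sum>i<m. of_bool (P i j)) \<le> (1::real)" for j
  proof -
    have "of_bool (P i j) = of_bool (\<bar>\<mu> j - E\<bar> \<le> R i) - (of_bool (\<bar>\<mu> j - E\<bar> \<le> R (Suc i)) :: real)" for i
      using antimonoD[OF R, of i "Suc i"] by (auto simp: P_def of_bool_def)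
    then have "(\<Sum>i<m. of_bool (P i j)) =
        of_bool (\<bar>\<mu> j - E\<bar> \<le> R 0) - (of_bool (\<bar>\<mu> j - E\<bar> \<le> R m) :: real)"
      using sum_lessThan_telescope'[of "\<lambda>i. of_bool (\<bar>\<mu> j - E\<bar> \<le> R i) :: real" m]
      by (simp only:)
    then show ?thesis by (simp add: of_bool_def split: if_splits)
  qed
  have "(\<Sum>i<m. A i) = (\<Sum>j<card S. (\<Sum>i<m. of_bool (P i j)) * (e j v)\<^sup>2)"
    unfolding A_def by (subst sum.swap) (simp add: sum_distrib_right)
  also have "\<dots> \<le> (\<Sum>j<card S. 1 * (e j v)\<^sup>2)"
    using one by (intro sum_mono mult_right_mono) auto
  finally have tot: "(\<Sum>i<m. A i) \<le> 1"
    by (simp add: eigenbasis_row_norm[OF eb v])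
  have "\<exists>i<m. A i \<le> 1 / real m"
  proof (rule ccontr)
    assume "\<not> ?thesis"
    then have "(\<Sum>i<m. 1 / real m) < (\<Sum>i<m. A i)"
      using m by (intro sum_strict_mono) (auto simp: not_le)
    then show False using tot m by simp
  qed
  then show ?thesis using that by (auto simp: A_def P_def sum_of_bool_filter)
qed

lemma finite_net_exists:
  fixes g M :: real
  assumes "0 < g"
  obtains \<Gamma> :: "real set" where "finite \<Gamma>" "\<And>x. \<bar>x\<bar> \<le> M \<Longrightarrow> \<exists>z\<in>\<Gamma>. \<bar>z - x\<bar> \<le> g"
proof
  show "finite ((\<lambda>k::int. g * of_int k) ` {\<lfloor>- M / g\<rfloor>..\<lfloor>M / g\<rfloor>})" by simp
  fix x :: real assume x: "\<bar>x\<bar> \<le> M"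
  have "g * of_int \<lfloor>x / g\<rfloor> - x = g * (of_int \<lfloor>x / g\<rfloor> - x / g)"
    using assms by (simp add: right_diff_distrib)
  then have "\<bar>g * of_int \<lfloor>x / g\<rfloor> - x\<bar> = g * \<bar>of_int \<lfloor>x / g\<rfloor> - x / g\<bar>"
    using assms by (simp only: abs_mult abs_of_pos)
  also have "\<dots> \<le> g * 1"
    using assms floor_correct[of "x / g"] by (intro mult_left_mono) linarith+
  finally have close: "\<bar>g * of_int \<lfloor>x / g\<rfloor> - x\<bar> \<le> g" by simp
  show "\<exists>z\<in>(\<lambda>k::int. g * of_int k) ` {\<lfloor>- M / g\<rfloor>..\<lfloor>M / g\<rfloor>}. \<bar>z - x\<bar> \<le> g"
  proof (intro bexI[of _ "g * of_int \<lfloor>x / g\<rfloor>"] imageI close)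
    have "- M / g \<le> x / g" "x / g \<le> M / g"
      using x assms by (intro divide_right_mono; linarith)+
    then show "\<lfloor>x / g\<rfloor> \<in> {\<lfloor>- M / g\<rfloor>..\<lfloor>M / g\<rfloor>}" by (simp add: floor_mono)
  qed
qed

lemma row_add_potential:
  assumes "finite S" "v \<in> S"
  shows "(\<Sum>u\<in>S. \<bar>add_potential B X v u\<bar>) \<le> (\<Sum>u\<in>S. \<bar>B v u\<bar>) + \<bar>X v\<bar>"
proof -
  have "(\<Sum>u\<in>S. \<bar>add_potential B X v u\<bar>) \<le> (\<Sum>u\<in>S. \<bar>B v u\<bar> + \<bar>X v\<bar> * of_bool (u = v))"
    by (intro sum_mono) (auto simp: add_potential_def)
  then show ?thesis using assms by (simp add: sum.distrib sum_delta_vec)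
qed

text \<open>The trace of a spectral projection is its rank.\<close>

lemma sum_weight_eq_card:
  assumes eb: "eigenbasis S B e \<mu>"
  shows "(\<Sum>v\<in>S. \<Sum>i | i < card S \<and> P i. (e i v)\<^sup>2) = real (card {i. i < card S \<and> P i})"
proof -
  have "(\<Sum>v\<in>S. \<Sum>i | i < card S \<and> P i. (e i v)\<^sup>2) = (\<Sum>i | i < card S \<and> P i. ip S (e i) (e i))"
    unfolding ip_def power2_eq_square by (rule sum.swap)
  also have "\<dots> = (\<Sum>i | i < card S \<and> P i. 1)"
    using eigenbasis_orthonormal[OF eb] by (intro sum.cong) auto
  finally show ?thesis by simp
qed

text \<open>Markov's inequality. Since the centre varies with \<open>v\<close>, the masses near all
  points of the net are added up before the trace is taken.\<close>

lemma few_vertices_near_net: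
  fixes a c :: real
  assumes fin: "finite S" and eb: "eigenbasis S B e \<mu>" and J: "J \<subseteq> S" and net: "finite \<Gamma>"
    and gam: "\<And>v. v \<in> J \<Longrightarrow> \<gamma> v \<in> \<Gamma>" and a: "0 \<le> a"
    and few: "\<And>z. z \<in> \<Gamma> \<Longrightarrow> real (card {i. i < card S \<and> \<bar>\<mu> i - z\<bar> < \<eta>}) \<le> c"
  shows "a * card {v\<in>J. a < (\<Sum>i | i < card S \<and> \<bar>\<mu> i - \<gamma> v\<bar> < \<eta>. (e i v)\<^sup>2)} \<le> card \<Gamma> * c"
proof -
  define A where "A = (\<lambda>z v. \<Sum>i | i < card S \<and> \<bar>\<mu> i - z\<bar> < \<eta>. (e i v)\<^sup>2)"
  have A0: "0 \<le> A z v" for z v by (simp add: A_def sum_nonneg)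
  define K where "K = {v\<in>J. a < A (\<gamma> v) v}"
  have KS: "K \<subseteq> S" using J by (auto simp: K_def)
  have "a * card K = (\<Sum>v\<in>K. a)" by simp
  also have "\<dots> \<le> (\<Sum>v\<in>K. \<Sum>z\<in>\<Gamma>. A z v)"
  proof (rule sum_mono)
    fix v assume v: "v \<in> K"
    then have "a \<le> A (\<gamma> v) v" by (auto simp: K_def)
    also have "\<dots> \<le> (\<Sum>z\<in>\<Gamma>. A z v)"
      using v gam net A0 by (intro member_le_sum) (auto simp: K_def)
    finally show "a \<le> (\<Sum>z\<in>\<Gamma>. A z v)" .
  qed
  also have "\<dots> \<le> (\<Sum>v\<in>S. \<Sum>z\<in>\<Gamma>. A z v)"
    using fin KS A0 by (intro sum_mono2) (auto intro: sum_nonneg)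
  also have "\<dots> = (\<Sum>z\<in>\<Gamma>. \<Sum>v\<in>S. A z v)" by (rule sum.swap)
  also have "\<dots> = (\<Sum>z\<in>\<Gamma>. real (card {i. i < card S \<and> \<bar>\<mu> i - z\<bar> < \<eta>}))"
    unfolding A_def by (intro sum.cong refl sum_weight_eq_card[OF eb])
  also have "\<dots> \<le> (\<Sum>z\<in>\<Gamma>. c)" using few by (intro sum_mono)
  finally show ?thesis by (simp add: K_def A_def)
qed

definition atom_vertices :: "real \<Rightarrow> 'a set \<Rightarrow> (nat \<Rightarrow> 'a \<Rightarrow> real) \<Rightarrow> (nat \<Rightarrow> real) \<Rightarrow> 'a set" where
  "atom_vertices \<epsilon> S e \<mu> = {v \<in> S. \<exists>E. \<epsilon> < (\<Sum>i | i < card S \<and> \<mu> i = E. (e i v)\<^sup>2)}"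

text \<open>This is \<Phi> without the average: the sum over the vertices.\<close>

definition localization :: "'a set \<Rightarrow> (nat \<Rightarrow> 'a \<Rightarrow> real) \<Rightarrow> (nat \<Rightarrow> real) \<Rightarrow> real \<Rightarrow> real" where
  "localization S e \<mu> \<rho> = (\<Sum>v\<in>S. pair_form S e \<mu> (\<lambda>x. of_bool (\<bar>x\<bar> \<le> \<rho>)) v)"

text \<open>Of the factor \<open>2 * k * m\<close>, \<open>m\<close> pays for agreeing on one scale
  and \<open>2 * k\<close> for the thinning. A common scale is needed because the potential will
  range over a cube of side proportional to it.\<close>

lemma weakly_interacting_clusters:
  fixes S :: "'a set"
  assumes fin: "finite S" and sym: "symmetric_on S B" and eb: "eigenbasis S B e \<mu>"
    and eps: "0 < \<epsilon>" "\<epsilon> \<le> 1" and alpha: "\<alpha> = \<epsilon>\<^sup>2 / 100" and r0: "0 < r0"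
    and m: "0 < m" "1 / real m \<le> \<alpha>\<^sup>2" and k: "0 < k" "2 / real k \<le> \<alpha>\<^sup>2"
  obtains j J E where "j < m" "J \<subseteq> S" "card (atom_vertices \<epsilon> S e \<mu>) \<le> 2 * k * m * card J"
    "\<And>v. v \<in> J \<Longrightarrow> spectral_cluster S B e \<mu> v (E v) (r0 * \<alpha> ^ (2 * j)) \<alpha> \<epsilon>"
    "\<And>v. v \<in> J \<Longrightarrow> \<exists>i<card S. E v = \<mu> i"
    "\<And>v. v \<in> J \<Longrightarrow> (\<Sum>u\<in>J - {v}. (spectral_cluster.\<psi> S e \<mu> v (E v) (r0 * \<alpha> ^ (2 * j)) \<alpha> u)\<^sup>2) \<le> \<alpha>\<^sup>2"
proof -
  have a01: "0 < \<alpha>" "\<alpha> \<le> 1"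
    using eps power_le_one[of \<epsilon> 2] by (auto simp: alpha)
  \<comment> \<open>Consecutive radii have ratio \<open>\<alpha>\<^sup>2\<close>, so a quiet annulus
    of this sequence is the one that \<open>spectral_cluster\<close> asks for.\<close>
  define R where "R = (\<lambda>i. r0 * \<alpha> ^ (2 * i))"
  have R0: "0 < R i" for i using r0 a01 by (simp add: R_def)
  have RS: "R (Suc i) = \<alpha>\<^sup>2 * R i" for i by (simp add: R_def power2_eq_square)
  have anti: "antimono R"
    unfolding R_def using r0 a01
    by (intro antimonoI mult_left_mono power_decreasing) auto
  define Bad where "Bad = atom_vertices \<epsilon> S e \<mu>"
  have "\<exists>E. \<epsilon> < (\<Sum>i | i < card S \<and> \<mu> i = E. (e i v)\<^sup>2)" if "v \<in> Bad" for v
    using that by (auto simp: Bad_def atom_vertices_def)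
  then obtain E where E: "\<And>v. v \<in> Bad \<Longrightarrow> \<epsilon> < (\<Sum>i | i < card S \<and> \<mu> i = E v. (e i v)\<^sup>2)"
    by metis
  have BS: "Bad \<subseteq> S" by (auto simp: Bad_def atom_vertices_def)
  have finB: "finite Bad" using BS fin by (rule finite_subset)
  define quiet where "quiet = (\<lambda>v i. i < m \<and> (\<Sum>j | j < card S \<and> R (Suc i) < \<bar>\<mu> j - E v\<bar> \<and> \<bar>\<mu> j - E v\<bar> \<le> R i.
      (e j v)\<^sup>2) \<le> 1 / real m)"
  have "\<exists>i. quiet v i" if "v \<in> Bad" for v
  proof -
    have "v \<in> S" using that BS by blast
    then show ?thesis
      by (rule quiet_annulus_exists[OF eb _ anti m(1), where E = "E v"]) (use quiet_def in blast)
  qed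
  then obtain l where l: "\<And>v. v \<in> Bad \<Longrightarrow> quiet v (l v)" by metis
  then have lm: "\<And>v. v \<in> Bad \<Longrightarrow> l v < m" by (auto simp: quiet_def)
  obtain j where j: "j < m" "card Bad \<le> m * card {v\<in>Bad. l v = j}"
    using large_fibre_exists[of Bad m l] finB m(1) lm by blast
  define Bj where "Bj = {v\<in>Bad. l v = j}"
  have cl: "spectral_cluster S B e \<mu> v (E v) (R j) \<alpha> \<epsilon>" if v: "v \<in> Bj" for v
  proof
    have vB: "v \<in> Bad" "l v = j" using v by (auto simp: Bj_def)
    show "v \<in> S" using vB BS by auto
    show "(\<Sum>i | i < card S \<and> \<alpha>\<^sup>2 * R j < \<bar>\<mu> i - E v\<bar> \<and> \<bar>\<mu> i - E v\<bar> \<le> R j. (e i v)\<^sup>2) \<le> \<alpha>\<^sup>2"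
      using l[OF vB(1)] m(2) unfolding vB quiet_def RS by linarith
    have "(\<Sum>i | i < card S \<and> \<mu> i = E v. (e i v)\<^sup>2) \<le>
        (\<Sum>i | i < card S \<and> \<bar>\<mu> i - E v\<bar> \<le> \<alpha>\<^sup>2 * R j. (e i v)\<^sup>2)"
      using R0[of j] by (intro sum_mono2) auto
    then show "\<epsilon> \<le> (\<Sum>i | i < card S \<and> \<bar>\<mu> i - E v\<bar> \<le> \<alpha>\<^sup>2 * R j. (e i v)\<^sup>2)"
      using E[OF vB(1)] by linarith
    show "\<alpha> \<le> \<epsilon>\<^sup>2 / 100" by (simp add: alpha)
  qed (fact fin sym eb eps a01 R0)+
  define \<psi> where "\<psi> = (\<lambda>v. if v \<in> Bj then spectral_cluster.\<psi> S e \<mu> v (E v) (R j) \<alpha> else (\<lambda>_. 0))"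
  have "(\<Sum>u\<in>Bj. (\<psi> v u)\<^sup>2) \<le> 1" if v: "v \<in> Bj" for v
  proof -
    have "(\<Sum>u\<in>Bj. (\<psi> v u)\<^sup>2) \<le> (\<Sum>u\<in>S. (\<psi> v u)\<^sup>2)"
      using fin BS by (intro sum_mono2) (auto simp: Bj_def)
    also have "\<dots> = (L2_set (\<psi> v) S)\<^sup>2" by (simp add: L2_set_def sum_nonneg)
    also have "\<dots> \<le> 1"
      using spectral_cluster.psi_le_1[OF cl[OF v]] v by (simp add: \<psi>_def power_le_one)
    finally show ?thesis .
  qed
  then obtain J where J: "J \<subseteq> Bj" "card Bj \<le> 2 * k * card J"
    "\<And>v. v \<in> J \<Longrightarrow> (\<Sum>u\<in>J - {v}. (\<psi> v u)\<^sup>2) \<le> 2 / real k"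
    using weakly_interacting_subset[of Bj k "\<lambda>v u. (\<psi> v u)\<^sup>2"] k(1) finB
    by (auto simp: Bj_def)
  show ?thesis
  proof (rule that[of j J E, OF j(1)])
    show "J \<subseteq> S" using J(1) BS by (auto simp: Bj_def)
    have "card Bad \<le> m * card Bj" using j(2) by (simp add: Bj_def)
    also have "\<dots> \<le> m * (2 * k * card J)" using J(2) by (rule mult_left_mono) simp
    finally show "card (atom_vertices \<epsilon> S e \<mu>) \<le> 2 * k * m * card J"
      by (simp add: Bad_def mult_ac)
    fix v assume v: "v \<in> J"
    then have vj: "v \<in> Bj" using J(1) by auto
    show "spectral_cluster S B e \<mu> v (E v) (r0 * \<alpha> ^ (2 * j)) \<alpha> \<epsilon>"
      using cl[OF vj] by (simp add: R_def)
    show "(\<Sum>u\<in>J - {v}. (spectral_cluster.\<psi> S e \<mu> v (E v) (r0 * \<alpha> ^ (2 * j)) \<alpha> u)\<^sup>2) \<le> \<alpha>\<^sup>2"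
      using J(3)[OF v] k(2) vj by (simp add: \<psi>_def R_def)
    \<comment> \<open>An atom of positive weight sits at an eigenvalue; this later places
      \<open>E v\<close> within reach of the net.\<close>
    show "\<exists>i<card S. E v = \<mu> i"
    proof (rule ccontr)
      assume "\<not> ?thesis"
      then have none: "{i. i < card S \<and> \<mu> i = E v} = {}" by auto
      have "\<epsilon> < (\<Sum>i | i < card S \<and> \<mu> i = E v. (e i v)\<^sup>2)"
        using E[of v] vj by (simp add: Bj_def)
      then show False using eps unfolding none by simp
    qed
  qed
qed

text \<open>Points of \<open>J\<close> lose the pairs across their gaps; at the other points the
  passage from \<open>\<rho> / 2\<close> to the smaller scale \<open>\<eta>\<close> cannot add
  pairs.\<close>

lemma localization_decreases:
  assumes fin: "finite S" and eb: "eigenbasis S B e \<mu>" and J: "J \<subseteq> S"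
    and eta: "0 < \<eta>" "2 * \<eta> \<le> \<rho>" and r: "4 * r \<le> \<rho>" and c: "0 \<le> c"
    and up: "\<And>v. v \<in> J \<Longrightarrow> c \<le> (\<Sum>i | i < card S \<and> \<gamma> v + \<eta> \<le> \<mu> i \<and> \<bar>\<mu> i - E v\<bar> \<le> r. (e i v)\<^sup>2)"
    and down: "\<And>v. v \<in> J \<Longrightarrow> c \<le> (\<Sum>i | i < card S \<and> \<mu> i \<le> \<gamma> v - \<eta> \<and> \<bar>\<mu> i - E v\<bar> \<le> r. (e i v)\<^sup>2)"
  shows "localization S e \<mu> \<eta> + c\<^sup>2 * card J \<le> localization S e \<mu> (\<rho> / 2)"
proof -
  have "(\<Sum>v\<in>S. c\<^sup>2 * of_bool (v \<in> J)) = (\<Sum>v\<in>J. c\<^sup>2)"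
    using J fin by (intro sum.mono_neutral_cong_right) auto
  then have "localization S e \<mu> \<eta> + c\<^sup>2 * card J =
      (\<Sum>v\<in>S. pair_form S e \<mu> (\<lambda>x. of_bool (\<bar>x\<bar> \<le> \<eta>)) v + c\<^sup>2 * of_bool (v \<in> J))"
    by (simp add: localization_def sum.distrib)
  also have "\<dots> \<le> localization S e \<mu> (\<rho> / 2)"
    unfolding localization_def
  proof (rule sum_mono)
    fix v assume v: "v \<in> S"
    show "pair_form S e \<mu> (\<lambda>x. of_bool (\<bar>x\<bar> \<le> \<eta>)) v + c\<^sup>2 * of_bool (v \<in> J) \<le>
        pair_form S e \<mu> (\<lambda>x. of_bool (\<bar>x\<bar> \<le> \<rho> / 2)) v"
    proof (cases "v \<in> J")
      case True
      then show ?thesis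
        using pair_form_split[where S = S and e = e and \<mu> = \<mu> and v = v and \<gamma> = "\<gamma> v" and E = "E v",
          OF eta(1) r eta(2) up[OF True] down[OF True] c] by simp
    next
      case False
      then show ?thesis
        using pair_form_le[OF eb v, of "\<lambda>x. of_bool (\<bar>x\<bar> \<le> \<eta>)" "\<lambda>x. of_bool (\<bar>x\<bar> \<le> \<rho> / 2)" 0] eta(2)
        by (simp add: of_bool_def)
    qed
  qed
  finally show ?thesis .
qed

text \<open>The form in which continuity of the IDS is used: short intervals, wherever they lie,
  hold a small fraction of the eigenvalues. Ranging over all eigenbases makes it a property of the
  matrix.\<close>

definition sparse_spectrum :: "'a set \<Rightarrow> ('a \<Rightarrow> 'a \<Rightarrow> real) \<Rightarrow> real \<Rightarrow> real \<Rightarrow> bool" where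
  "sparse_spectrum S B \<eta> c \<longleftrightarrow> (\<forall>e \<mu> z. eigenbasis S B e \<mu> \<longrightarrow>
     real (card {i. i < card S \<and> \<bar>\<mu> i - z\<bar> < \<eta>}) \<le> c * card S)"

lemma pair_form_bounds:
  assumes eb: "eigenbasis S B e \<mu>" and v: "v \<in> S"
  shows "0 \<le> pair_form S e \<mu> (\<lambda>x. of_bool (P x)) v" "pair_form S e \<mu> (\<lambda>x. of_bool (P x)) v \<le> 1"
proof -
  show "0 \<le> pair_form S e \<mu> (\<lambda>x. of_bool (P x)) v"
    unfolding pair_form_def by (intro sum_nonneg mult_nonneg_nonneg) auto
  have "pair_form S e \<mu> (\<lambda>x. of_bool (P x)) v \<le> pair_form S e \<mu> (\<lambda>x. 0) v + 1"
    by (rule pair_form_le[OF eb v]) auto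
  then show "pair_form S e \<mu> (\<lambda>x. of_bool (P x)) v \<le> 1" by (simp add: pair_form_def)
qed

lemma localization_bounds:
  assumes eb: "eigenbasis S B e \<mu>"
  shows "0 \<le> localization S e \<mu> \<rho>" "localization S e \<mu> \<rho> \<le> card S"
proof -
  show "0 \<le> localization S e \<mu> \<rho>"
    unfolding localization_def by (intro sum_nonneg pair_form_bounds[OF eb])
  have "localization S e \<mu> \<rho> \<le> (\<Sum>v\<in>S. 1)"
    unfolding localization_def by (intro sum_mono pair_form_bounds[OF eb])
  then show "localization S e \<mu> \<rho> \<le> card S" by simp
qed

text \<open>\<open>\<kappa>\<close> is the drop per point, \<open>M\<close> the bound on row sums,
  \<open>\<rho>\<close> and \<open>\<eta>\<close> the old and the new scale, \<open>\<beta>\<close>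
  the allowed change and \<open>c\<close> the fraction of eigenvalues in short intervals. Sparsity
  is demanded for all changes because the one that Poincare--Miranda supplies is not known
  beforehand.\<close>

definition disperses ::
  "real \<Rightarrow> real \<Rightarrow> real \<Rightarrow> real \<Rightarrow> real \<Rightarrow> real \<Rightarrow> real \<Rightarrow> real \<Rightarrow> 'a set \<Rightarrow> bool" where
  "disperses \<epsilon> \<delta> \<kappa> M \<rho> \<beta> c \<eta> S \<longleftrightarrow> (\<forall>B e \<mu>. finite S \<longrightarrow> symmetric_on S B \<longrightarrow>
     (\<forall>v\<in>S. (\<Sum>u\<in>S. \<bar>B v u\<bar>) + \<beta> \<le> M) \<longrightarrow> eigenbasis S B e \<mu> \<longrightarrow>
     \<delta> * card S \<le> card (atom_vertices \<epsilon> S e \<mu>) \<longrightarrow>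
     (\<forall>X. (\<forall>v. \<bar>X v\<bar> \<le> \<beta>) \<longrightarrow> sparse_spectrum S (add_potential B X) \<eta> c) \<longrightarrow>
     (\<exists>X. (\<forall>v. \<bar>X v\<bar> \<le> \<beta>) \<and> (\<forall>e' \<mu>'. eigenbasis S (add_potential B X) e' \<mu>' \<longrightarrow>
        localization S e' \<mu>' \<eta> \<le> localization S e \<mu> \<rho> - \<kappa> * card S)))"

text \<open>The order of the quantifiers is the point. \<open>\<kappa>\<close> comes before
  \<open>M\<close>, \<open>\<rho>\<close> and \<open>\<beta>\<close>, so the same drop is available
  at ever smaller scales; \<open>c\<close> comes before \<open>\<eta>\<close>, so the scale can be
  adapted to the sparsity of the spectrum.\<close>

lemma dispersal_step:
  fixes \<epsilon> \<delta> :: real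
  assumes eps: "0 < \<epsilon>" "\<epsilon> \<le> 1" and del: "0 < \<delta>"
  obtains \<kappa> :: real where "0 < \<kappa>"
    "\<And>M \<rho> \<beta>. 1 \<le> M \<Longrightarrow> 0 < \<rho> \<Longrightarrow> 0 < \<beta> \<Longrightarrow> \<exists>c>0. \<exists>\<eta>0>0. \<forall>\<eta>. 0 < \<eta> \<longrightarrow> \<eta> \<le> \<eta>0 \<longrightarrow>
      (\<forall>S::'a set. disperses \<epsilon> \<delta> \<kappa> M \<rho> \<beta> c \<eta> S)"
proof -
  \<comment> \<open>The largest value that \<open>spectral_cluster\<close> admits.\<close>
  define \<alpha> where "\<alpha> = \<epsilon>\<^sup>2 / 100"
  have a: "0 < \<alpha>" "\<alpha> \<le> 1" using eps power_le_one[of \<epsilon> 2] by (auto simp: \<alpha>_def)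
  \<comment> \<open>Enough annuli and colours to bring the averages \<open>1 / real m\<close> and
    \<open>2 / real k\<close> below \<open>\<alpha>\<^sup>2\<close>.\<close>
  define m where "m = nat \<lceil>1 / \<alpha>\<^sup>2\<rceil>"
  define k where "k = nat \<lceil>2 / \<alpha>\<^sup>2\<rceil>"
  have m_le: "1 / \<alpha>\<^sup>2 \<le> real m" and k_le: "2 / \<alpha>\<^sup>2 \<le> real k"
    unfolding m_def k_def by (rule real_nat_ceiling_ge)+
  have pos: "0 < 1 / \<alpha>\<^sup>2" "0 < 2 / \<alpha>\<^sup>2" using a by auto
  have mk: "0 < m" "0 < k" using m_le k_le pos by (auto intro: Nat.gr0I)
  have m: "1 / real m \<le> \<alpha>\<^sup>2" using m_le a mk by (simp add: field_simps)
  have k: "2 / real k \<le> \<alpha>\<^sup>2" using k_le a mk by (simp add: field_simps)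
  \<comment> \<open>\<open>J\<close> will have at least \<open>2 * c0 * card S\<close> points, half
    of which may be lost for want of a clean gap.\<close>
  define c0 where "c0 = \<delta> / (4 * real k * real m)"
  have c0: "0 < c0" using del mk by (simp add: c0_def)
  \<comment> \<open>A clean split lowers the pair form at its vertex by
    \<open>(\<epsilon>\<^sup>2 / 64)\<^sup>2\<close>, which amounts to \<open>2 * \<kappa>\<close>
    per point of \<open>S\<close>; half of this pays for the stability error.\<close>
  define \<kappa> where "\<kappa> = c0 * (\<epsilon>\<^sup>2 / 64)\<^sup>2 / 2"
  have kap: "0 < \<kappa>" using c0 eps by (simp add: \<kappa>_def)
  show ?thesis
  proof (rule that[OF kap])
    fix M \<rho> \<beta> :: real
    assume M: "1 \<le> M" and rho: "0 < \<rho>" and beta: "0 < \<beta>"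
    obtain h0 where h0: "0 < h0"
      "\<And>(S::'a set) B X e \<mu> e' \<mu>' v. \<lbrakk>finite S; symmetric_on S B;
        \<And>v. v \<in> S \<Longrightarrow> (\<Sum>u\<in>S. \<bar>B v u\<bar>) \<le> M;
        \<And>v. v \<in> S \<Longrightarrow> (\<Sum>u\<in>S. \<bar>add_potential B X v u\<bar>) \<le> M;
        \<And>v. v \<in> S \<Longrightarrow> \<bar>X v\<bar> \<le> h0;
        eigenbasis S B e \<mu>; eigenbasis S (add_potential B X) e' \<mu>'; v \<in> S\<rbrakk> \<Longrightarrow>
        pair_form S e' \<mu>' (\<lambda>x. of_bool (\<bar>x\<bar> \<le> \<rho> / 2)) v
          \<le> pair_form S e \<mu> (\<lambda>x. of_bool (\<bar>x\<bar> \<le> \<rho>)) v + \<kappa>"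
      using pair_form_stable[OF M rho kap, where 'a = 'a] by blast
    \<comment> \<open>The three bounds keep the split pairs within distance
      \<open>\<rho> / 2\<close>, the change within \<open>\<beta>\<close>, and the stability
      estimate applicable.\<close>
    define r0 where "r0 = min (\<rho> / 4) (min \<beta> h0)"
    have r0: "0 < r0" "r0 \<le> \<rho> / 4" "r0 \<le> \<beta>" "r0 \<le> h0"
      using rho beta h0(1) by (auto simp: r0_def)
    \<comment> \<open>Half of the tolerance \<open>\<alpha> * r * \<epsilon> / 2\<close> for the
      splitting energy, with \<open>m\<close> in place of the still unknown \<open>j < m\<close> so
      that one net serves all scales. The other half is left to \<open>\<eta>\<close>.\<close>
    define g where "g = \<alpha> * (r0 * \<alpha> ^ (2 * m)) * \<epsilon> / 4"
    have g: "0 < g" using a r0 eps by (simp add: g_def)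
    obtain \<Gamma> :: "real set" where net: "finite \<Gamma>" "\<And>x. \<bar>x\<bar> \<le> M \<Longrightarrow> \<exists>z\<in>\<Gamma>. \<bar>z - x\<bar> \<le> g"
      using finite_net_exists[OF g, of M] by blast
    \<comment> \<open>Chosen so that all net energies together have mass at most
      \<open>c0 * \<alpha>\<^sup>2 * card S\<close> nearby; the summand 1 guards against an empty
      net.\<close>
    define c where "c = c0 * \<alpha>\<^sup>2 / (card \<Gamma> + 1)"
    have c: "0 < c" using c0 a by (simp add: c_def)
    have c_card: "card \<Gamma> * c \<le> c0 * \<alpha>\<^sup>2"
    proof -
      have "card \<Gamma> * c = c0 * \<alpha>\<^sup>2 * (card \<Gamma> / (card \<Gamma> + 1))" by (simp add: c_def)
      also have "\<dots> \<le> c0 * \<alpha>\<^sup>2 * 1" using c0 by (intro mult_left_mono) auto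
      finally show ?thesis by simp
    qed
    have "\<exists>X. (\<forall>v. \<bar>X v\<bar> \<le> \<beta>) \<and> (\<forall>e' \<mu>'. eigenbasis S (add_potential B X) e' \<mu>' \<longrightarrow>
           localization S e' \<mu>' \<eta> \<le> localization S e \<mu> \<rho> - \<kappa> * card S)"
      if eta: "0 < \<eta>" "\<eta> \<le> min g (\<rho> / 2)" and fin: "finite S" and sym: "symmetric_on S B"
        and row: "\<forall>v\<in>S. (\<Sum>u\<in>S. \<bar>B v u\<bar>) + \<beta> \<le> M" and eb: "eigenbasis S B e \<mu>"
        and bad: "\<delta> * card S \<le> card (atom_vertices \<epsilon> S e \<mu>)"
        and sparse: "\<forall>X. (\<forall>v. \<bar>X v\<bar> \<le> \<beta>) \<longrightarrow> sparse_spectrum S (add_potential B X) \<eta> c"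
      for \<eta> and S :: "'a set" and B e \<mu>
    proof -
      obtain j J E where j: "j < m" and J: "J \<subseteq> S" "card (atom_vertices \<epsilon> S e \<mu>) \<le> 2 * k * m * card J"
        and cl: "\<And>v. v \<in> J \<Longrightarrow> spectral_cluster S B e \<mu> v (E v) (r0 * \<alpha> ^ (2 * j)) \<alpha> \<epsilon>"
        and E: "\<And>v. v \<in> J \<Longrightarrow> \<exists>i<card S. E v = \<mu> i"
        and weak: "\<And>v. v \<in> J \<Longrightarrow>
          (\<Sum>u\<in>J - {v}. (spectral_cluster.\<psi> S e \<mu> v (E v) (r0 * \<alpha> ^ (2 * j)) \<alpha> u)\<^sup>2) \<le> \<alpha>\<^sup>2"
        using weakly_interacting_clusters[OF fin sym eb eps \<alpha>_def r0(1) mk(1) m mk(2) k] by blast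
      define r where "r = r0 * \<alpha> ^ (2 * j)"
      have r: "0 < r" using r0 a by (simp add: r_def)
      have "r \<le> r0 * 1"
        unfolding r_def using r0 a power_le_one[of \<alpha> "2 * j"] by (intro mult_left_mono) auto
      then have rr: "4 * r \<le> \<rho>" "r \<le> \<beta>" "r \<le> h0" using r0 by auto
      have "\<alpha> * r \<le> 1 * r" using a r by (intro mult_right_mono) auto
      then have ar: "\<alpha> * r \<le> \<beta>" "\<alpha> * r \<le> h0" using rr by auto
      have "r0 * \<alpha> ^ (2 * m) \<le> r"
        unfolding r_def using j r0 a by (intro mult_left_mono power_decreasing) auto
      then have "\<alpha> * (r0 * \<alpha> ^ (2 * m)) * \<epsilon> \<le> \<alpha> * r * \<epsilon>"
        using a eps by (intro mult_left_mono mult_right_mono) auto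
      then have "g \<le> \<alpha> * r * \<epsilon> / 4" by (simp add: g_def)
      then have g_le: "g + \<eta> \<le> \<alpha> * r * \<epsilon> / 2" using eta by linarith
      have rowB: "(\<Sum>u\<in>S. \<bar>B v u\<bar>) \<le> M" if "v \<in> S" for v
        using row that beta by fastforce
      have rowX: "(\<Sum>u\<in>S. \<bar>add_potential B X v u\<bar>) \<le> M" if "v \<in> S" "\<And>v. \<bar>X v\<bar> \<le> \<beta>" for v X
        using row_add_potential[OF fin that(1), of B X] row that(1) that(2)[of v] by fastforce
      have "\<exists>z\<in>\<Gamma>. \<bar>z - E v\<bar> \<le> g" if v: "v \<in> J" for v
      proof -
        obtain i where "i < card S" "E v = \<mu> i" using E[OF v] by blast
        then show ?thesis using eigenvalue_bound[OF fin eb _ rowB, of i] net(2) by metis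
      qed
      then obtain \<gamma> where \<gamma>: "\<And>v. v \<in> J \<Longrightarrow> \<gamma> v \<in> \<Gamma> \<and> \<bar>\<gamma> v - E v\<bar> \<le> g" by metis
      have gam: "\<bar>\<gamma> v - E v\<bar> + \<eta> \<le> \<alpha> * r * \<epsilon> / 2" if "v \<in> J" for v
        using \<gamma>[OF that] g_le by linarith
      have bound: "\<forall>X e' \<mu>' i. (\<forall>v. \<bar>X v\<bar> \<le> \<alpha> * r) \<longrightarrow> eigenbasis S (add_potential B X) e' \<mu>' \<longrightarrow>
        i < card S \<longrightarrow> \<bar>\<mu>' i\<bar> \<le> M"
      proof (intro allI impI)
        fix X e' \<mu>' i
        assume X: "\<forall>v. \<bar>X v\<bar> \<le> \<alpha> * r" and eb': "eigenbasis S (add_potential B X) e' \<mu>'" and i: "i < card S"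
        have Xb: "\<bar>X v\<bar> \<le> \<beta>" for v using spec[OF X, of v] ar(1) by linarith
        show "\<bar>\<mu>' i\<bar> \<le> M" using fin eb' i rowX[OF _ Xb] by (rule eigenvalue_bound)
      qed
      obtain X where X: "\<And>v. \<bar>X v\<bar> \<le> \<alpha> * r" and
        split: "\<And>e' \<mu>' v. \<lbrakk>eigenbasis S (add_potential B X) e' \<mu>'; v \<in> J;
           (\<Sum>i | i < card S \<and> \<bar>\<mu>' i - \<gamma> v\<bar> < \<eta>. (e' i v)\<^sup>2) \<le> \<alpha>\<^sup>2\<rbrakk> \<Longrightarrow>
           \<epsilon>\<^sup>2 / 64 \<le> (\<Sum>i | i < card S \<and> \<gamma> v + \<eta> \<le> \<mu>' i \<and> \<bar>\<mu>' i - E v\<bar> \<le> r. (e' i v)\<^sup>2) \<and>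
           \<epsilon>\<^sup>2 / 64 \<le> (\<Sum>i | i < card S \<and> \<mu>' i \<le> \<gamma> v - \<eta> \<and> \<bar>\<mu>' i - E v\<bar> \<le> r. (e' i v)\<^sup>2)"
        using simultaneous_splitting[OF fin sym J(1) a cl[folded r_def] weak[folded r_def] eta(1) r gam bound]
        by blast
      have Xb: "\<And>v. \<bar>X v\<bar> \<le> \<beta>" and Xh: "\<And>v. \<bar>X v\<bar> \<le> h0" using X ar order_trans by blast+
      show ?thesis
      proof (intro exI[of _ X] conjI allI impI Xb)
        fix e' \<mu>' assume eb': "eigenbasis S (add_potential B X) e' \<mu>'"
        \<comment> \<open>The points without a clean gap; the choice of \<open>c\<close> keeps them
          to at most half of the guaranteed size of \<open>J\<close>.\<close>
        define K where "K = {v\<in>J. \<alpha>\<^sup>2 < (\<Sum>i | i < card S \<and> \<bar>\<mu>' i - \<gamma> v\<bar> < \<eta>. (e' i v)\<^sup>2)}"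
        have finJ: "finite J" using J(1) fin by (rule finite_subset)
        have "\<alpha>\<^sup>2 * card K \<le> card \<Gamma> * (c * card S)"
          unfolding K_def
        proof (rule few_vertices_near_net[OF fin eb' J(1) net(1)])
          show "real (card {i. i < card S \<and> \<bar>\<mu>' i - z\<bar> < \<eta>}) \<le> c * card S" for z
            using sparse Xb eb' unfolding sparse_spectrum_def by blast
        qed (use \<gamma> in auto)
        also have "\<dots> \<le> c0 * \<alpha>\<^sup>2 * card S"
          using mult_right_mono[OF c_card, of "card S"] by simp
        finally have K: "card K \<le> c0 * card S" using a by (simp add: mult.commute mult.left_commute)
        have "\<delta> * card S \<le> real (2 * k * m * card J)" using bad J(2) by linarith
        then have "2 * (c0 * card S) \<le> card J" using mk by (simp add: c0_def field_simps)
        moreover have "card (J - K) = card J - card K" "card K \<le> card J"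
          using finJ by (auto simp: K_def intro!: card_Diff_subset card_mono)
        ultimately have JK: "c0 * card S \<le> card (J - K)" using K by (simp add: of_nat_diff)
        have "localization S e' \<mu>' \<eta> + (\<epsilon>\<^sup>2 / 64)\<^sup>2 * card (J - K) \<le> localization S e' \<mu>' (\<rho> / 2)"
        proof (rule localization_decreases[OF fin eb' _ eta(1) _ rr(1), where \<gamma> = \<gamma> and E = E])
          fix v assume "v \<in> J - K"
          then have "v \<in> J" "(\<Sum>i | i < card S \<and> \<bar>\<mu>' i - \<gamma> v\<bar> < \<eta>. (e' i v)\<^sup>2) \<le> \<alpha>\<^sup>2"
            by (auto simp: K_def not_less)
          from split[OF eb' this]
          show "\<epsilon>\<^sup>2 / 64 \<le> (\<Sum>i | i < card S \<and> \<gamma> v + \<eta> \<le> \<mu>' i \<and> \<bar>\<mu>' i - E v\<bar> \<le> r. (e' i v)\<^sup>2)"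
            "\<epsilon>\<^sup>2 / 64 \<le> (\<Sum>i | i < card S \<and> \<mu>' i \<le> \<gamma> v - \<eta> \<and> \<bar>\<mu>' i - E v\<bar> \<le> r. (e' i v)\<^sup>2)"
            by auto
        qed (use J(1) eta in auto)
        moreover have "(\<epsilon>\<^sup>2 / 64)\<^sup>2 * (c0 * card S) \<le> (\<epsilon>\<^sup>2 / 64)\<^sup>2 * card (J - K)"
          using JK by (intro mult_left_mono) auto
        moreover have "(\<epsilon>\<^sup>2 / 64)\<^sup>2 * (c0 * card S) = 2 * (\<kappa> * card S)"
          by (simp add: \<kappa>_def)
        \<comment> \<open>Back to the old eigenbasis: stability costs \<open>\<kappa>\<close> per
          point, out of a gain of twice that.\<close>
        moreover have "localization S e' \<mu>' (\<rho> / 2) \<le> (\<Sum>v\<in>S. pair_form S e \<mu> (\<lambda>x. of_bool (\<bar>x\<bar> \<le> \<rho>)) v + \<kappa>)"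
          unfolding localization_def
          by (intro sum_mono h0(2)[OF fin sym rowB rowX[OF _ Xb] Xh eb eb']) auto
        then have "localization S e' \<mu>' (\<rho> / 2) \<le> localization S e \<mu> \<rho> + \<kappa> * card S"
          by (simp add: localization_def sum.distrib mult.commute)
        ultimately show "localization S e' \<mu>' \<eta> \<le> localization S e \<mu> \<rho> - \<kappa> * card S"
          by linarith
      qed
    qed
    then have "disperses \<epsilon> \<delta> \<kappa> M \<rho> \<beta> c \<eta> S" if "0 < \<eta>" "\<eta> \<le> min g (\<rho> / 2)" for \<eta> and S :: "'a set"
      unfolding disperses_def using that by blast
    then show "\<exists>c>0. \<exists>\<eta>0>0. \<forall>\<eta>. 0 < \<eta> \<longrightarrow> \<eta> \<le> \<eta>0 \<longrightarrow>
      (\<forall>S::'a set. disperses \<epsilon> \<delta> \<kappa> M \<rho> \<beta> c \<eta> S)"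
      using c g rho by (intro exI[of _ c] conjI exI[of _ "min g (\<rho> / 2)"] allI impI) auto
  qed
qed

section \<open>Iteration of the dispersal step\<close>

lemma add_potential_add:
  "add_potential (add_potential B W) X = add_potential B (\<lambda>v. W v + X v)"
  by (auto simp: add_potential_def fun_eq_iff distrib_left)

text \<open>The functional starts at or below \<open>card S\<close> and is never negative, so it
  cannot drop by \<open>\<kappa> * card S\<close> more than \<open>1 / \<kappa>\<close> times. The
  margin \<open>\<beta>\<close> keeps all intermediate potentials within \<open>L\<close>, where
  sparsity is available.\<close>

theorem dense_delocalization_of_sparse_spectrum:
  fixes \<S> :: "('a set \<times> ('a \<Rightarrow> 'a \<Rightarrow> real)) set" and \<epsilon> \<delta> \<beta> L D :: real
  assumes eps: "0 < \<epsilon>" "\<epsilon> \<le> 1" and del: "0 < \<delta>" and beta: "0 < \<beta>"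
    and sys: "\<And>S B. (S, B) \<in> \<S> \<Longrightarrow> finite S \<and> symmetric_on S B \<and> (\<forall>v\<in>S. (\<Sum>u\<in>S. \<bar>B v u\<bar>) \<le> D)"
    and sparse: "\<And>c. 0 < c \<Longrightarrow> \<exists>\<eta>>0. \<exists>N. \<forall>S B W. (S, B) \<in> \<S> \<longrightarrow> N \<le> card S \<longrightarrow>
       (\<forall>v\<in>S. \<bar>W v\<bar> \<le> L) \<longrightarrow>
       sparse_spectrum S (add_potential B W) \<eta> c"
  shows "\<exists>N. \<forall>S B V. (S, B) \<in> \<S> \<longrightarrow> N < card S \<longrightarrow> (\<forall>v\<in>S. \<bar>V v\<bar> + \<beta> \<le> L) \<longrightarrow>
    (\<exists>W e \<mu>. (\<forall>v\<in>S. \<bar>V v - W v\<bar> \<le> \<beta>) \<and> eigenbasis S (add_potential B W) e \<mu> \<and>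
      card (atom_vertices \<epsilon> S e \<mu>) < \<delta> * card S)"
proof -
  obtain \<kappa> :: real where kap: "0 < \<kappa>" and step:
    "\<And>M \<rho> \<beta>. 1 \<le> M \<Longrightarrow> 0 < \<rho> \<Longrightarrow> 0 < \<beta> \<Longrightarrow> \<exists>c>0. \<exists>\<eta>0>0. \<forall>\<eta>. 0 < \<eta> \<longrightarrow> \<eta> \<le> \<eta>0 \<longrightarrow>
      (\<forall>S::'a set. disperses \<epsilon> \<delta> \<kappa> M \<rho> \<beta> c \<eta> S)"
    using dispersal_step[OF eps del, where 'a = 'a] by blast
  define M where "M = max 1 (D + L)"
  \<comment> \<open>Either the atoms are already few, and the potential is left alone from then on,
    or \<open>j\<close> drops have been achieved.\<close>
  define Q where "Q = (\<lambda>j \<beta> \<rho> (S::'a set) B V.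
    \<exists>W e \<mu>. (\<forall>v\<in>S. \<bar>V v - W v\<bar> \<le> \<beta>) \<and> eigenbasis S (add_potential B W) e \<mu> \<and>
      (card (atom_vertices \<epsilon> S e \<mu>) < \<delta> * card S \<or> localization S e \<mu> \<rho> \<le> (1 - real j * \<kappa>) * card S))"
  have "\<forall>\<beta>>0. \<exists>\<rho>>0. \<exists>N. \<forall>S B V. (S, B) \<in> \<S> \<longrightarrow> N \<le> card S \<longrightarrow>
    (\<forall>v\<in>S. \<bar>V v\<bar> + \<beta> \<le> L) \<longrightarrow> Q j \<beta> \<rho> S B V" for j
  proof (induction j)
    case 0
    show ?case
    proof (intro allI impI exI[of _ "1::real"] exI[of _ "0::nat"] conjI)
      fix \<beta> :: real and S B V
      assume "0 < \<beta>" and SB: "(S, B) \<in> \<S>"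
      obtain e \<mu> where eb: "eigenbasis S (add_potential B V) e \<mu>"
        using eigenbasis_exists[of S "add_potential B V"] symmetric_add_potential sys[OF SB] by metis
      then show "Q 0 \<beta> 1 S B V"
        using localization_bounds(2)[OF eb] \<open>0 < \<beta>\<close> unfolding Q_def
        by (intro exI[of _ V] exI[of _ e] exI[of _ \<mu>]) auto
    qed simp
  next
    case (Suc j)
    show ?case
    proof (intro allI impI)
      fix \<beta> :: real assume beta: "0 < \<beta>"
      \<comment> \<open>Half of the budget goes to the first \<open>j\<close> changes and half to
        the new one; this is why the induction ranges over all \<open>\<beta>\<close>.\<close>
      then have "0 < \<beta> / 2" by simp
      from Suc.IH[rule_format, OF this] obtain \<rho> N1 where rho: "0 < \<rho>" and
        IH: "\<And>S B V. (S, B) \<in> \<S> \<Longrightarrow> N1 \<le> card S \<Longrightarrow> (\<forall>v\<in>S. \<bar>V v\<bar> + \<beta> / 2 \<le> L) \<Longrightarrow> Q j (\<beta> / 2) \<rho> S B V"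
        by blast
      have "1 \<le> M" "0 < \<beta> / 2" using beta by (auto simp: M_def)
      from step[OF this(1) rho this(2)] obtain c \<eta>0 where c: "0 < c" and eta0: "0 < \<eta>0" and st:
        "\<forall>\<eta>. 0 < \<eta> \<longrightarrow> \<eta> \<le> \<eta>0 \<longrightarrow>
      (\<forall>S::'a set. disperses \<epsilon> \<delta> \<kappa> M \<rho> (\<beta> / 2) c \<eta> S)"
        by (elim exE conjE)
      obtain \<eta>1 N2 where eta1: "0 < \<eta>1" and sp: "\<And>S B W. (S, B) \<in> \<S> \<Longrightarrow> N2 \<le> card S \<Longrightarrow>
          (\<forall>v\<in>S. \<bar>W v\<bar> \<le> L) \<Longrightarrow> sparse_spectrum S (add_potential B W) \<eta>1 c"
        using sparse[OF c] by blast
      \<comment> \<open>Small enough for the dispersal and for sparsity at once; sparsity passes to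
        smaller scales.\<close>
      define \<eta> where "\<eta> = min \<eta>0 \<eta>1"
      have eta: "0 < \<eta>" "\<eta> \<le> \<eta>0" "\<eta> \<le> \<eta>1" using eta0 eta1 by (auto simp: \<eta>_def)
      have mono: "sparse_spectrum S B \<eta> c" if "sparse_spectrum S B \<eta>1 c" for S :: "'a set" and B
        unfolding sparse_spectrum_def
      proof (intro allI impI)
        fix e \<mu> z assume "eigenbasis S B e \<mu>"
        then have "real (card {i. i < card S \<and> \<bar>\<mu> i - z\<bar> < \<eta>1}) \<le> c * card S"
          using that unfolding sparse_spectrum_def by blast
        moreover have "card {i. i < card S \<and> \<bar>\<mu> i - z\<bar> < \<eta>} \<le> card {i. i < card S \<and> \<bar>\<mu> i - z\<bar> < \<eta>1}"
          using eta by (intro card_mono) auto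
        ultimately show "real (card {i. i < card S \<and> \<bar>\<mu> i - z\<bar> < \<eta>}) \<le> c * card S" by linarith
      qed
      have "Q (Suc j) \<beta> \<eta> S B V"
        if SB: "(S, B) \<in> \<S>" and n: "max N1 N2 \<le> card S" and V: "\<forall>v\<in>S. \<bar>V v\<bar> + \<beta> \<le> L" for S B V
      proof -
        have V2: "\<forall>v\<in>S. \<bar>V v\<bar> + \<beta> / 2 \<le> L" using V beta by fastforce
        obtain W e \<mu> where W: "\<forall>v\<in>S. \<bar>V v - W v\<bar> \<le> \<beta> / 2" and eb: "eigenbasis S (add_potential B W) e \<mu>"
          and alt: "card (atom_vertices \<epsilon> S e \<mu>) < \<delta> * card S \<or> localization S e \<mu> \<rho> \<le> (1 - real j * \<kappa>) * card S"
          using IH[OF SB _ V2] n unfolding Q_def by auto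
        show ?thesis
        proof (cases "card (atom_vertices \<epsilon> S e \<mu>) < \<delta> * card S")
          case True
          moreover have "\<forall>v\<in>S. \<bar>V v - W v\<bar> \<le> \<beta>" using W beta by fastforce
          ultimately show ?thesis using eb True unfolding Q_def by blast
        next
          case False
          have Wb: "\<bar>W v\<bar> + \<beta> / 2 \<le> L" if "v \<in> S" for v
            using bspec[OF V that] bspec[OF W that] by linarith
          have fin: "finite S" and sym: "symmetric_on S (add_potential B W)"
            using sys[OF SB] symmetric_add_potential by auto
          have row: "\<forall>v\<in>S. (\<Sum>u\<in>S. \<bar>add_potential B W v u\<bar>) + \<beta> / 2 \<le> M"
          proof
            fix v assume v: "v \<in> S"
            have "(\<Sum>u\<in>S. \<bar>B v u\<bar>) \<le> D" using sys[OF SB] v by blast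
            then show "(\<Sum>u\<in>S. \<bar>add_potential B W v u\<bar>) + \<beta> / 2 \<le> M"
              using row_add_potential[OF fin v, of B W] Wb[OF v] unfolding M_def by linarith
          qed
          have sparse_X: "\<forall>X. (\<forall>v. \<bar>X v\<bar> \<le> \<beta> / 2) \<longrightarrow> sparse_spectrum S (add_potential (add_potential B W) X) \<eta> c"
            unfolding add_potential_add
          proof (intro allI impI mono sp[OF SB] ballI)
            fix X :: "'a \<Rightarrow> real" and v assume X: "\<forall>v. \<bar>X v\<bar> \<le> \<beta> / 2" and "v \<in> S"
            then show "\<bar>W v + X v\<bar> \<le> L" using Wb[of v] spec[OF X, of v] by linarith
          qed (use n in auto)
          note st_eta = mp[OF mp[OF spec[OF st, of \<eta>] eta(1)] eta(2)]
          note st_S = spec[OF spec[OF spec[OF spec[OF st_eta, of S, unfolded disperses_def],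
                of "add_potential B W"], of e], of \<mu>]
          obtain X where X: "\<forall>v. \<bar>X v\<bar> \<le> \<beta> / 2" and
            dec: "\<And>e' \<mu>'. eigenbasis S (add_potential (add_potential B W) X) e' \<mu>' \<Longrightarrow>
              localization S e' \<mu>' \<eta> \<le> localization S e \<mu> \<rho> - \<kappa> * card S"
            using mp[OF mp[OF mp[OF mp[OF mp[OF mp[OF st_S fin] sym] row] eb] False[unfolded not_less]] sparse_X]
            by blast
          obtain e' \<mu>' where eb': "eigenbasis S (add_potential (add_potential B W) X) e' \<mu>'"
            using eigenbasis_exists[OF fin symmetric_add_potential[OF sym]] by blast
          have "localization S e' \<mu>' \<eta> \<le> (1 - real (Suc j) * \<kappa>) * card S"
            using dec[OF eb'] alt False by (simp add: algebra_simps)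
          moreover have "\<bar>V v - (W v + X v)\<bar> \<le> \<beta>" if "v \<in> S" for v
            using bspec[OF W that] spec[OF X, of v] by linarith
          ultimately show ?thesis
            using eb' unfolding add_potential_add Q_def
            by (intro exI[of _ "\<lambda>v. W v + X v"] exI[of _ e'] exI[of _ \<mu>']) auto
        qed
      qed
      then show "\<exists>\<rho>>0. \<exists>N. \<forall>S B V. (S, B) \<in> \<S> \<longrightarrow> N \<le> card S \<longrightarrow>
        (\<forall>v\<in>S. \<bar>V v\<bar> + \<beta> \<le> L) \<longrightarrow> Q (Suc j) \<beta> \<rho> S B V"
        using eta(1) by blast
    qed
  qed
  note main = this
  \<comment> \<open>With more drops than the functional can sustain, the second alternative would
    make it negative.\<close>
  obtain j :: nat where "1 / \<kappa> < real j" using reals_Archimedean2 by blast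
  then have jk: "1 < real j * \<kappa>" using kap by (simp add: field_simps)
  obtain \<rho> N where N: "\<And>S B V. (S, B) \<in> \<S> \<Longrightarrow> N \<le> card S \<Longrightarrow> (\<forall>v\<in>S. \<bar>V v\<bar> + \<beta> \<le> L) \<Longrightarrow> Q j \<beta> \<rho> S B V"
    using main[of j, rule_format, OF beta] by blast
  have "\<exists>W e \<mu>. (\<forall>v\<in>S. \<bar>V v - W v\<bar> \<le> \<beta>) \<and> eigenbasis S (add_potential B W) e \<mu> \<and>
      card (atom_vertices \<epsilon> S e \<mu>) < \<delta> * card S"
    if prems: "(S, B) \<in> \<S>" "N < card S" "\<forall>v\<in>S. \<bar>V v\<bar> + \<beta> \<le> L" for S B V
  proof -
    obtain W e \<mu> where W: "\<forall>v\<in>S. \<bar>V v - W v\<bar> \<le> \<beta>" and eb: "eigenbasis S (add_potential B W) e \<mu>"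
      and alt: "card (atom_vertices \<epsilon> S e \<mu>) < \<delta> * card S \<or> localization S e \<mu> \<rho> \<le> (1 - real j * \<kappa>) * card S"
      using N[OF prems(1) _ prems(3)] prems(2) unfolding Q_def by auto
    have "(1 - real j * \<kappa>) * card S < 0" using jk prems by (intro mult_neg_pos) auto
    then have "card (atom_vertices \<epsilon> S e \<mu>) < \<delta> * card S"
      using alt localization_bounds(1)[OF eb, of \<rho>] by linarith
    then show ?thesis using W eb by blast
  qed
  then show ?thesis by blast
qed

section \<open>Schroedinger operators on graphs\<close>

definition kinetic :: "('a, 'b) pre_digraph \<Rightarrow> 'a \<Rightarrow> 'a \<Rightarrow> real" where
  "kinetic G v u = of_bool (v \<rightarrow>\<^bsub>G\<^esub> u) - of_bool (u = v) * real (card {v' \<in> verts G. v \<rightarrow>\<^bsub>G\<^esub> v'})"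

lemma sum_fun_apply: "(\<Sum>i\<in>A. f i) x = (\<Sum>i\<in>A. f i x :: complex)"
  by (induction A rule: infinite_finite_induct) auto

lemma (in graph) symmetric_kinetic: "symmetric_on (verts G) (kinetic G)"
  unfolding symmetric_on_def kinetic_def using sym_arcs
  by (auto simp: of_bool_def dest: arcs_ends_symmetric)

lemma (in graph) card_neighbours_le: "card {u \<in> verts G. v \<rightarrow> u} \<le> out_degree G v"
proof -
  have "{u \<in> verts G. v \<rightarrow> u} \<subseteq> head G ` out_arcs G v"
    by (auto simp: arcs_ends_conv out_arcs_def)
  then have "card {u \<in> verts G. v \<rightarrow> u} \<le> card (head G ` out_arcs G v)"
    by (intro card_mono) auto
  also have "\<dots> \<le> out_degree G v"
    unfolding out_degree_def by (intro card_image_le) auto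
  finally show ?thesis .
qed

text \<open>The neighbours and the diagonal entry contribute at most the degree each; this turns a
  degree bound into a bound on row sums.\<close>

lemma (in graph) kinetic_row:
  assumes "v \<in> verts G"
  shows "(\<Sum>u\<in>verts G. \<bar>kinetic G v u\<bar>) \<le> 2 * out_degree G v"
proof -
  define d where "d = real (card {u \<in> verts G. v \<rightarrow> u})"
  have "(\<Sum>u\<in>verts G. \<bar>kinetic G v u\<bar>) \<le> (\<Sum>u\<in>verts G. of_bool (v \<rightarrow> u) + d * of_bool (u = v))"
    unfolding kinetic_def d_def by (intro sum_mono) (auto simp: of_bool_def)
  also have "\<dots> = 2 * d"
    using assms by (simp add: sum.distrib sum_delta_vec) (simp add: d_def Int_def)
  finally show ?thesis using card_neighbours_le[of v] by (simp add: d_def)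
qed

text \<open>Carries a real eigenbasis of the matrix over to the complex operator. The vectors being
  real, the coefficients \<open>co\<close> need no conjugation; \<open>ev\<close> is zero off the
  vertices, as membership in \<open>ell2 G\<close> requires.\<close>

locale graph_eigenbasis = graph G for G :: "('a, 'b) pre_digraph" +
  fixes V :: "'a \<Rightarrow> real" and e \<mu>
  assumes eb: "eigenbasis (verts G) (add_potential (kinetic G) V) e \<mu>"
begin

definition ev :: "nat \<Rightarrow> 'a \<Rightarrow> complex" where
  "ev i v = (if v \<in> verts G then of_real (e i v) else 0)"

definition co :: "nat \<Rightarrow> ('a \<Rightarrow> complex) \<Rightarrow> complex" where
  "co i \<phi> = (\<Sum>v\<in>verts G. of_real (e i v) * \<phi> v)"

lemma symmetric_hamiltonian: "symmetric_on (verts G) (add_potential (kinetic G) V)"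
  by (rule symmetric_add_potential[OF symmetric_kinetic])

lemma schroedinger_eq:
  assumes v: "v \<in> verts G"
  shows "schroedinger G V \<phi> v = (\<Sum>u\<in>verts G. of_real (add_potential (kinetic G) V v u) * \<phi> u)"
proof -
  have pick: "(\<Sum>u\<in>verts G. c * of_bool (u = v) * \<phi> u) = c * \<phi> v" for c :: complex
  proof -
    have "(\<Sum>u\<in>verts G. c * of_bool (u = v) * \<phi> u) = (\<Sum>u\<in>verts G. if u = v then c * \<phi> u else 0)"
      by (intro sum.cong) auto
    then show ?thesis using v by simp
  qed
  have nb: "(\<Sum>u\<in>verts G. of_bool (v \<rightarrow>\<^bsub>G\<^esub> u) * \<phi> u) = (\<Sum>u | u \<in> verts G \<and> v \<rightarrow>\<^bsub>G\<^esub> u. \<phi> u)"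
  proof -
    have "(\<Sum>u\<in>verts G. of_bool (v \<rightarrow>\<^bsub>G\<^esub> u) * \<phi> u) = (\<Sum>u\<in>verts G. if v \<rightarrow>\<^bsub>G\<^esub> u then \<phi> u else 0)"
      by (intro sum.cong) auto
    then show ?thesis by (simp add: sum.If_cases Int_def)
  qed
  have "(\<Sum>u\<in>verts G. of_real (add_potential (kinetic G) V v u) * \<phi> u) =
      (\<Sum>u\<in>verts G. of_bool (v \<rightarrow>\<^bsub>G\<^esub> u) * \<phi> u) +
      (\<Sum>u\<in>verts G. (of_real (V v) - of_nat (card {v' \<in> verts G. v \<rightarrow>\<^bsub>G\<^esub> v'})) * of_bool (u = v) * \<phi> u)"
    unfolding sum.distrib[symmetric]
    by (intro sum.cong refl) (auto simp: add_potential_def kinetic_def of_bool_def algebra_simps)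
  also have "\<dots> = schroedinger G V \<phi> v"
    unfolding pick nb using v by (simp add: schroedinger_def sum_subtractf algebra_simps)
  finally show ?thesis ..
qed

lemma co_schroedinger:
  assumes "i < card (verts G)"
  shows "co i (schroedinger G V \<phi>) = of_real (\<mu> i) * co i \<phi>"
proof -
  let ?H = "add_potential (kinetic G) V"
  have "co i (schroedinger G V \<phi>) =
      (\<Sum>v\<in>verts G. \<Sum>u\<in>verts G. of_real (e i v) * (of_real (?H v u) * \<phi> u))"
    by (simp add: co_def schroedinger_eq sum_distrib_left)
  also have "\<dots> = (\<Sum>u\<in>verts G. \<Sum>v\<in>verts G. of_real (e i v) * (of_real (?H v u) * \<phi> u))"
    by (rule sum.swap)
  also have "\<dots> = (\<Sum>u\<in>verts G. of_real (mat_app (verts G) ?H (e i) u) * \<phi> u)"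
  proof (rule sum.cong[OF refl])
    fix u assume u: "u \<in> verts G"
    have "(\<Sum>v\<in>verts G. of_real (e i v) * (of_real (?H v u) * \<phi> u)) =
        (\<Sum>v\<in>verts G. of_real (?H u v * e i v) * \<phi> u)"
    proof (rule sum.cong[OF refl])
      fix v assume "v \<in> verts G"
      then have "?H v u = ?H u v" using symmetric_hamiltonian u by (simp add: symmetric_on_def)
      then show "of_real (e i v) * (of_real (?H v u) * \<phi> u) = of_real (?H u v * e i v) * \<phi> u"
        by simp
    qed
    then show "(\<Sum>v\<in>verts G. of_real (e i v) * (of_real (?H v u) * \<phi> u)) =
        of_real (mat_app (verts G) ?H (e i) u) * \<phi> u"
      by (simp add: mat_app_def sum_distrib_right)
  qed
  also have "\<dots> = (\<Sum>u\<in>verts G. of_real (\<mu> i) * (of_real (e i u) * \<phi> u))"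
    using eigenbasis_eigen[OF eb assms] by (intro sum.cong) (auto simp: mult.assoc)
  finally show ?thesis by (simp add: co_def sum_distrib_left)
qed

lemma expand:
  assumes "\<phi> \<in> ell2 G"
  shows "\<phi> = (\<Sum>i<card (verts G). fscale (co i \<phi>) (ev i))"
proof
  fix v
  show "\<phi> v = (\<Sum>i<card (verts G). fscale (co i \<phi>) (ev i)) v"
  proof (cases "v \<in> verts G")
    case True
    have "(\<Sum>i<card (verts G). fscale (co i \<phi>) (ev i)) v =
        (\<Sum>i<card (verts G). \<Sum>u\<in>verts G. \<phi> u * of_real (e i u * e i v))"
      using True by (simp add: sum_fun_apply fscale_def ev_def co_def sum_distrib_left sum_distrib_right mult_ac)
    also have "\<dots> = (\<Sum>u\<in>verts G. \<phi> u * of_real (\<Sum>i<card (verts G). e i u * e i v))"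
      by (subst sum.swap) (simp add: sum_distrib_left)
    also have "\<dots> = (\<Sum>u\<in>verts G. if u = v then \<phi> u else 0)"
      using eigenbasis_complete[OF eb _ True] by (intro sum.cong) auto
    finally show ?thesis using True by simp
  next
    case False
    then show ?thesis using assms by (simp add: sum_fun_apply fscale_def ev_def ell2_def)
  qed
qed

lemma co_ev:
  assumes "i < card (verts G)" "j < card (verts G)"
  shows "co i (ev j) = of_bool (i = j)"
proof -
  have "co i (ev j) = of_real (ip (verts G) (e i) (e j))"
    by (simp add: co_def ev_def ip_def)
  then show ?thesis by (simp add: eigenbasis_orthonormal[OF eb assms])
qed

lemma co_add: "co i (\<phi> + \<psi>) = co i \<phi> + co i \<psi>"
  by (simp add: co_def distrib_left sum.distrib)

lemma co_diff: "co i (\<phi> - \<psi>) = co i \<phi> - co i \<psi>"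
  by (simp add: co_def right_diff_distrib sum_subtractf)

lemma co_fscale: "co i (fscale c \<phi>) = c * co i \<phi>"
  by (simp add: co_def fscale_def sum_distrib_left mult.left_commute)

lemma co_sum: "co i (\<Sum>j\<in>A. f j) = (\<Sum>j\<in>A. co i (f j))"
proof (induction A rule: infinite_finite_induct)
  case (insert x F)
  show ?case unfolding sum.insert[OF insert.hyps] co_add insert.IH ..
qed (auto simp: co_def)

lemma co_combination:
  assumes "i < card (verts G)" "A \<subseteq> {..<card (verts G)}"
  shows "co i (\<Sum>j\<in>A. fscale (c j) (ev j)) = (if i \<in> A then c i else 0)"
proof -
  have "finite A" using assms(2) by (rule finite_subset) auto
  have "co i (\<Sum>j\<in>A. fscale (c j) (ev j)) = (\<Sum>j\<in>A. if j = i then c j else 0)"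
    unfolding co_sum co_fscale using assms by (intro sum.cong) (auto simp: co_ev subset_iff)
  then show ?thesis using \<open>finite A\<close> by simp
qed

lemma combination_ell2: "(\<Sum>j\<in>A. fscale (c j) (ev j)) \<in> ell2 G"
  by (simp add: ell2_def sum_fun_apply fscale_def ev_def)

lemma ell2_eqI:
  assumes "\<phi> \<in> ell2 G" "\<psi> \<in> ell2 G" "\<And>i. i < card (verts G) \<Longrightarrow> co i \<phi> = co i \<psi>"
  shows "\<phi> = \<psi>"
  by (subst expand[OF assms(1)], subst expand[OF assms(2)]) (simp add: assms(3))

text \<open>In coordinates the eigenvalue equation reads
  \<open>(\<mu> i - E) * co i \<phi> = 0\<close> for every \<open>i\<close>.\<close>

lemma eigenspace_eq:
  "eigenspace G V E = {\<phi> \<in> ell2 G. \<forall>i<card (verts G). \<mu> i \<noteq> E \<longrightarrow> co i \<phi> = 0}"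
proof (intro set_eqI iffI)
  fix \<phi> assume "\<phi> \<in> eigenspace G V E"
  then have \<phi>: "\<phi> \<in> ell2 G" "schroedinger G V \<phi> = fscale (of_real E) \<phi>"
    by (auto simp: eigenspace_def)
  have "co i \<phi> = 0" if "i < card (verts G)" "\<mu> i \<noteq> E" for i
  proof -
    have "of_real (\<mu> i) * co i \<phi> = of_real E * co i \<phi>"
      using co_schroedinger[OF that(1), of \<phi>] unfolding \<phi>(2) co_fscale by (rule sym)
    then show ?thesis using that(2) by (metis mult_cancel_right of_real_eq_iff)
  qed
  then show "\<phi> \<in> {\<phi> \<in> ell2 G. \<forall>i<card (verts G). \<mu> i \<noteq> E \<longrightarrow> co i \<phi> = 0}" using \<phi> by simp
next
  fix \<phi> assume \<phi>: "\<phi> \<in> {\<phi> \<in> ell2 G. \<forall>i<card (verts G). \<mu> i \<noteq> E \<longrightarrow> co i \<phi> = 0}"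
  have "schroedinger G V \<phi> = fscale (of_real E) \<phi>"
  proof (rule ell2_eqI)
    show "schroedinger G V \<phi> \<in> ell2 G" by (simp add: ell2_def schroedinger_def)
    show "fscale (of_real E) \<phi> \<in> ell2 G" using \<phi> by (simp add: ell2_def fscale_def)
    fix i assume i: "i < card (verts G)"
    then show "co i (schroedinger G V \<phi>) = co i (fscale (of_real E) \<phi>)"
      using \<phi> by (cases "\<mu> i = E") (auto simp: co_schroedinger co_fscale)
  qed
  then show "\<phi> \<in> eigenspace G V E" using \<phi> by (simp add: eigenspace_def)
qed

section \<open>Multiplicities, spectral projections and the functional calculus\<close>

definition level :: "real \<Rightarrow> nat set" where
  "level E = {i. i < card (verts G) \<and> \<mu> i = E}"

lemma level_subset: "level E \<subseteq> {..<card (verts G)}" "finite (level E)"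
  by (auto simp: level_def)

lemma combination_eigenspace:
  "(\<Sum>j\<in>level E. fscale (c j) (ev j)) \<in> eigenspace G V E"
  unfolding eigenspace_eq using co_combination[OF _ level_subset(1)]
  by (auto simp: combination_ell2 level_def)

lemma eigenspace_expand:
  assumes "\<phi> \<in> eigenspace G V E"
  shows "\<phi> = (\<Sum>j\<in>level E. fscale (co j \<phi>) (ev j))"
proof (rule ell2_eqI)
  show "\<phi> \<in> ell2 G" using assms by (simp add: eigenspace_def)
  fix i assume "i < card (verts G)"
  then show "co i \<phi> = co i (\<Sum>j\<in>level E. fscale (co j \<phi>) (ev j))"
    using assms co_combination[OF _ level_subset(1)[of E], where i = i and c = "\<lambda>j. co j \<phi>"]
    unfolding eigenspace_eq by (auto simp: level_def)
qed (rule combination_ell2)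

lemma ev_inj: "inj_on ev {..<card (verts G)}"
proof (rule inj_onI)
  fix i j assume "i \<in> {..<card (verts G)}" "j \<in> {..<card (verts G)}" "ev i = ev j"
  then show "i = j" using co_ev[of i i] co_ev[of i j] by auto
qed

lemma ev_eigenspace: "i \<in> level E \<Longrightarrow> ev i \<in> eigenspace G V E"
  unfolding eigenspace_eq by (auto simp: level_def co_ev ell2_def ev_def)

lemma dim_eigenspace: "cfun.dim (eigenspace G V E) = card (level E)"
proof (rule cfun.dim_unique[of "ev ` level E"])
  have inj: "inj_on ev (level E)" using ev_inj level_subset(1) by (rule inj_on_subset)
  show "ev ` level E \<subseteq> eigenspace G V E" using ev_eigenspace by auto
  show "card (ev ` level E) = card (level E)" by (rule card_image[OF inj])
  show "eigenspace G V E \<subseteq> cfun.span (ev ` level E)"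
  proof
    fix \<phi> assume "\<phi> \<in> eigenspace G V E"
    then have "\<phi> = (\<Sum>j\<in>level E. fscale (co j \<phi>) (ev j))" by (rule eigenspace_expand)
    also have "\<dots> \<in> cfun.span (ev ` level E)"
      by (intro cfun.span_sum cfun.span_scale cfun.span_base) auto
    finally show "\<phi> \<in> cfun.span (ev ` level E)" .
  qed
  show "\<not> cfun.dependent (ev ` level E)"
  proof (rule cfun.independent_if_scalars_zero)
    show "finite (ev ` level E)" using level_subset(2) by simp
    fix f x assume 0: "(\<Sum>x\<in>ev ` level E. fscale (f x) x) = 0" and "x \<in> ev ` level E"
    then obtain i where i: "i \<in> level E" "x = ev i" by auto
    have "co i (\<Sum>j\<in>level E. fscale (f (ev j)) (ev j)) = co i 0"
      using 0 by (simp add: sum.reindex[OF inj] o_def)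
    then show "f x = 0"
      using co_combination[OF _ level_subset(1)[of E], where i = i and c = "\<lambda>j. f (ev j)"] i level_subset(1)
      by (auto simp: co_def)
  qed
qed

lemma eigenvalues_eq: "eigenvalues G V = \<mu> ` {..<card (verts G)}"
proof (intro set_eqI iffI)
  fix E assume "E \<in> eigenvalues G V"
  then obtain \<phi> where "\<phi> \<in> eigenspace G V E" "\<phi> \<noteq> 0" by (auto simp: eigenvalues_def)
  then have "level E \<noteq> {}" using eigenspace_expand[of \<phi> E] by auto
  then show "E \<in> \<mu> ` {..<card (verts G)}" by (auto simp: level_def)
next
  fix E assume "E \<in> \<mu> ` {..<card (verts G)}"
  then obtain i where i: "i < card (verts G)" "i \<in> level E" by (auto simp: level_def)
  have "ev i \<noteq> 0" using co_ev[OF i(1) i(1)] by (auto simp: co_def)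
  then show "E \<in> eigenvalues G V" using ev_eigenspace[OF i(2)] by (auto simp: eigenvalues_def)
qed

lemma eigenvalue_mset_eq: "eigenvalue_mset G V = image_mset \<mu> (mset_set {..<card (verts G)})"
proof (rule multiset_eqI)
  fix E
  have "count (eigenvalue_mset G V) E =
      (\<Sum>E'\<in>eigenvalues G V. if E' = E then card (level E') else 0)"
    unfolding eigenvalue_mset_def count_sum dim_eigenspace by (intro sum.cong) auto
  also have "\<dots> = card (level E)"
    unfolding eigenvalues_eq by (auto simp: level_def)
  also have "\<dots> = count (image_mset \<mu> (mset_set {..<card (verts G)})) E"
    by (auto simp: count_image_mset' level_def intro!: arg_cong[where f = card])
  finally show "count (eigenvalue_mset G V) E = count (image_mset \<mu> (mset_set {..<card (verts G)})) E" .
qed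

lemma IDS_eq: "IDS V G E = card {i. i < card (verts G) \<and> \<mu> i \<le> E} / card (verts G)"
proof -
  have "size {# x \<in># eigenvalue_mset G V. x \<le> E #} = card {i \<in> {..<card (verts G)}. \<mu> i \<le> E}"
    unfolding eigenvalue_mset_eq by (simp add: filter_mset_image_mset filter_mset_mset_set)
  then show ?thesis by (simp add: IDS_def lessThan_def)
qed

text \<open>Testing against the basis vectors of the eigenspace fixes all coefficients, so the
  definite description has exactly one solution.\<close>

lemma eigenproj_eq:
  assumes "\<phi> \<in> ell2 G"
  shows "eigenproj G V E \<phi> = (\<Sum>j\<in>level E. fscale (co j \<phi>) (ev j))"
  unfolding eigenproj_def
proof (rule the_equality)
  let ?\<psi> = "\<Sum>j\<in>level E. fscale (co j \<phi>) (ev j)"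
  have inner: "ell2_inner G (ev i) \<xi> = co i \<xi>" for i \<xi>
    by (simp add: ell2_inner_def co_def ev_def)
  have inner_sum: "ell2_inner G (\<Sum>j\<in>A. fscale (c j) (ev j)) \<xi> = (\<Sum>j\<in>A. cnj (c j) * co j \<xi>)" for A c \<xi>
    unfolding ell2_inner_def sum_fun_apply co_def
    by (simp add: fscale_def ev_def sum_distrib_left sum_distrib_right mult_ac, subst sum.swap) simp
  show "?\<psi> \<in> eigenspace G V E \<and> (\<forall>\<eta>\<in>eigenspace G V E. ell2_inner G \<eta> (\<phi> - ?\<psi>) = 0)"
  proof (intro conjI ballI combination_eigenspace)
    fix \<eta> assume "\<eta> \<in> eigenspace G V E"
    then have "ell2_inner G \<eta> (\<phi> - ?\<psi>) =
        ell2_inner G (\<Sum>j\<in>level E. fscale (co j \<eta>) (ev j)) (\<phi> - ?\<psi>)"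
      by (simp flip: eigenspace_expand)
    also have "\<dots> = 0"
      unfolding inner_sum co_diff
    proof (intro sum.neutral ballI)
      fix j assume "j \<in> level E"
      then show "cnj (co j \<eta>) * (co j \<phi> - co j ?\<psi>) = 0"
        using co_combination[OF _ level_subset(1)[of E], where i = j and c = "\<lambda>j. co j \<phi>"]
          level_subset(1)[of E] by auto
    qed
    finally show "ell2_inner G \<eta> (\<phi> - ?\<psi>) = 0" .
  qed
  fix \<psi> assume \<psi>: "\<psi> \<in> eigenspace G V E \<and> (\<forall>\<eta>\<in>eigenspace G V E. ell2_inner G \<eta> (\<phi> - \<psi>) = 0)"
  have "co i \<psi> = co i \<phi>" if "i \<in> level E" for i
  proof -
    have "co i (\<phi> - \<psi>) = 0" using \<psi> ev_eigenspace[OF that] inner by metis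
    then show ?thesis by (simp add: co_diff)
  qed
  then show "\<psi> = ?\<psi>" using \<psi> eigenspace_expand[of \<psi> E] by simp
qed

text \<open>The sum over distinct eigenvalues is regrouped over indices: the spectral measure at
  \<open>v\<close> has to be the sum of point masses \<open>(e i v)\<^sup>2\<close> at
  \<open>\<mu> i\<close>.\<close>

lemma fun_calc_delta:
  assumes v: "v \<in> verts G"
  shows "ell2_inner G (delta v) (fun_calc g G V (delta v)) = (\<Sum>i<card (verts G). g (\<mu> i) * of_real ((e i v)\<^sup>2))"
proof -
  have dl: "delta v \<in> ell2 G" using v by (auto simp: delta_def ell2_def)
  have codl: "co i (delta v) = of_real (e i v)" for i
    using v by (simp add: co_def delta_def if_distrib cong: if_cong)
  have "ell2_inner G (delta v) (fun_calc g G V (delta v)) =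
      (\<Sum>u\<in>verts G. if u = v then fun_calc g G V (delta v) u else 0)"
    unfolding ell2_inner_def by (intro sum.cong) (auto simp: delta_def)
  also have "\<dots> = fun_calc g G V (delta v) v" using v by simp
  also have "\<dots> = (\<Sum>E\<in>eigenvalues G V. \<Sum>j\<in>level E. g (\<mu> j) * of_real ((e j v)\<^sup>2))"
  proof -
    have "fscale (g E) (eigenproj G V E (delta v)) v = (\<Sum>j\<in>level E. g (\<mu> j) * of_real ((e j v)\<^sup>2))" for E
    proof -
      have "eigenproj G V E (delta v) v = (\<Sum>j\<in>level E. of_real ((e j v)\<^sup>2))"
        using v by (simp add: eigenproj_eq[OF dl] sum_fun_apply fscale_def codl ev_def power2_eq_square)
      then show ?thesis by (simp add: fscale_def sum_distrib_left level_def)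
    qed
    then show ?thesis by (simp add: fun_calc_def sum_fun_apply)
  qed
  also have "\<dots> = (\<Sum>i<card (verts G). g (\<mu> i) * of_real ((e i v)\<^sup>2))"
    unfolding eigenvalues_eq level_def
    using sum.image_gen[of "{..<card (verts G)}" "\<lambda>j. g (\<mu> j) * of_real ((e j v)\<^sup>2)" \<mu>]
    by (simp add: Collect_conj_eq lessThan_def)
  finally show ?thesis .
qed

end

text \<open>Polynomial test functions suffice: a non-negative one whose zeros are exactly the given
  points confines the measure to them, and Lagrange interpolation reads off each weight.\<close>

lemma finite_support_of_integrals:
  fixes \<mu> :: "nat \<Rightarrow> real" and w :: "nat \<Rightarrow> real"
  assumes sets: "sets \<sigma> = sets borel"
    and int: "\<And>g :: real \<Rightarrow> complex. continuous_on UNIV g \<Longrightarrow>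
      integrable \<sigma> g \<and> (\<Sum>i<n. g (\<mu> i) * of_real (w i)) = integral\<^sup>L \<sigma> g"
  shows "AE x in \<sigma>. x \<in> \<mu> ` {..<n}"
    and "emeasure \<sigma> {y} = ennreal (\<Sum>i | i < n \<and> \<mu> i = y. w i)"
    and "measure \<sigma> {y} = (\<Sum>i | i < n \<and> \<mu> i = y. w i)"
proof -
  have real: "integrable \<sigma> f \<and> integral\<^sup>L \<sigma> f = (\<Sum>i<n. f (\<mu> i) * w i)"
    if "continuous_on UNIV f" for f :: "real \<Rightarrow> real"
  proof -
    have "continuous_on UNIV (\<lambda>x. complex_of_real (f x))"
      using that by (intro continuous_intros)
    from int[OF this] have "integrable \<sigma> f"
      and "complex_of_real (\<Sum>i<n. f (\<mu> i) * w i) = of_real (integral\<^sup>L \<sigma> f)"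
      by (simp_all add: complex_of_real_integrable_eq)
    then show ?thesis by (simp only: of_real_eq_iff)
  qed
  define F where "F = \<mu> ` {..<n}"
  have F: "finite F" "\<And>i. i < n \<Longrightarrow> \<mu> i \<in> F" by (auto simp: F_def)
  have space: "space \<sigma> = UNIV" using sets_eq_imp_space_eq[OF sets] by simp
  have fin: "finite_measure \<sigma>"
  proof
    have "integrable \<sigma> (\<lambda>_. 1 :: real)" using real[of "\<lambda>_. 1"] by simp
    then show "emeasure \<sigma> (space \<sigma>) \<noteq> \<infinity>" by (simp add: integrable_iff_bounded)
  qed
  then interpret finite_measure \<sigma> .
  define f where "f = (\<lambda>x::real. \<Prod>z\<in>F. (x - z)\<^sup>2)"
  have "continuous_on UNIV f" unfolding f_def by (intro continuous_intros)
  note rf = real[OF this]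
  have "(\<Sum>i<n. f (\<mu> i) * w i) = 0"
    using F by (intro sum.neutral) (auto simp: f_def)
  then have "AE x in \<sigma>. f x = 0"
    using rf integral_nonneg_eq_0_iff_AE[of \<sigma> f] by (auto simp: f_def prod_nonneg)
  then show ae: "AE x in \<sigma>. x \<in> \<mu> ` {..<n}"
    by (rule AE_mp) (use F in \<open>auto simp: f_def F_def\<close>)
  \<comment> \<open>On the finite set \<open>p\<close> is the indicator of \<open>y\<close>. This
    includes a \<open>y\<close> outside the set: then every point of the set makes one factor
    vanish.\<close>
  define p where "p = (\<lambda>x. \<Prod>z\<in>F - {y}. (x - z) / (y - z))"
  have "continuous_on UNIV p" unfolding p_def by (intro continuous_intros) auto
  note rp = real[OF this]
  have pF: "p x = indicator {y} x" if "x \<in> F" for x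
    using that F(1) by (auto simp: p_def indicator_def prod_zero_iff)
  have y: "{y} \<in> sets \<sigma>" by (simp add: sets)
  have "measure \<sigma> {y} = integral\<^sup>L \<sigma> (indicator {y})"
    using y by (simp add: space)
  also have "\<dots> = integral\<^sup>L \<sigma> p"
    using ae pF rp y by (intro integral_cong_AE) (auto simp: F_def elim!: AE_mp)
  also have "\<dots> = (\<Sum>i<n. of_bool (\<mu> i = y) * w i)"
    using rp pF F(2) by (auto intro!: sum.cong simp: indicator_def)
  finally show m: "measure \<sigma> {y} = (\<Sum>i | i < n \<and> \<mu> i = y. w i)"
    by (simp only: sum_of_bool_filter)
  show "emeasure \<sigma> {y} = ennreal (\<Sum>i | i < n \<and> \<mu> i = y. w i)"
    by (simp only: emeasure_eq_measure m)
qed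

text \<open>The weights are put on the indices and pushed forward by \<open>\<mu>\<close>, so
  coinciding eigenvalues merge by themselves.\<close>

lemma atomic_measure_exists:
  fixes \<mu> :: "nat \<Rightarrow> real" and w :: "nat \<Rightarrow> real"
  assumes w: "\<And>i. i < n \<Longrightarrow> 0 \<le> w i"
  shows "\<exists>\<sigma>. sets \<sigma> = sets borel \<and> (\<forall>g :: real \<Rightarrow> complex. continuous_on UNIV g \<longrightarrow>
      integrable \<sigma> g \<and> (\<Sum>i<n. g (\<mu> i) * of_real (w i)) = integral\<^sup>L \<sigma> g)"
proof (intro exI conjI allI impI)
  define P where "P = point_measure {..<n} (\<lambda>i. ennreal (w i))"
  show "sets (distr P borel \<mu>) = sets borel" by simp
  fix g :: "real \<Rightarrow> complex" assume "continuous_on UNIV g"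
  then have g: "g \<in> borel_measurable borel" by (rule borel_measurable_continuous_onI)
  have mu: "\<mu> \<in> measurable P borel" by (auto simp: P_def)
  have "integrable P (\<lambda>i. g (\<mu> i))"
    unfolding P_def integrable_iff_bounded
    by (simp add: nn_integral_point_measure_finite ennreal_mult_less_top)
  then show "integrable (distr P borel \<mu>) g" by (simp add: integrable_distr_eq[OF mu g])
  have "integral\<^sup>L (distr P borel \<mu>) g = (\<Sum>i<n. w i *\<^sub>R g (\<mu> i))"
    unfolding integral_distr[OF mu g] unfolding P_def
    using lebesgue_integral_point_measure_finite[of "{..<n}" w "\<lambda>i. g (\<mu> i)"] w by simp
  then show "(\<Sum>i<n. g (\<mu> i) * of_real (w i)) = integral\<^sup>L (distr P borel \<mu>) g"
    by (simp add: scaleR_conv_of_real mult.commute)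
qed

section \<open>Spectral measures of the Schroedinger operator\<close>

context graph_eigenbasis
begin

text \<open>The definite description is resolved: any two candidates are carried by the finite
  spectrum and have the same atoms there, hence agree on all Borel sets.\<close>

lemma spectral_measure_singleton:
  assumes v: "v \<in> verts G"
  shows "measure (spectral_measure G V v) {E} = (\<Sum>i | i < card (verts G) \<and> \<mu> i = E. (e i v)\<^sup>2)"
proof -
  let ?P = "\<lambda>\<sigma>. sets \<sigma> = sets borel \<and> (\<forall>g :: real \<Rightarrow> complex. continuous_on UNIV g \<longrightarrow>
      integrable \<sigma> g \<and> ell2_inner G (delta v) (fun_calc g G V (delta v)) = integral\<^sup>L \<sigma> g)"
  have ex: "\<exists>\<sigma>. ?P \<sigma>"
    unfolding fun_calc_delta[OF v] by (rule atomic_measure_exists) simp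
  have un: "\<sigma> = \<tau>" if \<sigma>: "?P \<sigma>" and \<tau>: "?P \<tau>" for \<sigma> \<tau>
  proof (rule measure_eqI)
    show "sets \<sigma> = sets \<tau>" using \<sigma> \<tau> by simp
    have eq: "emeasure \<rho> A = (\<Sum>y\<in>A \<inter> \<mu> ` {..<card (verts G)}. ennreal (\<Sum>i | i < card (verts G) \<and> \<mu> i = y. (e i v)\<^sup>2))"
      if \<rho>: "?P \<rho>" and A: "A \<in> sets borel" for \<rho> A
    proof -
      let ?F = "\<mu> ` {..<card (verts G)}"
      have s: "sets \<rho> = sets borel" using \<rho> by simp
      have int: "integrable \<rho> g \<and> (\<Sum>i<card (verts G). g (\<mu> i) * of_real ((e i v)\<^sup>2)) = integral\<^sup>L \<rho> g"
        if "continuous_on UNIV g" for g :: "real \<Rightarrow> complex"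
        using \<rho> that unfolding fun_calc_delta[OF v] by blast
      have F: "A \<inter> ?F \<in> sets borel" by (intro sets.Int A borel_closed finite_imp_closed) auto
      have "emeasure \<rho> A = emeasure \<rho> (A \<inter> ?F)"
        using finite_support_of_integrals(1)[OF s int] A F s
        by (intro emeasure_eq_AE) (auto elim!: AE_mp)
      also have "\<dots> = (\<Sum>y\<in>A \<inter> ?F. emeasure \<rho> {y})"
        using s by (intro emeasure_eq_sum_singleton) auto
      finally show ?thesis by (simp only: finite_support_of_integrals(2)[OF s int])
    qed
    show "emeasure \<sigma> A = emeasure \<tau> A" if "A \<in> sets \<sigma>" for A
      using that \<sigma> eq[OF \<sigma>, of A] eq[OF \<tau>, of A] by simp
  qed
  have "?P (spectral_measure G V v)"
    unfolding spectral_measure_def by (rule theI') (use ex un in blast)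
  then have s: "sets (spectral_measure G V v) = sets borel"
    and int: "\<And>g :: real \<Rightarrow> complex. continuous_on UNIV g \<Longrightarrow> integrable (spectral_measure G V v) g \<and>
      (\<Sum>i<card (verts G). g (\<mu> i) * of_real ((e i v)\<^sup>2)) = integral\<^sup>L (spectral_measure G V v) g"
    unfolding fun_calc_delta[OF v] by blast+
  show ?thesis by (rule finite_support_of_integrals(3)[OF s int])
qed

lemma atom_vertices_eq:
  "atom_vertices \<epsilon> (verts G) e \<mu> = {v \<in> verts G. \<exists>E. \<epsilon> < measure (spectral_measure G V v) {E}}"
  unfolding atom_vertices_def using spectral_measure_singleton by auto

end

section \<open>From the integrated density of states to delocalization\<close>

lemma modulus_small:
  assumes "modulus_of_continuity \<omega>" "0 < c"
  obtains t where "0 < t" "\<omega> t < ennreal c"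
proof -
  have "(\<omega> \<longlongrightarrow> 0) (at_right 0)" using assms(1) by (simp add: modulus_of_continuity_def)
  then have "\<forall>\<^sub>F t in at_right 0. \<omega> t < ennreal c"
    using assms(2) by (intro order_tendstoD) auto
  then obtain b where "0 < b" "\<And>t. 0 < t \<Longrightarrow> t < b \<Longrightarrow> \<omega> t < ennreal c"
    unfolding eventually_at_right_field by blast
  then show ?thesis using that[of "b / 2"] by auto
qed

text \<open>The fraction of eigenvalues in an interval is an increment of the IDS, at most the
  increment of the approximant \<open>g\<close> plus twice the approximation error. Each of the
  three terms is at most \<open>c / 4\<close>.\<close>

lemma sparse_spectrum_of_IDS:
  assumes G: "\<And>G. G \<in> \<F> \<Longrightarrow> graph G" and mod: "modulus_of_continuity \<omega>"
    and ids: "asymptotically_uniformly_continuous_IDSs lam \<omega> \<F>" and c: "0 < c"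
  shows "\<exists>\<eta>>0. \<exists>N. \<forall>G W. G \<in> \<F> \<longrightarrow> N \<le> card (verts G) \<longrightarrow> (\<forall>v\<in>verts G. \<bar>W v\<bar> \<le> lam) \<longrightarrow>
    sparse_spectrum (verts G) (add_potential (kinetic G) W) \<eta> c"
proof -
  obtain t where t: "0 < t" "\<omega> t < ennreal (c / 4)"
    using modulus_small[OF mod, of "c / 4"] c by auto
  have "0 < c / 4" using c by simp
  then obtain N :: nat where N: "quasi_uniformly_continuous (c / 4) \<omega>
      {IDS V G | V G. G \<in> \<F> \<and> N \<le> card (verts G) \<and> V \<in> verts G \<rightarrow> {-lam..lam}}"
    using ids unfolding asymptotically_uniformly_continuous_IDSs_def by blast
  have "sparse_spectrum (verts G) (add_potential (kinetic G) W) (t / 2) c"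
    if GF: "G \<in> \<F>" and n: "N \<le> card (verts G)" and W: "\<forall>v\<in>verts G. \<bar>W v\<bar> \<le> lam" for G W
    unfolding sparse_spectrum_def
  proof (intro allI impI)
    fix e \<mu> z assume eb: "eigenbasis (verts G) (add_potential (kinetic G) W) e \<mu>"
    interpret graph G by (rule G[OF GF])
    interpret graph_eigenbasis G W e \<mu> by unfold_locales (rule eb)
    have "W \<in> verts G \<rightarrow> {-lam..lam}" using W by (auto simp: abs_le_iff)
    then obtain g where g: "modulus_uniformly_continuous \<omega> g" "\<And>x. \<bar>IDS W G x - g x\<bar> \<le> c / 4"
      using N GF n unfolding quasi_uniformly_continuous_def by blast
    \<comment> \<open>The window of radius \<open>t / 2\<close> around \<open>z\<close> lies between
      \<open>x\<close> and \<open>x + t\<close>, where the IDS is compared.\<close>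
    define x where "x = z - t / 2"
    have "ennreal \<bar>g (x + t) - g x\<bar> \<le> \<omega> \<bar>x + t - x\<bar>"
      using g(1) t(1) unfolding modulus_uniformly_continuous_def by (metis add_cancel_left_right less_irrefl)
    then have "ennreal \<bar>g (x + t) - g x\<bar> < ennreal (c / 4)"
      using t by auto
    then have "\<bar>g (x + t) - g x\<bar> < c / 4" by (simp add: ennreal_less_iff)
    then have d: "IDS W G (x + t) - IDS W G x \<le> c"
      using g(2)[of x] g(2)[of "x + t"] c by linarith
    show "real (card {i. i < card (verts G) \<and> \<bar>\<mu> i - z\<bar> < t / 2}) \<le> c * real (card (verts G))"
    proof (cases "card (verts G) = 0")
      case False
      let ?A = "{i. i < card (verts G) \<and> \<mu> i \<le> x}" and ?B = "{i. i < card (verts G) \<and> \<mu> i \<le> x + t}"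
      have AB: "card ?A \<le> card ?B" using t by (intro card_mono) auto
      have "card {i. i < card (verts G) \<and> \<bar>\<mu> i - z\<bar> < t / 2} \<le> card (?B - ?A)"
      proof (rule card_mono)
        show "{i. i < card (verts G) \<and> \<bar>\<mu> i - z\<bar> < t / 2} \<subseteq> ?B - ?A"
        proof
          fix i assume i: "i \<in> {i. i < card (verts G) \<and> \<bar>\<mu> i - z\<bar> < t / 2}"
          then have "\<bar>\<mu> i - z\<bar> < t / 2" by simp
          then have "x < \<mu> i" "\<mu> i \<le> x + t" unfolding x_def by linarith+
          then show "i \<in> ?B - ?A" using i by auto
        qed
      qed auto
      also have "\<dots> = card ?B - card ?A" using t by (intro card_Diff_subset) auto
      finally have "real (card {i. i < card (verts G) \<and> \<bar>\<mu> i - z\<bar> < t / 2}) \<le> real (card ?B) - real (card ?A)"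
        using AB by linarith
      also have "\<dots> = (IDS W G (x + t) - IDS W G x) * card (verts G)"
        using False by (simp add: IDS_eq field_simps)
      also have "\<dots> \<le> c * card (verts G)" using d by (intro mult_right_mono) auto
      finally show ?thesis .
    qed simp
  qed
  then show ?thesis using t(1) by (intro exI[of _ "t / 2"] conjI exI[of _ N]) auto
qed

theorem theorem3p1p1:
  fixes \<F> :: "('a, 'b) pre_digraph set"
  assumes "\<And>G. G \<in> \<F> \<Longrightarrow> graph G"
    and "\<exists>D::nat. \<forall>G\<in>\<F>. \<forall>v\<in>verts G. out_degree G v \<le> D"
    and "\<And> lam::real. lam > 0 \<Longrightarrow>
           \<exists>\<omega>. modulus_of_continuity \<omega> \<and> asymptotically_uniformly_continuous_IDSs lam \<omega> \<F>"
  shows "asymptotically_dense_delocalization \<F>"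
  unfolding asymptotically_dense_delocalization_def
proof (intro allI impI)
  fix lam \<epsilon> \<delta> :: real
  assume lam: "0 < lam" and eps: "0 < \<epsilon>" and del: "0 < \<delta>"
  obtain D :: nat where D: "\<And>G v. G \<in> \<F> \<Longrightarrow> v \<in> verts G \<Longrightarrow> out_degree G v \<le> D"
    using assms(2) by blast
  obtain \<omega> where \<omega>: "modulus_of_continuity \<omega>" "asymptotically_uniformly_continuous_IDSs lam \<omega> \<F>"
    using assms(3)[OF lam] by blast
  \<comment> \<open>The cluster estimates want a threshold of at most 1; lowering it only enlarges
    the set of vertices counted as bad.\<close>
  define \<epsilon>' where "\<epsilon>' = min \<epsilon> 1"
  \<comment> \<open>The potential moves by at most \<open>\<beta>\<close> when it is clipped and by
    at most \<open>\<beta>\<close> again in the iteration, and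
    \<open>2 * \<beta> < \<delta>\<close>.\<close>
  define \<beta> where "\<beta> = min (lam / 2) (\<delta> / 3)"
  have eps': "0 < \<epsilon>'" "\<epsilon>' \<le> 1" "\<epsilon>' \<le> \<epsilon>" using eps by (auto simp: \<epsilon>'_def)
  have beta: "0 < \<beta>" "\<beta> \<le> lam / 2" "\<beta> \<le> \<delta> / 3" using lam del by (auto simp: \<beta>_def)
  define \<S> where "\<S> = (\<lambda>G. (verts G, kinetic G)) ` \<F>"
  have "\<exists>N. \<forall>S B V. (S, B) \<in> \<S> \<longrightarrow> N < card S \<longrightarrow> (\<forall>v\<in>S. \<bar>V v\<bar> + \<beta> \<le> lam) \<longrightarrow>
    (\<exists>W e \<mu>. (\<forall>v\<in>S. \<bar>V v - W v\<bar> \<le> \<beta>) \<and> eigenbasis S (add_potential B W) e \<mu> \<and>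
      card (atom_vertices \<epsilon>' S e \<mu>) < \<delta> * card S)"
  proof (rule dense_delocalization_of_sparse_spectrum[OF eps'(1,2) del beta(1), where D = "2 * real D"])
    fix S B assume "(S, B) \<in> \<S>"
    then obtain G where G: "G \<in> \<F>" "S = verts G" "B = kinetic G" by (auto simp: \<S>_def)
    interpret graph G by (rule assms(1)[OF G(1)])
    have "(\<Sum>u\<in>verts G. \<bar>kinetic G v u\<bar>) \<le> 2 * real D" if "v \<in> verts G" for v
      using kinetic_row[OF that] D[OF G(1) that] by linarith
    then show "finite S \<and> symmetric_on S B \<and> (\<forall>v\<in>S. (\<Sum>u\<in>S. \<bar>B v u\<bar>) \<le> 2 * real D)"
      using symmetric_kinetic by (simp add: G)
  next
    fix c :: real assume "0 < c"
    from sparse_spectrum_of_IDS[OF assms(1) \<omega> this]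
    obtain \<eta> N where "0 < \<eta>" and N: "\<And>G W. G \<in> \<F> \<Longrightarrow> N \<le> card (verts G) \<Longrightarrow>
        (\<forall>v\<in>verts G. \<bar>W v\<bar> \<le> lam) \<Longrightarrow> sparse_spectrum (verts G) (add_potential (kinetic G) W) \<eta> c"
      by blast
    then show "\<exists>\<eta>>0. \<exists>N. \<forall>S B W. (S, B) \<in> \<S> \<longrightarrow> N \<le> card S \<longrightarrow> (\<forall>v\<in>S. \<bar>W v\<bar> \<le> lam) \<longrightarrow>
        sparse_spectrum S (add_potential B W) \<eta> c"
      by (intro exI[of _ \<eta>] conjI exI[of _ N]) (auto simp: \<S>_def)
  qed
  then obtain N where N: "\<forall>S B V. (S, B) \<in> \<S> \<longrightarrow> N < card S \<longrightarrow> (\<forall>v\<in>S. \<bar>V v\<bar> + \<beta> \<le> lam) \<longrightarrow>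
    (\<exists>W e \<mu>. (\<forall>v\<in>S. \<bar>V v - W v\<bar> \<le> \<beta>) \<and> eigenbasis S (add_potential B W) e \<mu> \<and>
      card (atom_vertices \<epsilon>' S e \<mu>) < \<delta> * card S)"
    by (elim exE)
  have "\<exists>W \<in> verts G \<rightarrow> {-lam..lam}. (\<forall>v\<in>verts G. \<bar>V v - W v\<bar> < \<delta>) \<and>
      real (card {v \<in> verts G. \<not> (\<exists>E. measure (spectral_measure G W v) {E} > \<epsilon>)})
        \<ge> (1 - \<delta>) * real (card (verts G))"
    if G: "G \<in> \<F>" and V: "V \<in> verts G \<rightarrow> {-lam..lam}" and n: "Suc N < card (verts G)" for G V
  proof -
    \<comment> \<open>Clipping to the range from \<open>\<beta> - lam\<close> to
      \<open>lam - \<beta>\<close>, non-empty as \<open>\<beta> \<le> lam / 2\<close>, provides the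
      margin that the iteration uses up.\<close>
    define V' where "V' = (\<lambda>v. max (\<beta> - lam) (min (lam - \<beta>) (V v)))"
    have V': "\<bar>V' v\<bar> + \<beta> \<le> lam" "\<bar>V v - V' v\<bar> \<le> \<beta>" if "v \<in> verts G" for v
    proof -
      have "- lam \<le> V v" "V v \<le> lam" using V that by auto
      then show "\<bar>V' v\<bar> + \<beta> \<le> lam" "\<bar>V v - V' v\<bar> \<le> \<beta>"
        using beta lam unfolding V'_def by linarith+
    qed
    obtain W e \<mu> where W: "\<And>v. v \<in> verts G \<Longrightarrow> \<bar>V' v - W v\<bar> \<le> \<beta>"
      and eb: "eigenbasis (verts G) (add_potential (kinetic G) W) e \<mu>"
      and few: "card (atom_vertices \<epsilon>' (verts G) e \<mu>) < \<delta> * card (verts G)"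
    proof -
      have "(verts G, kinetic G) \<in> \<S>" "N < card (verts G)" "\<forall>v\<in>verts G. \<bar>V' v\<bar> + \<beta> \<le> lam"
        using G n V'(1) by (auto simp: \<S>_def)
      note prems = this
      from mp[OF mp[OF mp[OF spec[OF spec[OF spec[OF N, of "verts G"], of "kinetic G"], of V']
            prems(1)] prems(2)] prems(3)]
      show ?thesis using that by blast
    qed
    interpret graph G by (rule assms(1)[OF G])
    interpret graph_eigenbasis G W e \<mu> by unfold_locales (rule eb)
    have Wlam: "\<bar>W v\<bar> \<le> lam" if "v \<in> verts G" for v using W[OF that] V'(1)[OF that] by linarith
    have close: "\<bar>V v - W v\<bar> < \<delta>" if "v \<in> verts G" for v
      using W[OF that] V'(2)[OF that] beta del by linarith
    let ?bad = "atom_vertices \<epsilon>' (verts G) e \<mu>"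
    have "verts G - ?bad \<subseteq> {v \<in> verts G. \<not> (\<exists>E. measure (spectral_measure G W v) {E} > \<epsilon>)}"
      unfolding atom_vertices_eq using le_less_trans[OF eps'(3)] by blast
    then have "card (verts G - ?bad) \<le> card {v \<in> verts G. \<not> (\<exists>E. measure (spectral_measure G W v) {E} > \<epsilon>)}"
      by (intro card_mono) auto
    moreover have "real (card (verts G - ?bad)) = real (card (verts G)) - real (card ?bad)"
    proof -
      have "?bad \<subseteq> verts G" by (auto simp: atom_vertices_def)
      then show ?thesis by (simp add: card_Diff_subset finite_subset card_mono of_nat_diff)
    qed
    ultimately have "(1 - \<delta>) * real (card (verts G)) \<le>
        real (card {v \<in> verts G. \<not> (\<exists>E. measure (spectral_measure G W v) {E} > \<epsilon>)})"
      using few by (simp add: left_diff_distrib)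
    moreover have "W \<in> verts G \<rightarrow> {-lam..lam}" using Wlam by (auto simp: abs_le_iff minus_le_iff)
    ultimately show ?thesis using close by blast
  qed
  then show "\<exists>N>0. \<forall>G\<in>\<F>. \<forall>V\<in>verts G \<rightarrow> {-lam..lam}. card (verts G) > N \<longrightarrow>
      (\<exists>W\<in>verts G \<rightarrow> {-lam..lam}. (\<forall>v\<in>verts G. \<bar>V v - W v\<bar> < \<delta>) \<and>
        real (card {v \<in> verts G. \<not> (\<exists>E. measure (spectral_measure G W v) {E} > \<epsilon>)})
          \<ge> (1 - \<delta>) * real (card (verts G)))"
    \<comment> \<open>The successor makes the threshold positive.\<close>
    by (intro exI[of _ "Suc N"]) auto
qed

end
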